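(* Let $X$ be a (non-Euclidean) analytic normed plane, choose any non-zero point $z\in X$, and let $f:\mathbb{T}\to S_{\|z\|}[0]$ be an analytic bijective map with $f(0)=z$ and $\|f'(t)\|=1$ for all $t\in\mathbb{T}$. Then there exists a unique continuous map $r_z:X\times\mathbb{T}\to X$ with the following properties: (i) $r_z(z,t)=f(t)$ for all $t\in\mathbb{T}$. (ii) $r_z(x,0)=x$ for all $x\in X$. (iii) $\|r_z(x,t)\|=\|x\|$ and $\|r_z(x,t)-r_z(z,t)\|=\|x-z\|$ for all $x\in X$ and $t\in\mathbb{T}$. Furthermore, the map $r_z$ will have the following properties: (1) $r_z$ is analytic on the set $(X\setminus\operatorname{span}\{z\})\times\mathbb{T}$. (2) For any $x,y\in X\setminus\operatorname{span}\{z\}$ and any $t\in\mathbb{T}$, $x,y$ lie in the same connected component of $X\setminus\operatorname{span}\{z\}$ if and only if $r_z(x,t),r_z(y,t)$ lie in the same connected component of $X\setminus\operatorname{span}\{f(t)\}$. (3) For any $t\in\mathbb{T}$, $r_z(\cdot,t)$ is a homeomorphism. (4) For any non-zero $x\in X$, $r_z(x,\cdot)$ is a homeomorphism between $\mathbb{T}$ and $S_{\|x\|}[0]$. (5) For any $x\in X$ and any $t\in\mathbb{T}$, $r_z(x,-t)=-r_z(x,t)$.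
   Context: A normed plane is a $2$-dimensional real normed space. It is analytic if the restriction of its norm to $X\setminus\{0\}$ is a real analytic function (in linear coordinates), and non-Euclidean if its norm does not come from an inner product. $\mathbb{T}=\mathbb{R}/2\pi\mathbb{Z}$ is the circle group, represented by the set $[0,2\pi)$, with the topology given by the metric $d_{\mathbb{T}}(s,t)=\min\{|s-t|,2\pi-|s-t|\}$. $S_r[0]=\{x\in X:\|x\|=r\}$ is the sphere of radius $r$ centred at the origin. The map $f$ is analytic as a map into $X$, and $f'$ is its derivative.
   Formalization: Property (5) is stated and proved as r_z(x,t+π) = −r_z(x,t), with −t read as the point of the circle opposite to t; with −t the group inverse it would contradict (ii) at t = 0, giving x = −x. *)

theory Defs
  imports "HOL-Analysis.Analysis" "HOL-Library.Real_Mod"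
begin

section \<open>The circle group\<close>

typedef circle = "{0..<2 * pi}"
  morphisms circle_rep Abs_circle
  by (rule exI[of _ 0]) simp

(* The quotient map from the real line onto R/2piZ. *)
definition circle_of :: "real \<Rightarrow> circle" where
  "circle_of s = Abs_circle (s rmod (2 * pi))"

lemma circle_rep_bounds: "0 \<le> circle_rep t" "circle_rep t < 2 * pi"
  using circle_rep[of t] by auto

lemma circle_rep_circle_of: "circle_rep (circle_of s) = s rmod (2 * pi)"
  unfolding circle_of_def
  by (rule Abs_circle_inverse) (simp add: rmod_less rmod_nonneg)

lemma circle_of_circle_rep [simp]: "circle_of (circle_rep t) = t"
  unfolding circle_of_def using circle_rep_bounds[of t]
  by (subst rmod_idem) (simp_all add: circle_rep_inverse)

lemma circle_of_eq_iff: "circle_of s = circle_of s' \<longleftrightarrow> (\<exists>n::int. s' = s + of_int n * (2 * pi))"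
proof -
  have "circle_of s = circle_of s' \<longleftrightarrow> [s = s'] (rmod (2 * pi))"
    by (metis circle_rep_circle_of circle_of_def rcong_def)
  then show ?thesis by (simp add: rcong_altdef)
qed

instantiation circle :: metric_space
begin

definition dist_circle :: "circle \<Rightarrow> circle \<Rightarrow> real" where
  "dist_circle s t = min \<bar>circle_rep s - circle_rep t\<bar> (2 * pi - \<bar>circle_rep s - circle_rep t\<bar>)"

definition uniformity_circle :: "(circle \<times> circle) filter" where
  "uniformity_circle = (INF e\<in>{0 <..}. principal {(x, y). dist x y < e})"

definition open_circle :: "circle set \<Rightarrow> bool" where
  "open_circle U \<longleftrightarrow> (\<forall>x\<in>U. eventually (\<lambda>(x', y). x' = x \<longrightarrow> y \<in> U) uniformity)"

instance
proof
  fix x y z :: circle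
  note b = circle_rep_bounds[of x] circle_rep_bounds[of y] circle_rep_bounds[of z]
  have "circle_rep x = circle_rep y \<longleftrightarrow> x = y"
    by (simp add: circle_rep_inject)
  then show "dist x y = 0 \<longleftrightarrow> x = y"
    using b unfolding dist_circle_def min_def abs_if by auto
  show "dist x y \<le> dist x z + dist y z"
    using b unfolding dist_circle_def min_def abs_if by (auto; linarith)
qed (simp_all add: uniformity_circle_def open_circle_def)

end

instantiation circle :: ab_group_add
begin

definition zero_circle :: circle where "zero_circle = circle_of 0"
definition plus_circle :: "circle \<Rightarrow> circle \<Rightarrow> circle" where
  "plus_circle s t = circle_of (circle_rep s + circle_rep t)"
definition uminus_circle :: "circle \<Rightarrow> circle" where
  "uminus_circle t = circle_of (- circle_rep t)"
definition minus_circle :: "circle \<Rightarrow> circle \<Rightarrow> circle" where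
  "minus_circle s t = circle_of (circle_rep s - circle_rep t)"

lemma circle_of_rmod: "circle_of (s rmod (2 * pi)) = circle_of s"
  by (simp add: circle_of_def)

lemma circle_of_add: "circle_of a + circle_of b = circle_of (a + b)"
  unfolding plus_circle_def circle_rep_circle_of by (metis circle_of_rmod rmod_add)

lemma circle_of_diff: "circle_of a - circle_of b = circle_of (a - b)"
  unfolding minus_circle_def circle_rep_circle_of by (metis circle_of_rmod rmod_diff)

lemma circle_of_minus: "- circle_of a = circle_of (- a)"
  using circle_of_diff[of 0 a]
  unfolding uminus_circle_def minus_circle_def by (simp add: circle_rep_circle_of)

instance
proof
  fix a b c :: circle
  have *: "\<exists>s. t = circle_of s" for t by (metis circle_of_circle_rep)
  obtain a' b' c' where [simp]: "a = circle_of a'" "b = circle_of b'" "c = circle_of c'"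
    using * by metis
  show "a + b + c = a + (b + c)" by (simp add: circle_of_add add.assoc)
  show "a + b = b + a" by (simp add: circle_of_add add.commute)
  show "0 + a = a" by (simp add: zero_circle_def circle_of_add)
  show "- a + a = 0" by (simp add: zero_circle_def circle_of_add circle_of_minus)
  show "a - b = a + - b" by (simp add: circle_of_add circle_of_minus circle_of_diff)
qed

end

(* The point opposite to t.  This is not the group inverse - t, which fixes 0. *)
definition antipode :: "circle \<Rightarrow> circle" where
  "antipode t = t + circle_of pi"


section \<open>Real analytic maps\<close>

(* Linear coordinates on the domain are given by a basis B; multi-indices are the
   extensional functions from B to nat.  The power series converges unconditionally
   on a neighbourhood of each point of the open set U. *)
definition real_analytic_on ::
  "('a::real_normed_vector \<Rightarrow> 'b::real_normed_vector) \<Rightarrow> 'a set \<Rightarrow> bool" where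
  "real_analytic_on g U \<longleftrightarrow> open U \<and>
     (\<exists>B. finite B \<and> independent B \<and> span B = UNIV \<and>
       (\<forall>a\<in>U. \<exists>\<epsilon>>0. \<exists>c :: ('a \<Rightarrow> nat) \<Rightarrow> 'b. \<forall>x\<in>ball a \<epsilon>.
          ((\<lambda>\<alpha>. (\<Prod>b\<in>B. representation B (x - a) b ^ \<alpha> b) *\<^sub>R c \<alpha>) has_sum g x)
            (B \<rightarrow>\<^sub>E UNIV)))"

(* Analyticity and derivative on the circle are taken in the angle coordinate, whose local
   inverses are the branches of circle_of. *)
definition circle_analytic :: "(circle \<Rightarrow> 'b::real_normed_vector) \<Rightarrow> bool" where
  "circle_analytic f \<longleftrightarrow> real_analytic_on (\<lambda>s::real. f (circle_of s)) UNIV"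

definition circle_deriv :: "(circle \<Rightarrow> 'b::real_normed_vector) \<Rightarrow> circle \<Rightarrow> 'b" where
  "circle_deriv f t = vector_derivative (\<lambda>s::real. f (circle_of s)) (at (circle_rep t))"

definition analytic_on_times_circle ::
  "('a::real_normed_vector \<times> circle \<Rightarrow> 'b::real_normed_vector) \<Rightarrow> 'a set \<Rightarrow> bool" where
  "analytic_on_times_circle r U \<longleftrightarrow>
     real_analytic_on (\<lambda>(x, s::real). r (x, circle_of s)) (U \<times> UNIV)"


section \<open>Normed planes\<close>

definition normed_plane :: "'a::real_normed_vector itself \<Rightarrow> bool" where
  "normed_plane _ \<longleftrightarrow> dim (UNIV :: 'a set) = 2"

definition analytic_norm :: "'a::real_normed_vector itself \<Rightarrow> bool" where
  "analytic_norm _ \<longleftrightarrow> real_analytic_on (norm :: 'a \<Rightarrow> real) (UNIV - {0})"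

definition euclidean_norm :: "'a::real_normed_vector itself \<Rightarrow> bool" where
  "euclidean_norm _ \<longleftrightarrow>
     (\<exists>ip :: 'a \<Rightarrow> 'a \<Rightarrow> real. bilinear ip \<and> (\<forall>x y. ip x y = ip y x) \<and>
        (\<forall>x. x \<noteq> 0 \<longrightarrow> ip x x > 0) \<and> (\<forall>x. norm x = sqrt (ip x x)))"

definition rotation_map ::
  "'a::real_normed_vector \<Rightarrow> (circle \<Rightarrow> 'a) \<Rightarrow> ('a \<times> circle \<Rightarrow> 'a) \<Rightarrow> bool" where
  "rotation_map z f r \<longleftrightarrow> continuous_on UNIV r \<and>
     (\<forall>t. r (z, t) = f t) \<and>
     (\<forall>x. r (x, 0) = x) \<and>
     (\<forall>x t. norm (r (x, t)) = norm x \<and> norm (r (x, t) - r (z, t)) = norm (x - z))"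

end

theory Submission
  imports Defs "HOL-Complex_Analysis.Cauchy_Integral_Formula"
begin

text \<open>
  The point \<open>r (x, t)\<close> has to lie to \<open>f t\<close> as \<open>x\<close> lies to \<open>z\<close>: the triangles \<open>0, f t, r (x, t)\<close> and \<open>0, z, x\<close>
  have equal sides. An analytic norm is strictly convex (\<open>strictly_convex\<close>), because a norm that is
  constant on a segment would be constant on the whole line. In a strictly convex plane there is
  exactly one point with the given distances on each side of the line through \<open>0\<close> and \<open>f t\<close>
  (\<open>isosceles_unique\<close>, \<open>congruent_exists\<close>), and points of \<open>span {z}\<close> can only go to the corresponding
  points of \<open>span {f t}\<close>. A continuous \<open>r\<close> cannot change sides while \<open>t\<close> runs through the connected
  circle (\<open>rotation_map_unique\<close>). So \<open>r (x, t)\<close> is the point \<open>transport z (f t) x\<close> that completes the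
  congruent triangle of the same orientation. Congruence is a closed relation and balls are compact,
  which makes \<open>transport\<close> continuous (\<open>transport_continuous\<close>).

  The homeomorphisms come from the symmetry of congruence. Exchanging the triangles inverts
  \<open>transport z (f t)\<close>; exchanging the vertices \<open>f t\<close> and \<open>r (x, t)\<close> of one triangle shows that each
  point of the sphere is reached for exactly one \<open>t\<close>. For the antipodes, \<open>- f t = f (antipode t)\<close> is what
  is needed: the involution of the circle that corresponds to negation is an isometry, as \<open>f\<close> has unit
  speed, and it is free of fixed points (\<open>unit_speed_antipode\<close>).

  For analyticity, write \<open>r (x, t)\<close> as \<open>norm x / norm z\<close> times \<open>f\<close> at an angle. This angle solves a single
  real equation, prescribing the distance to \<open>f t\<close>, and the implicit function theorem
  (\<open>analytic_germ_implicit\<close>) applies as soon as moving along the sphere changes this distance to first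
  order. Otherwise the tangent of the sphere at \<open>p = r (x, t)\<close> would be Birkhoff-orthogonal both to \<open>p\<close> and
  to \<open>p - f t\<close>, which strict convexity forbids unless \<open>p\<close> lies in \<open>span {f t}\<close>
  (\<open>distance_along_sphere_nonstationary\<close>). The implicit function theorem itself is the contraction
  principle in the algebra of absolutely convergent power series on a polydisc, normed by the
  weighted sum of the coefficients.
\<close>

section \<open>Absolutely convergent power series\<close>

definition monomial :: "'i set \<Rightarrow> ('i \<Rightarrow> real) \<Rightarrow> ('i \<Rightarrow> nat) \<Rightarrow> real" where
  "monomial I y \<alpha> = (\<Prod>i\<in>I. y i ^ \<alpha> i)"

text \<open>
  The bound \<open>C\<close> is on the weighted \<open>\<ell>\<^sup>1\<close>-norm of the coefficients, not on the values of
  \<open>h\<close>. Variables are indexed by an arbitrary set \<open>I\<close> and the functions are total on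
  \<open>'i \<Rightarrow> real\<close>, so that power series in different numbers of variables can be mixed freely.
\<close>

definition expansion ::
  "'i set \<Rightarrow> real \<Rightarrow> (('i \<Rightarrow> nat) \<Rightarrow> real) \<Rightarrow> (('i \<Rightarrow> real) \<Rightarrow> real) \<Rightarrow> real \<Rightarrow> bool" where
  "expansion I \<rho> c h C \<longleftrightarrow>
     (\<exists>D\<le>C. ((\<lambda>\<alpha>. \<bar>c \<alpha>\<bar> * \<rho> ^ sum \<alpha> I) has_sum D) (I \<rightarrow>\<^sub>E UNIV)) \<and>
     (\<forall>y. (\<forall>i\<in>I. \<bar>y i\<bar> \<le> \<rho>) \<longrightarrow> ((\<lambda>\<alpha>. c \<alpha> * monomial I y \<alpha>) has_sum h y) (I \<rightarrow>\<^sub>E UNIV))"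

text \<open>
  For fixed \<open>I\<close> and \<open>\<rho>\<close> the functions with such a bound form a Banach algebra, with the least
  possible \<open>C\<close> as norm. This algebra carries all of the analytic part of the proof: substitution and
  the solution of equations become norm estimates.
\<close>

definition majorized :: "'i set \<Rightarrow> real \<Rightarrow> (('i \<Rightarrow> real) \<Rightarrow> real) \<Rightarrow> real \<Rightarrow> bool" where
  "majorized I \<rho> h C \<longleftrightarrow> (\<exists>c. expansion I \<rho> c h C)"

lemma monomial_bound:
  assumes "\<forall>i\<in>I. \<bar>y i\<bar> \<le> \<rho>"
  shows "\<bar>monomial I y \<alpha>\<bar> \<le> \<rho> ^ sum \<alpha> I"
proof -
  have "\<bar>monomial I y \<alpha>\<bar> = (\<Prod>i\<in>I. \<bar>y i\<bar> ^ \<alpha> i)"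
    by (simp add: monomial_def abs_prod power_abs)
  also have "\<dots> \<le> (\<Prod>i\<in>I. \<rho> ^ \<alpha> i)"
    using assms by (intro prod_mono) (auto intro!: power_mono)
  also have "\<dots> = \<rho> ^ sum \<alpha> I"
    by (simp add: power_sum)
  finally show ?thesis .
qed

lemma monomial_restrict [simp]: "monomial I y (restrict \<alpha> I) = monomial I y \<alpha>"
  by (simp add: monomial_def)

lemma monomial_zero: "monomial I y (\<lambda>_. 0) = 1"
  by (simp add: monomial_def)

text \<open>
  A function may be presented by any absolutely summable family of monomials, with repetitions:
  collecting the terms of equal exponent only decreases the norm. Sums, products and
  substitutions thus need no convolution of coefficients; it is enough to index their terms by disjoint
  unions and products of the index sets.
\<close>

lemma majorizedI_family:
  fixes a :: "'k \<Rightarrow> real" and e :: "'k \<Rightarrow> 'i \<Rightarrow> nat"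
  assumes \<rho>: "\<rho> > 0"
    and bound: "((\<lambda>k. \<bar>a k\<bar> * \<rho> ^ sum (e k) I) has_sum D) K" "D \<le> C"
    and val: "\<And>y. (\<forall>i\<in>I. \<bar>y i\<bar> \<le> \<rho>) \<Longrightarrow> ((\<lambda>k. a k * monomial I y (e k)) has_sum h y) K"
  shows "majorized I \<rho> h C"
proof -
  define P where "P = (I \<rightarrow>\<^sub>E (UNIV :: nat set))"
  define e' where "e' k = restrict (e k) I" for k
  \<comment> \<open>the terms that contribute to the exponent \<open>\<alpha>\<close>\<close>
  define F where "F \<alpha> = {k\<in>K. e' k = \<alpha>}" for \<alpha>
  define c where "c \<alpha> = infsum a (F \<alpha>)" for \<alpha>
  have sum_e': "sum (e' k) I = sum (e k) I" for k
    by (rule sum.cong) (auto simp: e'_def)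
  have bij: "bij_betw snd (Sigma P F) K"
    by (rule bij_betw_byWitness[where f' = "\<lambda>k. (e' k, k)"]) (auto simp: F_def P_def e'_def)
  have S: "((\<lambda>p. \<bar>a (snd p)\<bar> * \<rho> ^ sum (e (snd p)) I) has_sum D) (Sigma P F)"
    using has_sum_reindex_bij_betw[OF bij, of "\<lambda>k. \<bar>a k\<bar> * \<rho> ^ sum (e k) I" D] bound(1) by simp
  have fib: "(\<lambda>k. \<bar>a k\<bar>) summable_on F \<alpha>" for \<alpha>
  proof -
    have "(\<lambda>k. \<bar>a k\<bar> * \<rho> ^ sum (e k) I) summable_on F \<alpha>"
      using bound(1) by (intro summable_on_subset_banach[OF has_sum_imp_summable[OF bound(1)]]) (auto simp: F_def)
    then have "(\<lambda>k. \<bar>a k\<bar> * \<rho> ^ sum \<alpha> I) summable_on F \<alpha>"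
      by (rule summable_on_cong[THEN iffD1, rotated]) (use sum_e' in \<open>auto simp: F_def\<close>)
    then show ?thesis
      using \<rho> summable_on_cmult_left'[of "\<rho> ^ sum \<alpha> I" "\<lambda>k. \<bar>a k\<bar>" "F \<alpha>"] by simp
  qed
  have fib_a: "a summable_on F \<alpha>" for \<alpha>
    using fib[of \<alpha>] by (subst summable_on_iff_abs_summable_on_real) simp
  have c: "(a has_sum c \<alpha>) (F \<alpha>)" for \<alpha>
    unfolding c_def using fib_a by simp
  define b where "b \<alpha> = infsum (\<lambda>k. \<bar>a k\<bar>) (F \<alpha>) * \<rho> ^ sum \<alpha> I" for \<alpha>
  have "(b has_sum D) P"
  proof (rule has_sum_SigmaD[OF S])
    fix \<alpha> assume "\<alpha> \<in> P"
    have "((\<lambda>k. \<bar>a k\<bar> * \<rho> ^ sum \<alpha> I) has_sum b \<alpha>) (F \<alpha>)"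
      unfolding b_def using fib[of \<alpha>] by (intro has_sum_cmult_left) simp
    then show "((\<lambda>y. \<bar>a (snd (\<alpha>, y))\<bar> * \<rho> ^ sum (e (snd (\<alpha>, y))) I) has_sum b \<alpha>) (F \<alpha>)"
      by (rule has_sum_cong[THEN iffD1, rotated]) (use sum_e' in \<open>auto simp: F_def\<close>)
  qed
  moreover have cb: "\<bar>c \<alpha>\<bar> * \<rho> ^ sum \<alpha> I \<le> b \<alpha>" for \<alpha>
    unfolding b_def c_def using norm_infsum_bound[of a "F \<alpha>"] fib[of \<alpha>] \<rho>
    by (intro mult_right_mono) auto
  ultimately have "\<exists>D'\<le>C. ((\<lambda>\<alpha>. \<bar>c \<alpha>\<bar> * \<rho> ^ sum \<alpha> I) has_sum D') P"
  proof -
    have s: "(\<lambda>\<alpha>. \<bar>c \<alpha>\<bar> * \<rho> ^ sum \<alpha> I) summable_on P"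
      by (rule summable_on_comparison_test[OF has_sum_imp_summable[OF \<open>(b has_sum D) P\<close>]])
        (use cb \<rho> in simp_all)
    then have "((\<lambda>\<alpha>. \<bar>c \<alpha>\<bar> * \<rho> ^ sum \<alpha> I) has_sum (infsum (\<lambda>\<alpha>. \<bar>c \<alpha>\<bar> * \<rho> ^ sum \<alpha> I) P)) P" by simp
    moreover have "infsum (\<lambda>\<alpha>. \<bar>c \<alpha>\<bar> * \<rho> ^ sum \<alpha> I) P \<le> D"
      using has_sum_mono[OF calculation \<open>(b has_sum D) P\<close>] cb by auto
    ultimately show ?thesis using bound(2) by (meson order_trans)
  qed
  moreover have "((\<lambda>\<alpha>. c \<alpha> * monomial I y \<alpha>) has_sum h y) P" if y: "\<forall>i\<in>I. \<bar>y i\<bar> \<le> \<rho>" for y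
  proof (rule has_sum_SigmaD)
    show "((\<lambda>p. a (snd p) * monomial I y (e (snd p))) has_sum h y) (Sigma P F)"
      using has_sum_reindex_bij_betw[OF bij, of "\<lambda>k. a k * monomial I y (e k)"] val[OF y] by simp
    fix \<alpha> assume "\<alpha> \<in> P"
    have "((\<lambda>k. a k * monomial I y \<alpha>) has_sum c \<alpha> * monomial I y \<alpha>) (F \<alpha>)"
      by (intro has_sum_cmult_left c)
    then show "((\<lambda>k. a (snd (\<alpha>, k)) * monomial I y (e (snd (\<alpha>, k)))) has_sum c \<alpha> * monomial I y \<alpha>) (F \<alpha>)"
      by (rule has_sum_cong[THEN iffD1, rotated]) (auto simp: F_def e'_def)
  qed
  ultimately show ?thesis
    unfolding majorized_def expansion_def P_def by blast
qed

lemma expansion_value_bound: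
  assumes "expansion I \<rho> c h C" "\<forall>i\<in>I. \<bar>y i\<bar> \<le> \<rho>"
  shows "\<bar>h y\<bar> \<le> C"
proof -
  obtain D where D: "D \<le> C" "((\<lambda>\<alpha>. \<bar>c \<alpha>\<bar> * \<rho> ^ sum \<alpha> I) has_sum D) (I \<rightarrow>\<^sub>E UNIV)"
    and v: "((\<lambda>\<alpha>. c \<alpha> * monomial I y \<alpha>) has_sum h y) (I \<rightarrow>\<^sub>E UNIV)"
    using assms unfolding expansion_def by blast
  have "norm (h y) \<le> D"
    by (rule norm_infsum_le[OF v D(2)])
      (use monomial_bound[OF assms(2)] in \<open>auto simp: abs_mult intro!: mult_left_mono\<close>)
  then show ?thesis using D by simp
qed

lemma majorized_value_bound:
  "majorized I \<rho> h C \<Longrightarrow> \<forall>i\<in>I. \<bar>y i\<bar> \<le> \<rho> \<Longrightarrow> \<bar>h y\<bar> \<le> C"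
  unfolding majorized_def using expansion_value_bound by blast

text \<open>
  Completeness of the algebra: an absolutely convergent series of elements has its sum in the
  algebra.
\<close>

lemma majorized_infinite_sum:
  fixes h :: "'n \<Rightarrow> ('i \<Rightarrow> real) \<Rightarrow> real"
  assumes \<rho>: "\<rho> > 0"
    and m: "\<And>n. n \<in> N \<Longrightarrow> majorized I \<rho> (h n) (C n)"
    and C: "(C has_sum D) N" "D \<le> D'"
    and val: "\<And>y. (\<forall>i\<in>I. \<bar>y i\<bar> \<le> \<rho>) \<Longrightarrow> ((\<lambda>n. h n y) has_sum g y) N"
  shows "majorized I \<rho> g D'"
proof -
  define P where "P = (I \<rightarrow>\<^sub>E (UNIV :: nat set))"
  have "\<forall>n\<in>N. \<exists>c. expansion I \<rho> c (h n) (C n)"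
    using m by (auto simp: majorized_def)
  then obtain c where c: "\<forall>n\<in>N. expansion I \<rho> (c n) (h n) (C n)"
    using bchoice by metis
  then have "\<forall>n\<in>N. \<exists>D\<le>C n. ((\<lambda>\<alpha>. \<bar>c n \<alpha>\<bar> * \<rho> ^ sum \<alpha> I) has_sum D) P"
    by (auto simp: expansion_def P_def)
  then obtain E where "\<forall>n\<in>N. E n \<le> C n \<and> ((\<lambda>\<alpha>. \<bar>c n \<alpha>\<bar> * \<rho> ^ sum \<alpha> I) has_sum E n) P"
    using bchoice by metis
  then have E: "\<And>n. n \<in> N \<Longrightarrow> E n \<le> C n"
      "\<And>n. n \<in> N \<Longrightarrow> ((\<lambda>\<alpha>. \<bar>c n \<alpha>\<bar> * \<rho> ^ sum \<alpha> I) has_sum E n) P"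
    by auto
  have v: "((\<lambda>\<alpha>. c n \<alpha> * monomial I y \<alpha>) has_sum h n y) P"
    if "n \<in> N" "\<forall>i\<in>I. \<bar>y i\<bar> \<le> \<rho>" for n y
    using c that by (auto simp: expansion_def P_def)
  have E0: "0 \<le> E n" if "n \<in> N" for n
    by (rule has_sum_nonneg[OF E(2)[OF that]]) (use \<rho> in auto)
  have sE: "E summable_on N"
    by (rule summable_on_comparison_test[OF has_sum_imp_summable[OF C(1)]]) (use E E0 in auto)
  have sS: "(\<lambda>p. \<bar>c (fst p) (snd p)\<bar> * \<rho> ^ sum (snd p) I) summable_on Sigma N (\<lambda>_. P)"
    using E(2) \<rho> by (intro summable_on_SigmaI[where g = E, OF _ sE]) auto
  then obtain S where S: "((\<lambda>p. \<bar>c (fst p) (snd p)\<bar> * \<rho> ^ sum (snd p) I) has_sum S) (Sigma N (\<lambda>_. P))"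
    by (auto simp: summable_on_def)
  have "(E has_sum S) N"
    by (rule has_sum_SigmaD[OF S]) (use E in auto)
  then have "S \<le> D" by (rule has_sum_mono[OF _ C(1)]) (use E in auto)
  show ?thesis
  proof (rule majorizedI_family[OF \<rho> S])
    show "S \<le> D'" using \<open>S \<le> D\<close> C by simp
    fix y assume y: "\<forall>i\<in>I. \<bar>y i\<bar> \<le> \<rho>"
    show "((\<lambda>k. c (fst k) (snd k) * monomial I y (snd k)) has_sum g y) (Sigma N (\<lambda>_. P))"
    proof (rule has_sum_SigmaI)
      show "(\<lambda>k. c (fst k) (snd k) * monomial I y (snd k)) summable_on Sigma N (\<lambda>_. P)"
        by (rule abs_summable_summable, rule Infinite_Sum.abs_summable_on_comparison_test'[OF sS])
          (use monomial_bound[OF y] in \<open>auto simp: abs_mult intro!: mult_left_mono\<close>)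
    qed (use v y val in auto)
  qed
qed

lemma majorized_mono:
  assumes "majorized I \<rho> h C" "0 < \<rho>'" "\<rho>' \<le> \<rho>" "C \<le> C'"
  shows "majorized I \<rho>' h C'"
proof -
  obtain c D where D: "D \<le> C" "((\<lambda>\<alpha>. \<bar>c \<alpha>\<bar> * \<rho> ^ sum \<alpha> I) has_sum D) (I \<rightarrow>\<^sub>E UNIV)"
    and v: "\<And>y. (\<forall>i\<in>I. \<bar>y i\<bar> \<le> \<rho>) \<Longrightarrow> ((\<lambda>\<alpha>. c \<alpha> * monomial I y \<alpha>) has_sum h y) (I \<rightarrow>\<^sub>E UNIV)"
    using assms unfolding majorized_def expansion_def by blast
  have le: "\<bar>c \<alpha>\<bar> * \<rho>' ^ sum \<alpha> I \<le> \<bar>c \<alpha>\<bar> * \<rho> ^ sum \<alpha> I" for \<alpha>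
    using assms by (intro mult_left_mono power_mono) auto
  have "(\<lambda>\<alpha>. \<bar>c \<alpha>\<bar> * \<rho>' ^ sum \<alpha> I) summable_on (I \<rightarrow>\<^sub>E UNIV)"
    using le assms by (intro summable_on_comparison_test[OF has_sum_imp_summable[OF D(2)]]) auto
  then obtain D' where D': "((\<lambda>\<alpha>. \<bar>c \<alpha>\<bar> * \<rho>' ^ sum \<alpha> I) has_sum D') (I \<rightarrow>\<^sub>E UNIV)"
    by (auto simp: summable_on_def)
  then have "D' \<le> D" using has_sum_mono[OF D' D(2)] le by auto
  then show ?thesis
    unfolding majorized_def expansion_def using D' D assms
    by (intro exI[of _ c]) (auto intro!: exI[of _ D'] v elim: order_trans)
qed

lemma majorized_cong:
  assumes "majorized I \<rho> h C" "\<And>y. (\<forall>i\<in>I. \<bar>y i\<bar> \<le> \<rho>) \<Longrightarrow> h' y = h y"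
  shows "majorized I \<rho> h' C"
  using assms unfolding majorized_def expansion_def by auto

lemma majorized_monomial:
  assumes "0 < \<rho>"
  shows "majorized I \<rho> (\<lambda>y. a * monomial I y \<alpha>) (\<bar>a\<bar> * \<rho> ^ sum \<alpha> I)"
proof (rule majorizedI_family[OF assms])
  show "((\<lambda>_::unit. \<bar>a\<bar> * \<rho> ^ sum \<alpha> I) has_sum \<bar>a\<bar> * \<rho> ^ sum \<alpha> I) UNIV"
    by (intro has_sum_finiteI) auto
  show "((\<lambda>_::unit. a * monomial I y \<alpha>) has_sum a * monomial I y \<alpha>) UNIV" for y
    by (intro has_sum_finiteI) auto
qed auto

lemma majorized_const:
  assumes "0 < \<rho>" shows "majorized I \<rho> (\<lambda>_. a) \<bar>a\<bar>"
  using majorized_monomial[OF assms, of I a "\<lambda>_. 0"] by (simp add: monomial_zero)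

lemma majorized_var:
  assumes "0 < \<rho>" "finite I" "i \<in> I" shows "majorized I \<rho> (\<lambda>y. y i) \<rho>"
proof -
  let ?\<alpha> = "\<lambda>j. if j = i then 1 else 0 :: nat"
  have "monomial I y ?\<alpha> = y i" for y
    using assms by (simp add: monomial_def if_distrib[of "\<lambda>n. _ ^ n"] cong: if_cong)
  moreover have "sum ?\<alpha> I = 1" using assms by simp
  ultimately show ?thesis
    using majorized_monomial[OF assms(1), of I 1 ?\<alpha>] by simp
qed

lemma majorized_add:
  assumes "0 < \<rho>" "majorized I \<rho> g C" "majorized I \<rho> h D"
  shows "majorized I \<rho> (\<lambda>y. g y + h y) (C + D)"
proof (rule majorized_infinite_sum[where N = UNIV and h = "\<lambda>b. if b then g else h" and C = "\<lambda>b. if b then C else D"])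
  show "((\<lambda>b. if b then C else D) has_sum (C + D)) UNIV"
    by (intro has_sum_finiteI) (auto simp: UNIV_bool)
  show "((\<lambda>b. (if b then g else h) y) has_sum (g y + h y)) UNIV" for y
    by (intro has_sum_finiteI) (auto simp: UNIV_bool)
qed (use assms in auto)

text \<open>
  The algebra is normed. The product is summed first over the terms of one factor, which
  leaves a monomial times the other factor.
\<close>

lemma majorized_mult:
  assumes \<rho>: "0 < \<rho>" and g: "majorized I \<rho> g C" and h: "majorized I \<rho> h D"
  shows "majorized I \<rho> (\<lambda>y. g y * h y) (C * D)"
proof -
  define P where "P = (I \<rightarrow>\<^sub>E (UNIV :: nat set))"
  obtain a A where a: "A \<le> C" "((\<lambda>\<alpha>. \<bar>a \<alpha>\<bar> * \<rho> ^ sum \<alpha> I) has_sum A) P"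
    and av: "\<And>y. (\<forall>i\<in>I. \<bar>y i\<bar> \<le> \<rho>) \<Longrightarrow> ((\<lambda>\<alpha>. a \<alpha> * monomial I y \<alpha>) has_sum g y) P"
    using g unfolding majorized_def expansion_def P_def by blast
  obtain b B where b: "B \<le> D" "((\<lambda>\<alpha>. \<bar>b \<alpha>\<bar> * \<rho> ^ sum \<alpha> I) has_sum B) P"
    and bv: "\<And>y. (\<forall>i\<in>I. \<bar>y i\<bar> \<le> \<rho>) \<Longrightarrow> ((\<lambda>\<alpha>. b \<alpha> * monomial I y \<alpha>) has_sum h y) P"
    using h unfolding majorized_def expansion_def P_def by blast
  have nn: "0 \<le> A" "0 \<le> B"
    using has_sum_nonneg[OF a(2)] has_sum_nonneg[OF b(2)] \<rho> by auto
  \<comment> \<open>one term of the product series, for a fixed term of the first factor\<close>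
  have single: "majorized I \<rho> (\<lambda>y. a \<alpha> * monomial I y \<alpha> * h y) (\<bar>a \<alpha>\<bar> * \<rho> ^ sum \<alpha> I * B)" for \<alpha>
  proof (rule majorizedI_family[OF \<rho>, where K = P and a = "\<lambda>\<beta>. a \<alpha> * b \<beta>" and e = "\<lambda>\<beta> i. \<alpha> i + \<beta> i"])
    have "((\<lambda>\<beta>. \<bar>a \<alpha>\<bar> * \<rho> ^ sum \<alpha> I * (\<bar>b \<beta>\<bar> * \<rho> ^ sum \<beta> I)) has_sum \<bar>a \<alpha>\<bar> * \<rho> ^ sum \<alpha> I * B) P"
      by (intro has_sum_cmult_right b)
    then show "((\<lambda>\<beta>. \<bar>a \<alpha> * b \<beta>\<bar> * \<rho> ^ (\<Sum>i\<in>I. \<alpha> i + \<beta> i)) has_sum \<bar>a \<alpha>\<bar> * \<rho> ^ sum \<alpha> I * B) P"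
      by (simp add: abs_mult sum.distrib power_add mult_ac)
    fix y assume y: "\<forall>i\<in>I. \<bar>y i\<bar> \<le> \<rho>"
    have "((\<lambda>\<beta>. a \<alpha> * monomial I y \<alpha> * (b \<beta> * monomial I y \<beta>)) has_sum a \<alpha> * monomial I y \<alpha> * h y) P"
      by (intro has_sum_cmult_right bv y)
    then show "((\<lambda>\<beta>. a \<alpha> * b \<beta> * monomial I y (\<lambda>i. \<alpha> i + \<beta> i)) has_sum a \<alpha> * monomial I y \<alpha> * h y) P"
      by (simp add: monomial_def power_add prod.distrib mult_ac)
  qed simp
  show ?thesis
  proof (rule majorized_infinite_sum[OF \<rho> single])
    show "((\<lambda>\<alpha>. \<bar>a \<alpha>\<bar> * \<rho> ^ sum \<alpha> I * B) has_sum A * B) P"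
      by (intro has_sum_cmult_left a)
    show "A * B \<le> C * D" using a b nn by (intro mult_mono) auto
    show "((\<lambda>\<alpha>. a \<alpha> * monomial I y \<alpha> * h y) has_sum g y * h y) P" if "\<forall>i\<in>I. \<bar>y i\<bar> \<le> \<rho>" for y
      by (intro has_sum_cmult_left av that)
  qed
qed

lemma majorized_power:
  assumes "0 < \<rho>" "majorized I \<rho> g C"
  shows "majorized I \<rho> (\<lambda>y. g y ^ n) (C ^ n)"
proof (induction n)
  case 0 then show ?case using majorized_const[OF assms(1), of I 1] by simp
next
  case (Suc n) then show ?case using majorized_mult[OF assms Suc] by simp
qed

lemma majorized_prod:
  assumes "0 < \<rho>" "finite J" "\<And>j. j \<in> J \<Longrightarrow> majorized I \<rho> (g j) (C j)"
  shows "majorized I \<rho> (\<lambda>y. \<Prod>j\<in>J. g j y) (\<Prod>j\<in>J. C j)"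
  using assms(2,3)
proof (induction J rule: finite_induct)
  case empty then show ?case using majorized_const[OF assms(1), of I 1] by simp
next
  case (insert j J)
  then have "majorized I \<rho> (g j) (C j)" "majorized I \<rho> (\<lambda>y. \<Prod>j\<in>J. g j y) (prod C J)" by auto
  from majorized_mult[OF assms(1) this] show ?case using insert by simp
qed

text \<open>
  A power series may be evaluated at algebra elements of norm at most \<open>\<sigma>\<close>: the substituted
  monomials have norm at most the corresponding power of \<open>\<sigma>\<close>.
\<close>

lemma majorized_compose:
  assumes \<rho>: "0 < \<rho>" and J: "finite J" and g: "majorized J \<sigma> g C"
    and h: "\<And>j. j \<in> J \<Longrightarrow> majorized I \<rho> (h j) \<sigma>"
  shows "majorized I \<rho> (\<lambda>y. g (\<lambda>j. h j y)) C"
proof -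
  obtain c D where D: "D \<le> C" "((\<lambda>\<alpha>. \<bar>c \<alpha>\<bar> * \<sigma> ^ sum \<alpha> J) has_sum D) (J \<rightarrow>\<^sub>E UNIV)"
    and v: "\<And>y. (\<forall>i\<in>J. \<bar>y i\<bar> \<le> \<sigma>) \<Longrightarrow> ((\<lambda>\<alpha>. c \<alpha> * monomial J y \<alpha>) has_sum g y) (J \<rightarrow>\<^sub>E UNIV)"
    using g unfolding majorized_def expansion_def by blast
  show ?thesis
  proof (rule majorized_infinite_sum[OF \<rho> _ D(2) D(1)])
    fix \<alpha> :: "'a \<Rightarrow> nat"
    have "majorized I \<rho> (\<lambda>y. \<Prod>j\<in>J. h j y ^ \<alpha> j) (\<Prod>j\<in>J. \<sigma> ^ \<alpha> j)"
      by (intro majorized_prod majorized_power \<rho> J h)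
    from majorized_mult[OF \<rho> majorized_const[OF \<rho>, of I "c \<alpha>"] this]
    show "majorized I \<rho> (\<lambda>y. c \<alpha> * monomial J (\<lambda>j. h j y) \<alpha>) (\<bar>c \<alpha>\<bar> * \<sigma> ^ sum \<alpha> J)"
      by (simp add: monomial_def power_sum)
  next
    fix y assume y: "\<forall>i\<in>I. \<bar>y i\<bar> \<le> \<rho>"
    show "((\<lambda>n. c n * monomial J (\<lambda>j. h j y) n) has_sum g (\<lambda>j. h j y)) (J \<rightarrow>\<^sub>E UNIV)"
      using majorized_value_bound[OF h] y by (intro v) auto
  qed
qed

section \<open>First-order terms and fixed points\<close>

text \<open>
  On the axis of the variable \<open>k\<close> every monomial other than a power of this variable vanishes, and the
  terms of degree at least two are bounded by their values at \<open>R\<close> times \<open>(s / R)\<^sup>2\<close>.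
\<close>

lemma expansion_first_order:
  assumes exp: "expansion J R c h C" and J: "finite J" "k \<in> J" and R: "0 < R" and s: "\<bar>s\<bar> \<le> R"
  defines "e \<equiv> (\<lambda>j\<in>J. if j = k then 1 else 0)"
  shows "\<bar>h ((\<lambda>_. 0)(k := s)) - c (\<lambda>_\<in>J. 0) - c e * s\<bar> \<le> C / R\<^sup>2 * s\<^sup>2"
proof -
  define P where "P = (J \<rightarrow>\<^sub>E (UNIV :: nat set))"
  define y where "y = (\<lambda>_. 0 :: real)(k := s)"
  let ?o = "\<lambda>_\<in>J. 0 :: nat"
  have y: "\<forall>i\<in>J. \<bar>y i\<bar> \<le> R" using s R by (auto simp: y_def)
  obtain D where D: "D \<le> C" "((\<lambda>\<alpha>. \<bar>c \<alpha>\<bar> * R ^ sum \<alpha> J) has_sum D) P"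
    and v: "((\<lambda>\<alpha>. c \<alpha> * monomial J y \<alpha>) has_sum h y) P"
    using exp y unfolding expansion_def P_def by blast
  have oP: "?o \<in> P" "e \<in> P" by (auto simp: P_def e_def)
  have ne: "e \<noteq> ?o" using J by (auto simp: e_def fun_eq_iff restrict_def)
  have mo: "monomial J y ?o = 1" by (simp add: monomial_zero)
  have mono: "monomial J y \<alpha> = (if \<exists>i\<in>J - {k}. \<alpha> i \<noteq> 0 then 0 else s ^ \<alpha> k)" for \<alpha>
  proof -
    have "monomial J y \<alpha> = s ^ \<alpha> k * (\<Prod>i\<in>J - {k}. y i ^ \<alpha> i)"
      using J by (simp add: monomial_def y_def prod.remove)
    also have "(\<Prod>i\<in>J - {k}. y i ^ \<alpha> i) = (\<Prod>i\<in>J - {k}. if \<alpha> i = 0 then 1 else 0)"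
      by (rule prod.cong) (auto simp: y_def)
    also have "\<dots> = (if \<exists>i\<in>J - {k}. \<alpha> i \<noteq> 0 then 0 else 1)"
      using J by auto
    finally show ?thesis by simp
  qed
  have me: "monomial J y e = s" using J by (auto simp: mono e_def)
  define low where "low \<alpha> = (if \<alpha> = ?o then c ?o else if \<alpha> = e then c e * s else 0)" for \<alpha>
  have "(low has_sum (c ?o + c e * s)) P"
    by (rule has_sum_finite_neutralI[of "{?o, e}"]) (use oP ne in \<open>auto simp: low_def\<close>)
  then have "((\<lambda>\<alpha>. c \<alpha> * monomial J y \<alpha> - low \<alpha>) has_sum (h y - (c ?o + c e * s))) P"
    using has_sum_add[OF v has_sum_uminusI] by simp
  moreover have "((\<lambda>\<alpha>. \<bar>c \<alpha>\<bar> * R ^ sum \<alpha> J * (s / R)\<^sup>2) has_sum D * (s / R)\<^sup>2) P"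
    by (intro has_sum_cmult_left D)
  moreover have "norm (c \<alpha> * monomial J y \<alpha> - low \<alpha>) \<le> \<bar>c \<alpha>\<bar> * R ^ sum \<alpha> J * (s / R)\<^sup>2"
    if \<alpha>: "\<alpha> \<in> P" for \<alpha>
  proof (cases "(\<alpha> = ?o \<or> \<alpha> = e) \<or> (\<exists>i\<in>J - {k}. \<alpha> i \<noteq> 0)")
    case True
    then have "c \<alpha> * monomial J y \<alpha> - low \<alpha> = 0"
      using mono[of \<alpha>] ne by (auto simp: low_def mo me e_def)
    then show ?thesis using R by simp
  next
    case False
    have "\<alpha> k \<noteq> 0"
    proof
      assume "\<alpha> k = 0"
      with False \<alpha> have "\<alpha> = ?o" by (auto simp: P_def PiE_def extensional_def fun_eq_iff restrict_def)
      with False show False by simp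
    qed
    moreover have "\<alpha> k \<noteq> 1"
    proof
      assume "\<alpha> k = 1"
      with False \<alpha> have "\<alpha> = e" by (auto simp: P_def PiE_def extensional_def fun_eq_iff restrict_def e_def)
      with False show False by simp
    qed
    ultimately obtain n where n: "\<alpha> k = n + 2" by (metis add_2_eq_Suc' not0_implies_Suc One_nat_def)
    have "sum \<alpha> J = \<alpha> k + sum \<alpha> (J - {k})" using J by (simp add: sum.remove)
    then have deg: "sum \<alpha> J = n + 2" using False n J by simp
    have "\<bar>monomial J y \<alpha>\<bar> = \<bar>s\<bar> ^ n * s\<^sup>2"
      using False by (auto simp: mono n power_abs abs_mult power_add power2_eq_square)
    also have "\<dots> \<le> R ^ n * s\<^sup>2"
      using s by (intro mult_right_mono power_mono) auto
    also have "\<dots> = R ^ sum \<alpha> J * (s / R)\<^sup>2"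
      using R by (simp add: deg power_add power_divide power2_eq_square)
    finally have "\<bar>c \<alpha>\<bar> * \<bar>monomial J y \<alpha>\<bar> \<le> \<bar>c \<alpha>\<bar> * (R ^ sum \<alpha> J * (s / R)\<^sup>2)"
      by (intro mult_left_mono) auto
    then show ?thesis using False by (simp add: low_def abs_mult mult.assoc)
  qed
  ultimately have "norm (h y - (c ?o + c e * s)) \<le> D * (s / R)\<^sup>2"
    by (rule norm_infsum_le)
  also have "\<dots> \<le> C * (s / R)\<^sup>2" using D by (intro mult_right_mono) auto
  finally show ?thesis by (simp add: y_def power_divide diff_diff_eq)
qed

lemma expansion_coeff_zero:
  assumes "expansion J R c h C" "0 < R" "finite J"
  shows "c (\<lambda>_\<in>J. 0) = h (\<lambda>_. 0)"
proof -
  have v: "((\<lambda>\<alpha>. c \<alpha> * monomial J (\<lambda>_. 0) \<alpha>) has_sum h (\<lambda>_. 0)) (J \<rightarrow>\<^sub>E UNIV)"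
    using assms unfolding expansion_def by auto
  have "((\<lambda>\<alpha>. c \<alpha> * monomial J (\<lambda>_. 0) \<alpha>) has_sum c (\<lambda>_\<in>J. 0)) (J \<rightarrow>\<^sub>E UNIV)"
  proof (rule has_sum_finite_neutralI[of "{\<lambda>_\<in>J. 0}"])
    fix \<alpha> assume "\<alpha> \<in> (J \<rightarrow>\<^sub>E UNIV) - {\<lambda>_\<in>J. 0 :: nat}"
    then obtain i where "i \<in> J" "\<alpha> i \<noteq> 0"
      by (auto simp: PiE_def extensional_def fun_eq_iff restrict_def split: if_splits)
    then show "c \<alpha> * monomial J (\<lambda>_. 0) \<alpha> = 0" using assms(3) by (auto simp: monomial_def)
  qed (auto simp: monomial_zero)
  with v show ?thesis using has_sum_unique by blast
qed

text \<open>
  Without a constant term, every monomial gains at least one factor \<open>\<rho> / R\<close>. This is how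
  elements of small norm are obtained.
\<close>

lemma majorized_shrink:
  assumes "majorized J R h C" "finite J" "h (\<lambda>_. 0) = 0" "0 < \<rho>" "\<rho> \<le> R"
  shows "majorized J \<rho> h (C * \<rho> / R)"
proof -
  obtain c where c: "expansion J R c h C" using assms by (auto simp: majorized_def)
  have c0: "c (\<lambda>_\<in>J. 0) = 0" using expansion_coeff_zero[OF c] assms by simp
  obtain D where D: "D \<le> C" "((\<lambda>\<alpha>. \<bar>c \<alpha>\<bar> * R ^ sum \<alpha> J) has_sum D) (J \<rightarrow>\<^sub>E UNIV)"
    and v: "\<And>y. (\<forall>i\<in>J. \<bar>y i\<bar> \<le> R) \<Longrightarrow> ((\<lambda>\<alpha>. c \<alpha> * monomial J y \<alpha>) has_sum h y) (J \<rightarrow>\<^sub>E UNIV)"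
    using c unfolding expansion_def by blast
  have S: "((\<lambda>\<alpha>. \<bar>c \<alpha>\<bar> * R ^ sum \<alpha> J * (\<rho> / R)) has_sum D * (\<rho> / R)) (J \<rightarrow>\<^sub>E UNIV)"
    by (intro has_sum_cmult_left D)
  have le: "\<bar>c \<alpha>\<bar> * \<rho> ^ sum \<alpha> J \<le> \<bar>c \<alpha>\<bar> * R ^ sum \<alpha> J * (\<rho> / R)" if "\<alpha> \<in> J \<rightarrow>\<^sub>E UNIV" for \<alpha>
  proof (cases "sum \<alpha> J")
    case 0
    then have "\<alpha> = (\<lambda>_\<in>J. 0)"
      using that assms(2) by (auto simp: PiE_def extensional_def fun_eq_iff restrict_def)
    then show ?thesis using c0 by simp
  next
    case (Suc n)
    have "\<rho> ^ n * \<rho> \<le> R ^ n * \<rho>" using assms by (intro mult_right_mono power_mono) auto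
    then have "\<bar>c \<alpha>\<bar> * (\<rho> ^ n * \<rho>) \<le> \<bar>c \<alpha>\<bar> * (R ^ n * \<rho>)" by (intro mult_left_mono) auto
    then show ?thesis using assms Suc by (simp add: mult_ac)
  qed
  have "(\<lambda>\<alpha>. \<bar>c \<alpha>\<bar> * \<rho> ^ sum \<alpha> J) summable_on (J \<rightarrow>\<^sub>E UNIV)"
    by (rule summable_on_comparison_test[OF has_sum_imp_summable[OF S]]) (use le assms in auto)
  then obtain E where E: "((\<lambda>\<alpha>. \<bar>c \<alpha>\<bar> * \<rho> ^ sum \<alpha> J) has_sum E) (J \<rightarrow>\<^sub>E UNIV)"
    by (auto simp: summable_on_def)
  have "E \<le> D * (\<rho> / R)" by (rule has_sum_mono[OF E S le])
  also have "\<dots> \<le> C * (\<rho> / R)" using D assms by (intro mult_right_mono) auto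
  finally have "E \<le> C * \<rho> / R" by simp
  then show ?thesis
    unfolding majorized_def expansion_def using E v assms
    by (intro exI[of _ c]) (auto intro!: exI[of _ E] v elim: order_trans)
qed

lemma majorized_power_diff:
  assumes "0 < \<rho>" "majorized I \<rho> u \<sigma>" "majorized I \<rho> v \<sigma>" "majorized I \<rho> (\<lambda>y. u y - v y) \<delta>"
  shows "majorized I \<rho> (\<lambda>y. u y ^ n - v y ^ n) (of_nat n * \<sigma> ^ (n - 1) * \<delta>)"
proof (induction n)
  case 0 show ?case using majorized_const[OF assms(1), of I 0] by simp
next
  case (Suc n)
  have "majorized I \<rho> (\<lambda>y. u y * (u y ^ n - v y ^ n) + (u y - v y) * v y ^ n)
     (\<sigma> * (of_nat n * \<sigma> ^ (n - 1) * \<delta>) + \<delta> * \<sigma> ^ n)"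
    by (intro majorized_add majorized_mult majorized_power assms Suc)
  moreover have "\<sigma> * (of_nat n * \<sigma> ^ (n - 1) * \<delta>) + \<delta> * \<sigma> ^ n = of_nat (Suc n) * \<sigma> ^ (Suc n - 1) * \<delta>"
    by (cases n) (auto simp: algebra_simps)
  moreover have "u y * (u y ^ n - v y ^ n) + (u y - v y) * v y ^ n = u y ^ Suc n - v y ^ Suc n" for y
    by (simp add: algebra_simps)
  ultimately show ?case by (simp only:)
qed

lemma linear_times_power_le:
  fixes \<tau> :: real
  assumes "0 \<le> \<tau>" "\<tau> \<le> 1/2"
  shows "of_nat (m + 2) * \<tau> ^ (m + 1) \<le> 2 * \<tau>"
proof (induction m)
  case (Suc m)
  have "of_nat (Suc m + 2) * \<tau> ^ (Suc m + 1) \<le> \<tau> * (2 * (of_nat (m + 2) * \<tau> ^ (m + 1)))"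
    using assms by (simp add: algebra_simps mult_left_mono)
  also have "\<dots> \<le> (1/2) * (2 * (2 * \<tau>))"
    using assms by (intro mult_mono Suc mult_nonneg_nonneg order_refl) auto
  finally show ?case by simp
qed simp

text \<open>
  If \<open>T\<close> has no linear term in the variable \<open>k\<close>, then every term \<open>c \<alpha> y\<^sup>\<alpha>\<close> in which
  \<open>k\<close> really occurs has degree at least two. The difference of its values at \<open>u\<close> and \<open>v\<close> is
  at most \<open>n \<tau>\<^sup>n\<^sup>-\<^sup>1 \<delta> / R\<close> times its norm on the large polydisc, \<open>n\<close> being the
  degree, and \<open>n \<tau>\<^sup>n\<^sup>-\<^sup>1 \<le> 2 \<tau>\<close>. So on a small polydisc substitution into \<open>T\<close> is a contraction.
\<close>

lemma majorized_contraction: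
  assumes exp: "expansion (insert k I) R c T C" and I: "finite I" "k \<notin> I"
    and c0: "c (\<lambda>j\<in>insert k I. if j = k then 1 else 0) = 0"
    and \<tau>: "0 < \<tau>" "\<tau> \<le> 1/2" "4 * \<tau> * C \<le> R" and R: "0 < R"
    and \<rho>: "0 < \<rho>" "\<rho> \<le> \<tau> * R"
    and uv: "majorized I \<rho> u (\<tau> * R)" "majorized I \<rho> v (\<tau> * R)" "majorized I \<rho> (\<lambda>y. u y - v y) \<delta>"
  shows "majorized I \<rho> (\<lambda>y. T (y(k := u y)) - T (y(k := v y))) (\<delta> / 2)"
proof -
  define J where "J = insert k I"
  define P where "P = (J \<rightarrow>\<^sub>E (UNIV :: nat set))"
  have \<delta>: "0 \<le> \<delta>" using majorized_value_bound[OF uv(3), of "\<lambda>_. 0"] \<rho> by auto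
  have le_R: "\<rho> \<le> R" "\<tau> * R \<le> R" using \<rho> \<tau> R by (auto intro: order_trans)
  obtain D where D: "D \<le> C" "((\<lambda>\<alpha>. \<bar>c \<alpha>\<bar> * R ^ sum \<alpha> J) has_sum D) P"
    and val: "\<And>y. (\<forall>i\<in>J. \<bar>y i\<bar> \<le> R) \<Longrightarrow> ((\<lambda>\<alpha>. c \<alpha> * monomial J y \<alpha>) has_sum T y) P"
    using exp unfolding expansion_def P_def J_def by blast
  have split: "monomial J (y(k := t)) \<alpha> = monomial I y \<alpha> * t ^ \<alpha> k" for y t \<alpha>
  proof -
    have "(\<Prod>i\<in>I. (y(k := t)) i ^ \<alpha> i) = (\<Prod>i\<in>I. y i ^ \<alpha> i)"
      using I by (intro prod.cong) auto
    then show ?thesis using I by (simp add: J_def monomial_def)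
  qed
  show ?thesis
  proof (rule majorized_infinite_sum[OF \<rho>(1)])
    show "((\<lambda>\<alpha>. \<bar>c \<alpha>\<bar> * R ^ sum \<alpha> J * (2 * \<tau> / R * \<delta>)) has_sum D * (2 * \<tau> / R * \<delta>)) P"
      by (intro has_sum_cmult_left D)
    have "4 * \<tau> * D \<le> 4 * \<tau> * C" using D \<tau> by simp
    then have "(4 * \<tau> * D) * \<delta> \<le> R * \<delta>" using \<tau>(3) \<delta> by (intro mult_right_mono) auto
    then show "D * (2 * \<tau> / R * \<delta>) \<le> \<delta> / 2" using R by (simp add: field_simps)
  next
    fix y assume y: "\<forall>i\<in>I. \<bar>y i\<bar> \<le> \<rho>"
    have "\<bar>u y\<bar> \<le> R" "\<bar>v y\<bar> \<le> R"
      using majorized_value_bound[OF uv(1) y] majorized_value_bound[OF uv(2) y] le_R by auto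
    then have "((\<lambda>\<alpha>. c \<alpha> * monomial J (y(k := u y)) \<alpha> - c \<alpha> * monomial J (y(k := v y)) \<alpha>)
        has_sum (T (y(k := u y)) - T (y(k := v y)))) P"
      using y le_R has_sum_add[OF val[of "y(k := u y)"] has_sum_uminusI[OF val[of "y(k := v y)"]]]
      by (force simp: J_def)
    then show "((\<lambda>\<alpha>. c \<alpha> * monomial I y \<alpha> * (u y ^ \<alpha> k - v y ^ \<alpha> k))
        has_sum (T (y(k := u y)) - T (y(k := v y)))) P"
      by (simp add: split algebra_simps)
  next
    fix \<alpha> assume \<alpha>: "\<alpha> \<in> P"
    define a n where "a = sum \<alpha> I" and "n = \<alpha> k"
    have deg: "sum \<alpha> J = a + n" using I by (simp add: J_def a_def n_def)
    have m: "majorized I \<rho> (\<lambda>y. c \<alpha> * monomial I y \<alpha> * (u y ^ \<alpha> k - v y ^ \<alpha> k))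
      (\<bar>c \<alpha>\<bar> * \<rho> ^ a * (of_nat n * (\<tau> * R) ^ (n - 1) * \<delta>))"
      unfolding n_def a_def by (intro majorized_mult majorized_monomial majorized_power_diff \<rho> uv)
    have "\<bar>c \<alpha>\<bar> * \<rho> ^ a * (of_nat n * (\<tau> * R) ^ (n - 1) * \<delta>) \<le> \<bar>c \<alpha>\<bar> * R ^ sum \<alpha> J * (2 * \<tau> / R * \<delta>)"
    proof (cases "n = 0 \<or> a + n = 1")
      case True
      show ?thesis
      proof (cases "n = 0")
        case False
        then have "n = 1" "a = 0" using True by auto
        then have "\<alpha> = (\<lambda>j\<in>insert k I. if j = k then 1 else 0)"
          using \<alpha> I unfolding n_def a_def P_def J_def
          by (auto simp: PiE_def extensional_def fun_eq_iff restrict_def)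
        then show ?thesis using c0 by simp
      qed (use R \<tau> \<delta> in auto)
    next
      case False
      then obtain n' where n': "n = Suc n'" by (cases n) auto
      obtain m where m': "a + n = m + 2" using False by (metis One_nat_def add_2_eq_Suc' add_is_0 not0_implies_Suc)
      have "\<rho> ^ a * (of_nat n * (\<tau> * R) ^ (n - 1)) \<le> (\<tau> * R) ^ a * (of_nat (m + 2) * (\<tau> * R) ^ (n - 1))"
        using \<rho> \<tau> R m' by (intro mult_mono power_mono) auto
      also have "\<dots> = of_nat (m + 2) * (\<tau> * R) ^ (a + (n - 1))"
        by (simp only: power_add mult_ac)
      also have "a + (n - 1) = m + 1" using m' n' by simp
      also have "of_nat (m + 2) * (\<tau> * R) ^ (m + 1) = (of_nat (m + 2) * \<tau> ^ (m + 1)) * R ^ (m + 1)"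
        by (simp only: power_mult_distrib mult_ac)
      also have "\<dots> \<le> 2 * \<tau> * R ^ (m + 1)"
        using linear_times_power_le[of \<tau> m] \<tau> R by (intro mult_right_mono) auto
      also have "\<dots> = R ^ sum \<alpha> J * (2 * \<tau> / R)"
        using R by (simp add: deg m')
      finally have "\<bar>c \<alpha>\<bar> * (\<rho> ^ a * (of_nat n * (\<tau> * R) ^ (n - 1))) * \<delta> \<le> \<bar>c \<alpha>\<bar> * (R ^ sum \<alpha> J * (2 * \<tau> / R)) * \<delta>"
        using \<delta> by (intro mult_right_mono mult_left_mono) auto
      then show ?thesis by (simp only: mult.assoc)
    qed
    then show "majorized I \<rho> (\<lambda>y. c \<alpha> * monomial I y \<alpha> * (u y ^ \<alpha> k - v y ^ \<alpha> k))
       (\<bar>c \<alpha>\<bar> * R ^ sum \<alpha> J * (2 * \<tau> / R * \<delta>))"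
      using majorized_mono[OF m \<rho>(1)] by simp
  qed
qed

text \<open>
  The contraction principle in the algebra of power series. The iterates from \<open>0\<close> converge
  to an element \<open>\<Theta>\<close>; and since constants belong to the algebra, the same contraction estimate shows
  that the iterates converge pointwise to any fixed point, which is therefore the value of \<open>\<Theta>\<close>.
\<close>

lemma majorized_fixed_point:
  assumes exp: "expansion (insert k I) R c T C" and I: "finite I" "k \<notin> I" and R: "0 < R"
    and T0: "T (\<lambda>_. 0) = 0"
    and c0: "c (\<lambda>j\<in>insert k I. if j = k then 1 else 0) = 0"
  obtains \<Theta> \<rho> \<sigma> where "0 < \<rho>" "0 < \<sigma>" "majorized I \<rho> \<Theta> \<sigma>"
    "\<And>y \<theta>. (\<forall>i\<in>I. \<bar>y i\<bar> \<le> \<rho>) \<Longrightarrow> \<bar>\<theta>\<bar> \<le> \<sigma> \<Longrightarrow> T (y(k := \<theta>)) = \<theta> \<Longrightarrow> \<theta> = \<Theta> y"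
proof -
  define C' where "C' = max C 1"
  have C': "0 < C'" "C \<le> C'" by (auto simp: C'_def)
  \<comment> \<open>small enough for the contraction factor \<open>1/2\<close>\<close>
  define \<tau> where "\<tau> = min (1/2) (R / (4 * C'))"
  have \<tau>: "0 < \<tau>" "\<tau> \<le> 1/2" using R C' by (auto simp: \<tau>_def)
  have \<tau>C: "4 * \<tau> * C \<le> R"
  proof -
    have "4 * \<tau> * C \<le> 4 * \<tau> * C'" using \<tau> C' by (intro mult_left_mono) auto
    also have "\<dots> \<le> 4 * (R / (4 * C')) * C'" using C' by (intro mult_right_mono mult_left_mono) (auto simp: \<tau>_def)
    finally show ?thesis using C' by simp
  qed
  define \<sigma> where "\<sigma> = \<tau> * R"
  have \<sigma>: "0 < \<sigma>" "\<sigma> \<le> R" using \<tau> R by (auto simp: \<sigma>_def)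
  \<comment> \<open>small enough for the first iterate to have norm at most \<open>\<sigma> / 2\<close>\<close>
  define \<rho> where "\<rho> = min \<sigma> (\<sigma> / 2 * R / C')"
  have \<rho>: "0 < \<rho>" "\<rho> \<le> \<sigma>" "\<rho> \<le> R" using \<sigma> R C' by (auto simp: \<rho>_def)
  have "C * \<rho> / R \<le> \<sigma> / 2"
  proof -
    have "C * \<rho> \<le> C' * (\<sigma> / 2 * R / C')" using \<rho> C' by (intro mult_mono) (auto simp: \<rho>_def)
    then show ?thesis using C' R by (simp add: field_simps)
  qed
  moreover have "majorized (insert k I) \<rho> T (C * \<rho> / R)"
    using exp I T0 \<rho> by (intro majorized_shrink) (auto simp: majorized_def)
  ultimately have Tsmall: "majorized (insert k I) \<rho> T (\<sigma> / 2)"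
    using majorized_mono \<rho>(1) by blast
  have start: "majorized I \<rho> (\<lambda>y. T (y(k := 0))) (\<sigma> / 2)"
  proof -
    have "majorized I \<rho> (\<lambda>y. T (\<lambda>j. (if j = k then (\<lambda>_. 0) else (\<lambda>y. y j)) y)) (\<sigma> / 2)"
    proof (rule majorized_compose[OF \<rho>(1) _ Tsmall])
      fix j assume "j \<in> insert k I"
      then show "majorized I \<rho> (if j = k then (\<lambda>_. 0) else (\<lambda>y. y j)) \<rho>"
        using majorized_var[OF \<rho>(1) I(1), of j] majorized_mono[OF majorized_const[OF \<rho>(1), of I 0], of \<rho> \<rho>] \<rho> by auto
    qed (use I in auto)
    moreover have "(\<lambda>j. (if j = k then (\<lambda>_. 0) else (\<lambda>y. y j)) y) = y(k := 0)" for y :: "'a \<Rightarrow> real"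
      by auto
    ultimately show ?thesis by simp
  qed
  note contr = majorized_contraction[OF exp I c0 \<tau> \<tau>C R \<rho>(1) \<rho>(2)[unfolded \<sigma>_def], folded \<sigma>_def]
  define \<theta> where "\<theta> = rec_nat (\<lambda>_. 0) (\<lambda>_ u y. T (y(k := u y)))"
  have \<theta>_0: "\<theta> 0 = (\<lambda>_. 0)" and \<theta>_Suc: "\<theta> (Suc n) = (\<lambda>y. T (y(k := \<theta> n y)))" for n
    by (simp_all add: \<theta>_def)
  define d where "d n y = \<theta> (Suc n) y - \<theta> n y" for n y
  have both: "majorized I \<rho> (\<theta> n) (\<sigma> * (1 - 1 / 2 ^ n)) \<and> majorized I \<rho> (d n) (\<sigma> / 2 ^ Suc n)" for n
  proof (induction n)
    case 0
    show ?case using majorized_const[OF \<rho>(1), of I 0] start by (simp add: \<theta>_0 d_def[abs_def] \<theta>_Suc)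
  next
    case (Suc n)
    have "\<sigma> * (1 - 1 / 2 ^ n) + \<sigma> / 2 ^ Suc n = \<sigma> * (1 - 1 / 2 ^ Suc n)" by (simp add: field_simps)
    then have A: "majorized I \<rho> (\<theta> (Suc n)) (\<sigma> * (1 - 1 / 2 ^ Suc n))"
      using majorized_add[OF \<rho>(1) conjunct1[OF Suc] conjunct2[OF Suc]] by (simp add: d_def)
    have "\<sigma> * (1 - 1 / 2 ^ n) \<le> \<sigma>" "\<sigma> * (1 - 1 / 2 ^ Suc n) \<le> \<sigma>"
      using \<sigma> by (auto intro!: mult_left_le)
    then have "majorized I \<rho> (\<theta> n) \<sigma>" "majorized I \<rho> (\<theta> (Suc n)) \<sigma>"
      using majorized_mono[OF conjunct1[OF Suc], of \<rho> \<sigma>] majorized_mono[OF A, of \<rho> \<sigma>] \<rho>(1) by auto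
    moreover have "majorized I \<rho> (\<lambda>y. \<theta> (Suc n) y - \<theta> n y) (\<sigma> / 2 ^ Suc n)"
      using conjunct2[OF Suc] by (simp only: d_def[abs_def])
    ultimately have "majorized I \<rho> (\<lambda>y. T (y(k := \<theta> (Suc n) y)) - T (y(k := \<theta> n y))) (\<sigma> / 2 ^ Suc n / 2)"
      by (intro contr)
    moreover have "d (Suc n) = (\<lambda>y. T (y(k := \<theta> (Suc n) y)) - T (y(k := \<theta> n y)))"
      by (simp only: d_def[abs_def] \<theta>_Suc)
    ultimately have "majorized I \<rho> (d (Suc n)) (\<sigma> / 2 ^ Suc n / 2)" by (simp only:)
    with A show ?case by simp
  qed
  have \<theta>_le: "majorized I \<rho> (\<theta> n) \<sigma>" for n
    using majorized_mono[OF conjunct1[OF both[of n]], of \<rho> \<sigma>] \<rho> \<sigma> by simp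
  have geo: "(\<lambda>n. \<sigma> / 2 ^ Suc n) sums \<sigma>"
    using sums_mult[OF power_half_series, of \<sigma>] by (simp add: power_divide)
  define \<Theta> where "\<Theta> y = (\<Sum>n. d n y)" for y
  have absd: "summable (\<lambda>n. norm (d n y))" if y: "\<forall>i\<in>I. \<bar>y i\<bar> \<le> \<rho>" for y
    by (rule summable_comparison_test'[OF sums_summable[OF geo]])
      (use majorized_value_bound[OF conjunct2[OF both] y] in simp)
  have "majorized I \<rho> \<Theta> \<sigma>"
  proof (rule majorized_infinite_sum[OF \<rho>(1) conjunct2[OF both]])
    show "((\<lambda>n. \<sigma> / 2 ^ Suc n) has_sum \<sigma>) UNIV"
      using geo \<sigma> by (intro norm_summable_imp_has_sum) (auto simp: sums_iff)
    fix y assume "\<forall>i\<in>I. \<bar>y i\<bar> \<le> \<rho>"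
    then show "((\<lambda>n. d n y) has_sum \<Theta> y) UNIV"
      unfolding \<Theta>_def
      by (intro norm_summable_imp_has_sum absd summable_sums[OF summable_norm_cancel])
  qed simp
  moreover have "t = \<Theta> y" if y: "\<forall>i\<in>I. \<bar>y i\<bar> \<le> \<rho>" and t: "\<bar>t\<bar> \<le> \<sigma>" and fp: "T (y(k := t)) = t" for y t
  proof -
    have step: "\<bar>\<theta> (Suc n) y - t\<bar> \<le> \<bar>\<theta> n y - t\<bar> / 2" for n
    proof -
      have b: "\<bar>\<theta> n y\<bar> \<le> \<sigma>" by (rule majorized_value_bound[OF \<theta>_le y])
      have "majorized I \<rho> (\<lambda>y'. T (y'(k := \<theta> n y)) - T (y'(k := t))) (\<bar>\<theta> n y - t\<bar> / 2)"
      proof (rule contr)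
        show "majorized I \<rho> (\<lambda>_. \<theta> n y) \<sigma>" using b majorized_mono[OF majorized_const] \<rho> by blast
        show "majorized I \<rho> (\<lambda>_. t) \<sigma>" using t majorized_mono[OF majorized_const] \<rho> by blast
        show "majorized I \<rho> (\<lambda>_. \<theta> n y - t) \<bar>\<theta> n y - t\<bar>" by (rule majorized_const[OF \<rho>(1)])
      qed
      from majorized_value_bound[OF this y] show ?thesis by (simp add: \<theta>_Suc fp)
    qed
    have bnd: "norm (\<theta> n y - t) \<le> \<bar>t\<bar> * (1/2) ^ n" for n
    proof (induction n)
      case (Suc n) with step[of n] show ?case by simp
    qed (simp add: \<theta>_0)
    have lim0: "(\<lambda>n. \<bar>t\<bar> * (1/2) ^ n) \<longlonglongrightarrow> 0"
      by (rule tendsto_mult_right_zero) (rule LIMSEQ_power_zero, simp)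
    have "(\<lambda>n. \<theta> n y - t) \<longlonglongrightarrow> 0"
      by (rule Lim_null_comparison[OF always_eventually[OF allI] lim0]) (rule bnd)
    then have "(\<lambda>n. \<theta> n y) \<longlonglongrightarrow> t" using LIM_zero_iff by blast
    moreover have "(\<lambda>n. \<theta> n y) \<longlonglongrightarrow> \<Theta> y"
    proof -
      have "(\<Sum>m<n. d m y) = \<theta> n y" for n
        by (induction n) (auto simp: d_def \<theta>_0)
      then show ?thesis
        using summable_LIMSEQ[OF summable_norm_cancel[OF absd[OF y]]] by (simp add: \<Theta>_def)
    qed
    ultimately show ?thesis by (rule LIMSEQ_unique)
  qed
  ultimately show ?thesis using that \<rho> \<sigma> by blast
qed

section \<open>Germs of analytic functions\<close>

text \<open>
  Analyticity at the origin. All functions are moved there by adding constants, so this one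
  point is enough.
\<close>

definition analytic_germ :: "'i set \<Rightarrow> (('i \<Rightarrow> real) \<Rightarrow> real) \<Rightarrow> bool" where
  "analytic_germ I h \<longleftrightarrow> (\<exists>\<rho>>0. \<exists>C. majorized I \<rho> h C)"

lemma analytic_germ_eventually:
  "analytic_germ I h \<longleftrightarrow> (\<exists>C. \<forall>\<^sub>F \<rho> in at_right 0. majorized I \<rho> h C)"
proof
  assume "analytic_germ I h"
  then obtain \<rho> C where "0 < \<rho>" "majorized I \<rho> h C" by (auto simp: analytic_germ_def)
  then have "\<forall>\<^sub>F r in at_right 0. majorized I r h C"
    unfolding eventually_at_right_field by (intro exI[of _ \<rho>]) (auto intro: majorized_mono)
  then show "\<exists>C. \<forall>\<^sub>F \<rho> in at_right 0. majorized I \<rho> h C" by blast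
next
  assume "\<exists>C. \<forall>\<^sub>F \<rho> in at_right 0. majorized I \<rho> h C"
  then obtain C where "\<forall>\<^sub>F \<rho> in at_right 0. majorized I \<rho> h C" by blast
  then have "\<forall>\<^sub>F \<rho> in at_right 0. 0 < \<rho> \<and> majorized I \<rho> h C"
    using eventually_at_right_less by eventually_elim simp
  then show "analytic_germ I h"
    unfolding analytic_germ_def using eventually_happens'[OF trivial_limit_at_right_real] by blast
qed

lemma analytic_germ_const: "analytic_germ I (\<lambda>_. a)"
  unfolding analytic_germ_def by (intro exI[of _ 1] exI[of _ "\<bar>a\<bar>"] conjI zero_less_one majorized_const)

lemma analytic_germ_var: "finite I \<Longrightarrow> i \<in> I \<Longrightarrow> analytic_germ I (\<lambda>y. y i)"
  unfolding analytic_germ_def by (intro exI[of _ 1] conjI zero_less_one majorized_var)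

lemma analytic_germ_mult:
  assumes "analytic_germ I g" "analytic_germ I h"
  shows "analytic_germ I (\<lambda>y. g y * h y)"
proof -
  obtain C D where "\<forall>\<^sub>F \<rho> in at_right 0. majorized I \<rho> g C" "\<forall>\<^sub>F \<rho> in at_right 0. majorized I \<rho> h D"
    using assms by (auto simp: analytic_germ_eventually)
  then have "\<forall>\<^sub>F \<rho> in at_right 0. majorized I \<rho> (\<lambda>y. g y * h y) (C * D)"
    using eventually_at_right_less by eventually_elim (rule majorized_mult)
  then show ?thesis by (auto simp: analytic_germ_eventually)
qed

lemma analytic_germ_add:
  assumes "analytic_germ I g" "analytic_germ I h"
  shows "analytic_germ I (\<lambda>y. g y + h y)"
proof -
  obtain C D where "\<forall>\<^sub>F \<rho> in at_right 0. majorized I \<rho> g C" "\<forall>\<^sub>F \<rho> in at_right 0. majorized I \<rho> h D"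
    using assms by (auto simp: analytic_germ_eventually)
  then have "\<forall>\<^sub>F \<rho> in at_right 0. majorized I \<rho> (\<lambda>y. g y + h y) (C + D)"
    using eventually_at_right_less by eventually_elim (rule majorized_add)
  then show ?thesis by (auto simp: analytic_germ_eventually)
qed

lemma analytic_germ_diff:
  assumes "analytic_germ I g" "analytic_germ I h"
  shows "analytic_germ I (\<lambda>y. g y - h y)"
  using analytic_germ_add[OF assms(1) analytic_germ_mult[OF analytic_germ_const[of I "-1"] assms(2)]] by simp

text \<open>
  The inner functions vanish at the origin, so they have arbitrarily small norm on small
  polydiscs.
\<close>

lemma analytic_germ_compose:
  assumes "finite I" "finite J" and g: "analytic_germ J g"
    and h: "\<And>j. j \<in> J \<Longrightarrow> analytic_germ I (h j)" and h0: "\<And>j. j \<in> J \<Longrightarrow> h j (\<lambda>_. 0) = 0"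
  shows "analytic_germ I (\<lambda>y. g (\<lambda>j. h j y))"
proof -
  obtain \<sigma> C where \<sigma>: "0 < \<sigma>" "majorized J \<sigma> g C" using g by (auto simp: analytic_germ_def)
  have "\<forall>\<^sub>F \<rho> in at_right 0. majorized I \<rho> (h j) \<sigma>" if j: "j \<in> J" for j
  proof -
    obtain R D where R: "0 < R" "majorized I R (h j) D" using h[OF j] by (auto simp: analytic_germ_def)
    show ?thesis unfolding eventually_at_right_field
    proof (intro exI[of _ "min R (\<sigma> * R / (\<bar>D\<bar> + 1))"] conjI allI impI)
      show "0 < min R (\<sigma> * R / (\<bar>D\<bar> + 1))" using R \<sigma> by (auto simp: add_nonneg_pos)
      fix \<rho> assume \<rho>: "0 < \<rho>" "\<rho> < min R (\<sigma> * R / (\<bar>D\<bar> + 1))"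
      have "D * \<rho> \<le> (\<bar>D\<bar> + 1) * \<rho>" using \<rho> by (intro mult_right_mono) auto
      also have "\<dots> \<le> \<sigma> * R" using \<rho> by (simp add: field_simps)
      finally have "D * \<rho> / R \<le> \<sigma>" using R by (simp add: field_simps)
      then show "majorized I \<rho> (h j) \<sigma>"
        using majorized_mono[OF majorized_shrink[OF R(2) assms(1) h0[OF j], of \<rho>], of \<rho> \<sigma>] \<rho> by simp
    qed
  qed
  then have "\<forall>\<^sub>F \<rho> in at_right 0. \<forall>j\<in>J. majorized I \<rho> (h j) \<sigma>"
    using assms(2) by (intro eventually_ball_finite) auto
  then have "\<forall>\<^sub>F \<rho> in at_right 0. majorized I \<rho> (\<lambda>y. g (\<lambda>j. h j y)) C"
    using eventually_at_right_less
    by eventually_elim (rule majorized_compose[OF _ assms(2) \<sigma>(2)], auto)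
  then show ?thesis by (auto simp: analytic_germ_eventually)
qed

lemma analytic_germ_cong:
  assumes "analytic_germ I h" "0 < \<delta>" "\<And>y. (\<forall>i\<in>I. \<bar>y i\<bar> \<le> \<delta>) \<Longrightarrow> h' y = h y"
  shows "analytic_germ I h'"
proof -
  obtain R C where R: "0 < R" "majorized I R h C" using assms(1) by (auto simp: analytic_germ_def)
  have "majorized I (min R \<delta>) h C" using majorized_mono[OF R(2)] R assms(2) by simp
  then have "majorized I (min R \<delta>) h' C" by (rule majorized_cong) (use assms(3) in auto)
  then show ?thesis unfolding analytic_germ_def using R assms(2) by (metis min_less_iff_conj)
qed

lemma analytic_germ_first_order:
  assumes "analytic_germ J h" "finite J" "k \<in> J"
  obtains d K R where "0 < R" "\<And>s. \<bar>s\<bar> \<le> R \<Longrightarrow> \<bar>h ((\<lambda>_. 0)(k := s)) - h (\<lambda>_. 0) - d * s\<bar> \<le> K * s\<^sup>2"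
proof -
  obtain R C c where R: "0 < R" "expansion J R c h C"
    using assms(1) by (auto simp: analytic_germ_def majorized_def)
  show ?thesis
    by (rule that[OF R(1) expansion_first_order[OF R(2) assms(2,3) R(1), unfolded expansion_coeff_zero[OF R(2,1) assms(2)]]])
qed

lemma zero_if_linear_le_square:
  fixes d :: real
  assumes "0 < R" "\<And>s. 0 < s \<Longrightarrow> s \<le> R \<Longrightarrow> \<bar>d * s\<bar> \<le> K * s\<^sup>2"
  shows "d = 0"
proof (rule ccontr)
  assume "d \<noteq> 0"
  define s where "s = min R (\<bar>d\<bar> / (2 * (\<bar>K\<bar> + 1)))"
  have s: "0 < s" "s \<le> R" using \<open>d \<noteq> 0\<close> assms by (auto simp: s_def)
  have "\<bar>d\<bar> * s \<le> K * s * s" using assms(2)[OF s] s by (simp add: abs_mult power2_eq_square)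
  then have "\<bar>d\<bar> \<le> K * s" using s by simp
  also have "\<dots> \<le> (\<bar>K\<bar> + 1) * s" using s by (intro mult_right_mono) auto
  also have "\<dots> \<le> (\<bar>K\<bar> + 1) * (\<bar>d\<bar> / (2 * (\<bar>K\<bar> + 1)))" by (intro mult_left_mono) (auto simp: s_def)
  also have "\<dots> = \<bar>d\<bar> / 2" by (simp add: field_simps)
  finally show False using \<open>d \<noteq> 0\<close> by simp
qed

text \<open>
  The implicit function theorem for one unknown, by the Newton iteration with fixed slope
  \<open>y k - H y / h1\<close>, where \<open>h1\<close> is the partial derivative. That \<open>h1\<close> does not vanish enters as the
  failure of \<open>H\<close> to be stationary on the axis of the unknown, which is what the geometry will give.
  Only uniqueness is asserted: in the application a solution is already known and has to be
  recognised as analytic.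
\<close>

lemma analytic_germ_implicit:
  assumes I: "finite I" "k \<notin> I" and H: "analytic_germ (insert k I) H" and H0: "H (\<lambda>_. 0) = 0"
    and nz: "\<not> ((\<lambda>s. H ((\<lambda>_. 0)(k := s)) / s) \<longlongrightarrow> 0) (at 0)"
  obtains \<Theta> \<delta> where "analytic_germ I \<Theta>" "\<Theta> (\<lambda>_. 0) = 0" "0 < \<delta>"
    "\<And>y \<theta>. (\<forall>i\<in>I. \<bar>y i\<bar> \<le> \<delta>) \<Longrightarrow> \<bar>\<theta>\<bar> \<le> \<delta> \<Longrightarrow> H (y(k := \<theta>)) = 0 \<Longrightarrow> \<theta> = \<Theta> y"
proof -
  define J where "J = insert k I"
  have J: "finite J" "k \<in> J" using I by (auto simp: J_def)
  obtain R1 h1 K1 where R1: "0 < R1"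
    "\<And>s. \<bar>s\<bar> \<le> R1 \<Longrightarrow> \<bar>H ((\<lambda>_. 0)(k := s)) - H (\<lambda>_. 0) - h1 * s\<bar> \<le> K1 * s\<^sup>2"
    by (rule analytic_germ_first_order[OF H[folded J_def] J]) (rule that)
  note R1 = R1[unfolded H0 diff_0_right]
  have "h1 \<noteq> 0"
  proof
    assume "h1 = 0"
    have "\<forall>\<^sub>F s in at 0. norm (H ((\<lambda>_. 0)(k := s)) / s) \<le> \<bar>K1\<bar> * \<bar>s\<bar>"
      unfolding eventually_at
    proof (intro exI[of _ R1] conjI ballI impI)
      fix s :: real assume s: "s \<noteq> 0 \<and> dist s 0 < R1"
      then have "\<bar>H ((\<lambda>_. 0)(k := s))\<bar> \<le> K1 * s\<^sup>2" using R1(2)[of s] \<open>h1 = 0\<close> by simp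
      also have "\<dots> \<le> \<bar>K1\<bar> * s\<^sup>2" by (intro mult_right_mono) auto
      finally show "norm (H ((\<lambda>_. 0)(k := s)) / s) \<le> \<bar>K1\<bar> * \<bar>s\<bar>"
        using s by (simp add: power2_eq_square field_simps)
    qed (use R1 in auto)
    moreover have "((\<lambda>s::real. \<bar>K1\<bar> * \<bar>s\<bar>) \<longlongrightarrow> 0) (at 0)"
      by (intro tendsto_mult_right_zero tendsto_rabs_zero tendsto_ident_at)
    ultimately have "((\<lambda>s. H ((\<lambda>_. 0)(k := s)) / s) \<longlongrightarrow> 0) (at 0)"
      by (rule Lim_null_comparison)
    with nz show False by simp
  qed
  define T where "T y = y k - (1 / h1) * H y" for y
  have "analytic_germ J T"
    unfolding T_def[abs_def] using J H[folded J_def]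
    by (intro analytic_germ_diff analytic_germ_mult analytic_germ_const analytic_germ_var)
  then obtain R c C where R: "0 < R" and exp: "expansion J R c T C"
    by (auto simp: analytic_germ_def majorized_def)
  define d where "d = c (\<lambda>j\<in>J. if j = k then 1 else 0)"
  have T0: "T (\<lambda>_. 0) = 0" by (simp add: T_def H0)
  have d: "d = 0"
  proof (rule zero_if_linear_le_square)
    show "0 < min R R1" using R R1 by simp
    fix s :: real assume s: "0 < s" "s \<le> min R R1"
    let ?t = "T ((\<lambda>_. 0)(k := s))"
    have 1: "\<bar>?t - d * s\<bar> \<le> C / R\<^sup>2 * s\<^sup>2"
      using expansion_first_order[OF exp J R, of s] expansion_coeff_zero[OF exp R J(1)] s T0
      by (simp add: d_def)
    have "?t = - (H ((\<lambda>_. 0)(k := s)) - h1 * s) / h1" using \<open>h1 \<noteq> 0\<close> by (simp add: T_def field_simps)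
    then have "\<bar>?t\<bar> = \<bar>H ((\<lambda>_. 0)(k := s)) - h1 * s\<bar> / \<bar>h1\<bar>" by (simp add: abs_divide abs_minus_commute)
    also have "\<dots> \<le> K1 * s\<^sup>2 / \<bar>h1\<bar>" using R1(2)[of s] s by (intro divide_right_mono) auto
    finally have 2: "\<bar>?t\<bar> \<le> K1 / \<bar>h1\<bar> * s\<^sup>2" by simp
    show "\<bar>d * s\<bar> \<le> (C / R\<^sup>2 + K1 / \<bar>h1\<bar>) * s\<^sup>2"
    proof -
      have "\<bar>d * s\<bar> \<le> \<bar>?t - d * s\<bar> + \<bar>?t\<bar>" using abs_triangle_ineq[of "d * s - ?t" ?t] by (simp add: abs_minus_commute)
      also have "\<dots> \<le> C / R\<^sup>2 * s\<^sup>2 + K1 / \<bar>h1\<bar> * s\<^sup>2" by (rule add_mono[OF 1 2])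
      finally show ?thesis by (simp only: distrib_right)
    qed
  qed
  obtain \<Theta> \<rho> \<sigma> where \<Theta>: "0 < \<rho>" "0 < \<sigma>" "majorized I \<rho> \<Theta> \<sigma>"
    and uniq: "\<And>y \<theta>. (\<forall>i\<in>I. \<bar>y i\<bar> \<le> \<rho>) \<Longrightarrow> \<bar>\<theta>\<bar> \<le> \<sigma> \<Longrightarrow> T (y(k := \<theta>)) = \<theta> \<Longrightarrow> \<theta> = \<Theta> y"
    by (rule majorized_fixed_point[OF exp[unfolded J_def] I R T0 d[unfolded d_def J_def]]) (rule that)
  have 2: "\<Theta> (\<lambda>_. 0) = 0"
  proof (rule uniq[symmetric])
    have "(\<lambda>_. 0)(k := 0) = (\<lambda>_. 0 :: real)" by auto
    then show "T ((\<lambda>_. 0)(k := 0)) = 0" by (simp only: T0)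
  qed (use \<Theta> in auto)
  have 4: "\<theta> = \<Theta> y"
    if y: "\<forall>i\<in>I. \<bar>y i\<bar> \<le> min \<rho> \<sigma>" and \<theta>: "\<bar>\<theta>\<bar> \<le> min \<rho> \<sigma>" and H\<theta>: "H (y(k := \<theta>)) = 0" for y \<theta>
  proof (rule uniq)
    show "\<forall>i\<in>I. \<bar>y i\<bar> \<le> \<rho>" "\<bar>\<theta>\<bar> \<le> \<sigma>" using y \<theta> by auto
    show "T (y(k := \<theta>)) = \<theta>" by (simp add: T_def H\<theta>)
  qed
  have 1: "analytic_germ I \<Theta>" using \<Theta>(1,3) by (auto simp: analytic_germ_def)
  have 3: "0 < min \<rho> \<sigma>" using \<Theta> by simp
  show ?thesis by (rule that[OF 1 2 3 4])
qed

lemma analytic_germ_power_series: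
  assumes "analytic_germ {k} h"
  obtains a r where "0 < r" "\<And>s. \<bar>s\<bar> < r \<Longrightarrow> (\<lambda>n. a n * s ^ n) sums h (\<lambda>_. s)"
proof -
  obtain R c C where R: "0 < R" "expansion {k} R c h C"
    using assms by (auto simp: analytic_germ_def majorized_def)
  define i where "i n = (\<lambda>_\<in>{k}. n :: nat)" for n
  have bij: "bij_betw i UNIV ({k} \<rightarrow>\<^sub>E UNIV)"
    by (rule bij_betw_byWitness[where f' = "\<lambda>\<alpha>. \<alpha> k"])
      (auto simp: i_def PiE_def extensional_def fun_eq_iff restrict_def)
  show ?thesis
  proof (rule that[OF R(1)])
    fix s assume "\<bar>s\<bar> < R"
    then have "((\<lambda>\<alpha>. c \<alpha> * monomial {k} (\<lambda>_. s) \<alpha>) has_sum h (\<lambda>_. s)) ({k} \<rightarrow>\<^sub>E UNIV)"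
      using R by (auto simp: expansion_def)
    then have "((\<lambda>n. c (i n) * monomial {k} (\<lambda>_. s) (i n)) has_sum h (\<lambda>_. s)) UNIV"
      using has_sum_reindex_bij_betw[OF bij, of "\<lambda>\<alpha>. c \<alpha> * monomial {k} (\<lambda>_. s) \<alpha>"] by simp
    then have "(\<lambda>n. c (i n) * monomial {k} (\<lambda>_. s) (i n)) sums h (\<lambda>_. s)"
      by (rule has_sum_imp_sums)
    then show "(\<lambda>n. c (i n) * s ^ n) sums h (\<lambda>_. s)" by (simp add: monomial_def i_def)
  qed
qed

text \<open>
  The zeros of a power series in one variable are isolated.
\<close>

lemma analytic_germ_identity:
  assumes h: "analytic_germ {k} h" and h0: "h (\<lambda>_. 0) = 0"
    and z: "\<And>\<epsilon>. 0 < \<epsilon> \<Longrightarrow> \<exists>s. s \<noteq> 0 \<and> \<bar>s\<bar> < \<epsilon> \<and> h (\<lambda>_. s) = 0"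
  shows "\<exists>\<epsilon>>0. \<forall>s. \<bar>s\<bar> < \<epsilon> \<longrightarrow> h (\<lambda>_. s) = 0"
proof -
  obtain a r where r: "0 < r" "\<And>s. \<bar>s\<bar> < r \<Longrightarrow> (\<lambda>n. a n * s ^ n) sums h (\<lambda>_. s)"
    by (rule analytic_germ_power_series[OF h]) (rule that)
  have a: "a m = 0" if m: "0 < m" for m
  proof (rule ccontr)
    assume am: "a m \<noteq> 0"
    obtain e where e: "0 < e" "\<And>s. s \<in> cball 0 e - {0} \<Longrightarrow> h (\<lambda>_. s) \<noteq> 0"
    proof (rule powser_0_nonzero[where \<xi> = 0 and f = "\<lambda>s. h (\<lambda>_. s)" and a = a and m = m and r = r])
      show "0 < r" "a m \<noteq> 0" "0 < m" by fact+
      show "h (\<lambda>_. 0) = 0" by fact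
      show "(\<lambda>n. a n * (x - 0) ^ n) sums h (\<lambda>_. x)" if "norm (x - 0) < r" for x
        using r(2)[of x] that by simp
    qed (rule that)
    from z[OF e(1)] obtain s where "s \<noteq> 0" "\<bar>s\<bar> < e" "h (\<lambda>_. s) = 0" by blast
    with e(2)[of s] show False by (simp add: mem_cball_0 del: cball_eq_atLeastAtMost)
  qed
  have "h (\<lambda>_. s) = 0" if "\<bar>s\<bar> < r" for s
  proof -
    have s: "(\<lambda>n. a n * t ^ n) sums a 0" for t
      using sums_finite[of "{0}" "\<lambda>n. a n * t ^ n"] a by auto
    have "h (\<lambda>_. s) = a 0" "h (\<lambda>_. 0) = a 0"
      using sums_unique2[OF r(2)[OF that] s] sums_unique2[OF r(2)[of 0] s] r(1) by auto
    then show ?thesis using h0 by simp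
  qed
  then show ?thesis using r(1) by (intro exI[of _ r] conjI allI impI)
qed

section \<open>Coordinates in a normed plane\<close>

text \<open>
  Otherwise a subsequence of the values would stay away from \<open>F a\<close> and, by compactness, converge to
  another value allowed by the closed relation.
\<close>

lemma sequential_compact_continuous:
  fixes F :: "'s::metric_space \<Rightarrow> 'b::metric_space"
  assumes loc: "\<And>u a. (\<And>n. u n \<in> S) \<Longrightarrow> a \<in> S \<Longrightarrow> u \<longlonglongrightarrow> a \<Longrightarrow> \<exists>K. compact K \<and> (\<forall>n. F (u n) \<in> K)"
    and closed_rel: "\<And>u a p. (\<And>n. u n \<in> S) \<Longrightarrow> a \<in> S \<Longrightarrow> u \<longlonglongrightarrow> a \<Longrightarrow> (\<lambda>n. F (u n)) \<longlonglongrightarrow> p \<Longrightarrow> p = F a"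
  shows "continuous_on S F"
proof (rule continuous_on_sequentiallyI)
  fix u a assume u: "\<forall>n. u n \<in> S" "a \<in> S" "u \<longlonglongrightarrow> a"
  obtain K where K: "compact K" "\<And>n. F (u n) \<in> K" using loc[of u a] u by blast
  show "(\<lambda>n. F (u n)) \<longlonglongrightarrow> F a"
  proof (rule ccontr)
    assume "\<not> (\<lambda>n. F (u n)) \<longlonglongrightarrow> F a"
    then obtain e where e: "0 < e" "\<not> (\<forall>\<^sub>F n in sequentially. dist (F (u n)) (F a) < e)"
      by (auto simp: tendsto_iff)
    then obtain r :: "nat \<Rightarrow> nat" where r: "strict_mono r" "\<And>n. \<not> dist (F (u (r n))) (F a) < e"
      using not_eventually_sequentiallyD by blast
    obtain l s where s: "strict_mono (s :: nat \<Rightarrow> nat)" "((\<lambda>n. F (u (r n))) \<circ> s) \<longlonglongrightarrow> l"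
      using K compact_imp_seq_compact[THEN seq_compactE, of K "\<lambda>n. F (u (r n))"] by metis
    have "(u \<circ> (r \<circ> s)) \<longlonglongrightarrow> a"
      using u(3) r(1) s(1) by (intro LIMSEQ_subseq_LIMSEQ strict_mono_o)
    then have "l = F a"
      using closed_rel[of "u \<circ> (r \<circ> s)" a l] u s(2) by (auto simp: o_def)
    with s(2) have "\<forall>\<^sub>F n in sequentially. dist (F (u (r (s n)))) (F a) < e"
      using e(1) by (auto simp: tendsto_iff o_def)
    then show False using r(2) by (auto dest: eventually_happens)
  qed
qed

text \<open>
  The plane is only a normed space in which two vectors form a basis; compactness and the continuity
  of the coordinates have to be derived from this.
\<close>

locale plane =
  fixes u v :: "'a::real_normed_vector"
  assumes uv: "u \<noteq> v" "independent {u, v}" "span {u, v} = UNIV"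
begin

definition co1 :: "'a \<Rightarrow> real" where "co1 x = representation {u, v} x u"
definition co2 :: "'a \<Rightarrow> real" where "co2 x = representation {u, v} x v"
definition det2 :: "'a \<Rightarrow> 'a \<Rightarrow> real" where "det2 x y = co1 x * co2 y - co2 x * co1 y"

lemma co_add: "co1 (x + y) = co1 x + co1 y" "co2 (x + y) = co2 x + co2 y"
  using uv by (simp_all add: co1_def co2_def representation_add)

lemma co_scale: "co1 (c *\<^sub>R x) = c * co1 x" "co2 (c *\<^sub>R x) = c * co2 x"
  using uv by (simp_all add: co1_def co2_def representation_scale)

lemma co_basis: "co1 u = 1" "co1 v = 0" "co2 u = 0" "co2 v = 1"
  using uv by (simp_all add: co1_def co2_def representation_basis)

lemma co_minus: "co1 (- x) = - co1 x" "co2 (- x) = - co2 x"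
  using co_scale[of "-1" x] by simp_all

lemma co_diff: "co1 (x - y) = co1 x - co1 y" "co2 (x - y) = co2 x - co2 y"
  using co_add[of x "- y"] co_minus[of y] by simp_all

lemma co_zero: "co1 0 = 0" "co2 0 = 0"
  using co_scale[of 0 0] by simp_all

lemmas co_simps = co_add co_scale co_minus co_diff co_zero co_basis

lemma co_eq: "x = co1 x *\<^sub>R u + co2 x *\<^sub>R v"
proof -
  have "(\<Sum>b\<in>{u, v}. representation {u, v} x b *\<^sub>R b) = x"
    using uv by (intro sum_representation_eq) auto
  then show ?thesis using uv(1) by (simp add: co1_def co2_def)
qed

lemma co_eqI: "co1 x = co1 y \<Longrightarrow> co2 x = co2 y \<Longrightarrow> x = y"
  using co_eq[of x] co_eq[of y] by simp

lemma det2_bilinear: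
  "det2 (x + y) w = det2 x w + det2 y w" "det2 w (x + y) = det2 w x + det2 w y"
  "det2 (x - y) w = det2 x w - det2 y w" "det2 w (x - y) = det2 w x - det2 w y"
  "det2 (c *\<^sub>R x) w = c * det2 x w" "det2 w (c *\<^sub>R x) = c * det2 w x"
  "det2 (- x) w = - det2 x w" "det2 w (- x) = - det2 w x" "det2 x x = 0" "det2 x 0 = 0" "det2 0 x = 0"
  by (simp_all add: det2_def co_simps algebra_simps)

lemma det2_swap: "det2 x y = - det2 y x"
  by (simp add: det2_def)

lemma det2_zero_iff:
  assumes "q \<noteq> 0" shows "det2 q x = 0 \<longleftrightarrow> (\<exists>c. x = c *\<^sub>R q)"
proof
  assume d: "det2 q x = 0"
  define n where "n = (co1 q)\<^sup>2 + (co2 q)\<^sup>2"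
  have "co1 q \<noteq> 0 \<or> co2 q \<noteq> 0" using assms co_eqI[of q 0] by (auto simp: co_zero)
  then have n: "n \<noteq> 0" by (simp add: n_def)
  define c where "c = (co1 q * co1 x + co2 q * co2 x) / n"
  have "n * co1 x = (co1 q * co1 x + co2 q * co2 x) * co1 q" "n * co2 x = (co1 q * co1 x + co2 q * co2 x) * co2 q"
    using d unfolding det2_def n_def by algebra+
  then have "x = c *\<^sub>R q"
    using n by (intro co_eqI) (simp_all add: c_def co_simps field_simps)
  then show "\<exists>c. x = c *\<^sub>R q" by blast
qed (auto simp: det2_bilinear)

lemma span_eq_det2: "q \<noteq> 0 \<Longrightarrow> x \<in> span {q} \<longleftrightarrow> det2 q x = 0"
  by (auto simp: det2_zero_iff span_singleton)

lemma cramer: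
  assumes "det2 q w \<noteq> 0"
  shows "x = (det2 x w / det2 q w) *\<^sub>R q + (det2 q x / det2 q w) *\<^sub>R w"
proof (rule co_eqI)
  have "det2 q w * co1 x = det2 x w * co1 q + det2 q x * co1 w" "det2 q w * co2 x = det2 x w * co2 q + det2 q x * co2 w"
    unfolding det2_def by algebra+
  then show "co1 x = co1 ((det2 x w / det2 q w) *\<^sub>R q + (det2 q x / det2 q w) *\<^sub>R w)"
    "co2 x = co2 ((det2 x w / det2 q w) *\<^sub>R q + (det2 q x / det2 q w) *\<^sub>R w)"
    using assms by (simp_all add: co_simps field_simps)
qed

text \<open>
  The norm of a combination of the basis vectors is continuous and positive on the Euclidean unit
  circle of coefficients, hence bounded below there.
\<close>

lemma co_bounded: "\<exists>K. \<forall>x. norm (co1 x, co2 x) \<le> K * norm x"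
proof -
  define \<phi> where "\<phi> = (\<lambda>p::real\<times>real. fst p *\<^sub>R u + snd p *\<^sub>R v)"
  have \<phi>: "\<phi> (co1 x, co2 x) = x" for x using co_eq[of x] by (simp add: \<phi>_def)
  have \<phi>_scale: "\<phi> (c *\<^sub>R p) = c *\<^sub>R \<phi> p" for c p
    by (simp add: \<phi>_def scaleR_right_distrib)
  have "\<exists>p\<in>sphere (0::real\<times>real) 1. \<forall>q\<in>sphere 0 1. norm (\<phi> p) \<le> norm (\<phi> q)"
    by (rule continuous_attains_inf) (auto simp: \<phi>_def intro!: continuous_intros)
  then obtain p where p: "norm p = 1" "\<And>q. norm q = 1 \<Longrightarrow> norm (\<phi> p) \<le> norm (\<phi> q)" by auto
  have "\<phi> p \<noteq> 0"
  proof
    assume "\<phi> p = 0"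
    then have "co1 (\<phi> p) = 0" "co2 (\<phi> p) = 0" by (simp_all add: co_zero)
    then have "p = 0" by (simp add: \<phi>_def co_simps prod_eq_iff)
    with p show False by simp
  qed
  define m where "m = norm (\<phi> p)"
  have m: "0 < m" using \<open>\<phi> p \<noteq> 0\<close> by (simp add: m_def)
  have "norm (co1 x, co2 x) \<le> (1 / m) * norm x" for x
  proof (cases "x = 0")
    case False
    define q where "q = (co1 x, co2 x)"
    have "q \<noteq> 0" using \<phi>[of x] False by (auto simp: q_def \<phi>_def zero_prod_def)
    then have "m \<le> norm (\<phi> (q /\<^sub>R norm q))" unfolding m_def by (intro p) simp
    also have "\<phi> (q /\<^sub>R norm q) = x /\<^sub>R norm q"
      by (simp only: \<phi>_scale q_def \<phi>)
    finally have "m * norm q \<le> norm x" using \<open>q \<noteq> 0\<close> by (simp add: field_simps)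
    then show ?thesis using m by (simp add: q_def field_simps)
  qed (simp add: co_zero zero_prod_def[symmetric])
  then show ?thesis by blast
qed

lemma bounded_linear_co: "bounded_linear co1" "bounded_linear co2"
proof -
  obtain K where K: "\<And>x. norm (co1 x, co2 x) \<le> K * norm x" using co_bounded by blast
  have "\<bar>co1 x\<bar> \<le> norm x * K" "\<bar>co2 x\<bar> \<le> norm x * K" for x
    using K[of x] norm_fst_le[of "co1 x" "co2 x"] norm_snd_le[of "co2 x" "co1 x"]
    by (auto simp: mult.commute)
  then show "bounded_linear co1" "bounded_linear co2"
    by (auto intro!: bounded_linear_intro[where K = K] simp: co_simps)
qed

lemmas continuous_on_co [continuous_intros] =
  bounded_linear.continuous_on[OF bounded_linear_co(1)] bounded_linear.continuous_on[OF bounded_linear_co(2)]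
lemmas tendsto_co [tendsto_intros] =
  bounded_linear.tendsto[OF bounded_linear_co(1)] bounded_linear.tendsto[OF bounded_linear_co(2)]

lemma continuous_on_det2 [continuous_intros]:
  "continuous_on S f \<Longrightarrow> continuous_on S g \<Longrightarrow> continuous_on S (\<lambda>x. det2 (f x) (g x))"
  unfolding det2_def by (intro continuous_intros)

lemma tendsto_det2 [tendsto_intros]:
  "(f \<longlongrightarrow> a) F \<Longrightarrow> (g \<longlongrightarrow> b) F \<Longrightarrow> ((\<lambda>x. det2 (f x) (g x)) \<longlongrightarrow> det2 a b) F"
  unfolding det2_def by (intro tendsto_intros)

lemma compact_cball_plane: "compact (cball (0::'a) r)"
proof -
  obtain K where K: "\<And>x. norm (co1 x, co2 x) \<le> K * norm x" using co_bounded by blast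
  define \<phi> where "\<phi> = (\<lambda>p::real\<times>real. fst p *\<^sub>R u + snd p *\<^sub>R v)"
  have c: "continuous_on UNIV \<phi>" unfolding \<phi>_def by (intro continuous_intros)
  define C where "C = {p. norm (\<phi> p) \<le> r}"
  have "closed C" unfolding C_def using c by (intro closed_Collect_le continuous_intros)
  moreover have "bounded C"
  proof (rule boundedI)
    fix p assume "p \<in> C"
    have "(co1 (\<phi> p), co2 (\<phi> p)) = p" by (simp add: \<phi>_def co_simps)
    then have "norm p \<le> K * norm (\<phi> p)" using K[of "\<phi> p"] by simp
    also have "\<dots> \<le> \<bar>K\<bar> * norm (\<phi> p)" by (intro mult_right_mono) auto
    also have "\<dots> \<le> \<bar>K\<bar> * r" using \<open>p \<in> C\<close> by (intro mult_left_mono) (auto simp: C_def)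
    finally show "norm p \<le> \<bar>K\<bar> * r" .
  qed
  ultimately have "compact (\<phi> ` C)"
    by (intro compact_continuous_image continuous_on_subset[OF c]) (auto simp: compact_eq_bounded_closed)
  moreover have "\<phi> ` C = cball 0 r"
  proof
    show "cball 0 r \<subseteq> \<phi> ` C"
    proof
      fix x :: 'a assume "x \<in> cball 0 r"
      moreover have "\<phi> (co1 x, co2 x) = x" using co_eq[of x] by (simp add: \<phi>_def)
      ultimately show "x \<in> \<phi> ` C" by (intro image_eqI[of _ _ "(co1 x, co2 x)"]) (auto simp: C_def)
    qed
  qed (auto simp: C_def)
  ultimately show ?thesis by simp
qed

text \<open>
  Half-planes are convex, and on a connected set that avoids the line \<open>det2 q\<close> keeps its sign.
\<close>

lemma same_side_iff_connected:
  assumes q: "q \<noteq> 0" and xy: "x \<notin> span {q}" "y \<notin> span {q}"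
  shows "connected_component (UNIV - span {q}) x y \<longleftrightarrow> 0 < det2 q x * det2 q y"
proof
  have ne: "det2 q x \<noteq> 0" "det2 q y \<noteq> 0" using xy span_eq_det2[OF q] by auto
  assume "connected_component (UNIV - span {q}) x y"
  then obtain T where T: "connected T" "T \<subseteq> UNIV - span {q}" "x \<in> T" "y \<in> T"
    by (auto simp: connected_component_def)
  have conn: "connected (det2 q ` T)" by (intro connected_continuous_image T continuous_intros)
  have 0: "0 \<notin> det2 q ` T" using T(2) span_eq_det2[OF q] by fastforce
  show "0 < det2 q x * det2 q y"
  proof (rule ccontr)
    assume "\<not> 0 < det2 q x * det2 q y"
    then have "(det2 q x < 0 \<and> 0 < det2 q y) \<or> (det2 q y < 0 \<and> 0 < det2 q x)"
      using ne by (auto simp: zero_less_mult_iff)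
    then have "0 \<in> det2 q ` T"
      using conn T(3,4) unfolding connected_iff_interval by (meson imageI less_imp_le)
    with 0 show False by simp
  qed
next
  assume s: "0 < det2 q x * det2 q y"
  define T where "T = {p. 0 < det2 q x * det2 q p}"
  have "convex T"
    unfolding T_def
  proof (rule convexI)
    fix a b :: 'a and s t :: real
    assume "a \<in> {p. 0 < det2 q x * det2 q p}" "b \<in> {p. 0 < det2 q x * det2 q p}" "0 \<le> s" "0 \<le> t" "s + t = 1"
    then have "0 < s * (det2 q x * det2 q a) + t * (det2 q x * det2 q b)"
      by (cases "s = 0") (auto intro: add_pos_nonneg mult_pos_pos mult_nonneg_nonneg less_imp_le)
    then show "s *\<^sub>R a + t *\<^sub>R b \<in> {p. 0 < det2 q x * det2 q p}" by (simp add: det2_bilinear algebra_simps)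
  qed
  moreover have "x \<in> T" "y \<in> T" using s by (auto simp: T_def zero_less_mult_iff)
  moreover have "T \<subseteq> UNIV - span {q}" using span_eq_det2[OF q] by (auto simp: T_def)
  ultimately show "connected_component (UNIV - span {q}) x y"
    unfolding connected_component_def using convex_connected by blast
qed

end

section \<open>Congruent triangles in a strictly convex plane\<close>

locale strict_plane = plane u v for u v :: "'a::real_normed_vector" +
  assumes strict: "\<And>x y :: 'a. norm (x + y) = norm x + norm y \<Longrightarrow> x \<noteq> 0 \<Longrightarrow> \<exists>c\<ge>0. y = c *\<^sub>R x"
begin

lemma strict_det2: "norm (x + y) = norm x + norm y \<Longrightarrow> det2 x y = 0"
  using strict[of x y] by (cases "x = 0") (auto simp: det2_bilinear)

text \<open>
  Here \<open>0, q, p2, p1\<close> is a convex quadrilateral with diagonals from \<open>0\<close> to \<open>p2\<close> and from \<open>q\<close> to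
  \<open>p1\<close>. In a strictly convex plane the diagonals are together longer than the two opposite sides
  from \<open>0\<close> to \<open>p1\<close> and from \<open>q\<close> to \<open>p2\<close>, but the assumed equal lengths make the two sums equal.
\<close>

lemma crossing_diagonals:
  assumes eq: "norm p1 = norm p2" "norm (p1 - q) = norm (p2 - q)"
    and p1: "p1 = a *\<^sub>R q + b *\<^sub>R p2" and b: "0 < b" "b \<le> 1" and a: "a \<le> 0" and d: "det2 q p2 \<noteq> 0"
  shows "p1 = p2"
proof -
  \<comment> \<open>the diagonals meet in \<open>m\<close>, at the fractions \<open>\<mu>\<close> and \<open>l\<close> of their lengths\<close>
  define \<mu> where "\<mu> = b / (1 - a)"
  define m where "m = \<mu> *\<^sub>R p2"
  have \<mu>: "0 < \<mu>" "\<mu> \<le> 1" using a b by (auto simp: \<mu>_def field_simps)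
  define l where "l = 1 / (1 - a)"
  have l: "0 < l" "l \<le> 1" "l * a = l - 1" "l * b = \<mu>" using a by (auto simp: l_def \<mu>_def field_simps)
  have "m - q = l *\<^sub>R (p1 - q)"
  proof -
    have "l *\<^sub>R p1 = (l - 1) *\<^sub>R q + m"
      unfolding p1 m_def scaleR_right_distrib scaleR_scaleR l(3,4) ..
    then show ?thesis by (simp add: algebra_simps)
  qed
  have 1: "norm (m - q) = l * norm (p1 - q)" unfolding \<open>m - q = _\<close> using l by simp
  have "p1 - m = (1 - l) *\<^sub>R (p1 - q)" using \<open>m - q = _\<close> by (simp add: algebra_simps)
  then have 2: "norm (p1 - m) = (1 - l) * norm (p1 - q)" using l by simp
  have 3: "norm m = \<mu> * norm p2" using \<mu> by (simp add: m_def)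
  have "p2 - m = (1 - \<mu>) *\<^sub>R p2" by (simp add: m_def algebra_simps)
  then have 4: "norm (p2 - m) = (1 - \<mu>) * norm p2" using \<mu> by simp
  have "norm p1 \<le> norm m + norm (p1 - m)" using norm_triangle_ineq[of m "p1 - m"] by simp
  moreover have "norm (p2 - q) \<le> norm (p2 - m) + norm (m - q)" using norm_triangle_ineq[of "p2 - m" "m - q"] by simp
  ultimately have "norm (m + (p1 - m)) = norm m + norm (p1 - m)"
    using 1 2 3 4 eq by (simp add: algebra_simps)
  then have "det2 m (p1 - m) = 0" by (rule strict_det2)
  then have "\<mu> * a * det2 p2 q = 0" by (auto simp: m_def p1 det2_bilinear)
  then have "a = 0" using \<mu> d det2_swap[of p2 q] by simp
  then have "norm p1 = b * norm p2" using p1 b by simp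
  moreover have "p2 \<noteq> 0" using d by (auto simp: det2_bilinear)
  ultimately have "b = 1" using eq by simp
  then show ?thesis using p1 \<open>a = 0\<close> by simp
qed

text \<open>
  Two points on the same side of the line through \<open>0\<close> and \<open>q\<close> form with \<open>0\<close> and \<open>q\<close> either a convex
  quadrilateral, with the diagonals starting at \<open>0\<close> and at \<open>q\<close>, or a triangle that contains one
  of the points. In the latter case the way from \<open>0\<close> to \<open>q\<close> over the inner point is strictly shorter.
  The assumption \<open>b \<le> 1\<close> says that \<open>p1\<close> is not the farther of the two points from the line.
\<close>

lemma isosceles_unique_ordered:
  assumes eq: "norm p1 = norm p2" "norm (p1 - q) = norm (p2 - q)"
    and p1: "p1 = a *\<^sub>R q + b *\<^sub>R p2" and b: "0 < b" "b \<le> 1" and d: "det2 q p2 \<noteq> 0"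
  shows "p1 = p2"
proof -
  consider "a \<le> 0" | "1 \<le> a + b" | "0 < a" "a + b < 1" by linarith
  then show ?thesis
  proof cases
    case 1 then show ?thesis using crossing_diagonals[OF eq p1 b] d by simp
  next
    case 2
    have "p1 - q = p2 - q"
    proof (rule crossing_diagonals[where q = "- q" and a = "1 - a - b" and b = b])
      show "p1 - q = (1 - a - b) *\<^sub>R - q + b *\<^sub>R (p2 - q)" by (simp add: p1 algebra_simps)
    qed (use eq b d 2 in \<open>auto simp: det2_bilinear\<close>)
    then show ?thesis by simp
  next
    case 3
    \<comment> \<open>the ray from \<open>0\<close> through the inner point \<open>p1\<close> leaves the triangle at \<open>e\<close>, between \<open>q\<close> and \<open>p2\<close>\<close>
    define \<kappa> where "\<kappa> = a + b"
    define e where "e = (a / \<kappa>) *\<^sub>R q + (b / \<kappa>) *\<^sub>R p2"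
    have \<kappa>: "0 < \<kappa>" "\<kappa> < 1" using 3 b by (auto simp: \<kappa>_def)
    have p1e: "p1 = \<kappa> *\<^sub>R e" using \<kappa> by (simp add: e_def p1 scaleR_right_distrib)
    have sum1: "a / \<kappa> + b / \<kappa> = 1" using \<kappa> by (simp add: \<kappa>_def add_divide_distrib[symmetric])
    then have e1: "b / \<kappa> = 1 - a / \<kappa>" by simp
    have "e - q = (b / \<kappa>) *\<^sub>R (p2 - q)" "p2 - e = (a / \<kappa>) *\<^sub>R (p2 - q)"
      unfolding e_def e1 by (simp_all add: algebra_simps)
    then have "norm (e - q) = (b / \<kappa>) * norm (p2 - q)" "norm (p2 - e) = (a / \<kappa>) * norm (p2 - q)"
      using 3 b \<kappa> by auto
    then have seg: "norm (p2 - e) + norm (e - q) = norm (p2 - q)" using sum1 by (metis add.commute distrib_right mult_1)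
    have "e - p1 = (1 - \<kappa>) *\<^sub>R e" by (simp add: p1e algebra_simps)
    then have "norm (e - p1) = (1 - \<kappa>) * norm e" using \<kappa> by simp
    moreover have "norm p1 = \<kappa> * norm e" using \<kappa> p1e by simp
    ultimately have "norm p1 + norm (e - p1) = norm e" by (simp add: algebra_simps)
    moreover have "norm (p1 - q) \<le> norm (e - p1) + norm (e - q)"
      using norm_triangle_ineq[of "p1 - e" "e - q"] by (simp add: norm_minus_commute)
    moreover have "norm e \<le> norm p2 + norm (e - p2)" using norm_triangle_ineq[of p2 "e - p2"] by simp
    ultimately have "norm (p2 + (e - p2)) = norm p2 + norm (e - p2)"
      using seg eq by (simp add: norm_minus_commute)
    then have "det2 p2 (e - p2) = 0" by (rule strict_det2)
    then have "a / \<kappa> * det2 p2 q = 0" by (simp add: e_def det2_bilinear)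
    then show ?thesis using d det2_swap[of p2 q] \<kappa> 3 by simp
  qed
qed

lemma isosceles_unique:
  assumes eq: "norm p1 = norm p2" "norm (p1 - q) = norm (p2 - q)" and side: "0 < det2 q p1 * det2 q p2"
  shows "p1 = p2"
proof -
  have d: "det2 q p1 \<noteq> 0" "det2 q p2 \<noteq> 0" using side by auto
  define b where "b = det2 q p1 / det2 q p2"
  have b: "0 < b" using side by (auto simp: b_def zero_less_divide_iff zero_less_mult_iff)
  show ?thesis
  proof (cases "b \<le> 1")
    case True
    show ?thesis
      by (rule isosceles_unique_ordered[OF eq _ b True d(2)])
        (use cramer[OF d(2), of p1] in \<open>simp add: b_def\<close>)
  next
    case False
    then have b': "0 < det2 q p2 / det2 q p1" "det2 q p2 / det2 q p1 \<le> 1"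
      using b d by (auto simp: b_def divide_simps split: if_splits)
    show ?thesis
      by (rule isosceles_unique_ordered[OF eq(1,2)[symmetric] _ b' d(1), symmetric])
        (rule cramer[OF d(1), of p2])
  qed
qed

text \<open>
  The triangles \<open>0, q, p\<close> and \<open>0, z, x\<close> have equal sides and, if nondegenerate, equal
  orientation. The weak inequality makes the relation closed, which gives continuity; it
  loses nothing because equal sides already force the two triangles to be degenerate together.
\<close>

definition congruent_to :: "'a \<Rightarrow> 'a \<Rightarrow> 'a \<Rightarrow> 'a \<Rightarrow> bool" where
  "congruent_to z x q p \<longleftrightarrow> norm p = norm x \<and> norm (p - q) = norm (x - z) \<and> 0 \<le> det2 z x * det2 q p"

lemma congruent_to_sym: "congruent_to z x q p \<Longrightarrow> congruent_to q p z x"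
  by (auto simp: congruent_to_def mult.commute)

text \<open>
  On the line through \<open>0\<close> and \<open>z\<close> one of the three triangle inequalities for \<open>0, z\<close> and the
  third point is an equality. Equal sides carry it over to \<open>0, q, p\<close>, and strict convexity
  puts \<open>p\<close> on the line through \<open>0\<close> and \<open>q\<close>.
\<close>

lemma congruent_collinear:
  fixes p q z :: 'a
  assumes q: "norm q = norm z" "z \<noteq> 0" and p: "norm p = norm (c *\<^sub>R z)" "norm (p - q) = norm (c *\<^sub>R z - z)"
  shows "p = c *\<^sub>R q"
proof -
  have q0: "q \<noteq> 0" using q by auto
  have n: "norm p = \<bar>c\<bar> * norm q" "norm (p - q) = \<bar>c - 1\<bar> * norm q"
    using p q(1) norm_scaleR[of "c - 1" z] by (auto simp: algebra_simps)
  have "det2 q p = 0"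
  proof -
    consider "1 \<le> c" | "0 \<le> c" "c \<le> 1" | "c < 0" by linarith
    then show ?thesis
    proof cases
      case 1
      then have "norm (q + (p - q)) = norm q + norm (p - q)" using n by (simp add: algebra_simps)
      from strict_det2[OF this] show ?thesis by (simp add: det2_bilinear)
    next
      case 2
      then have "norm (p + (q - p)) = norm p + norm (q - p)" using n by (simp add: algebra_simps norm_minus_commute)
      from strict_det2[OF this] show ?thesis using det2_swap[of p q] by (simp add: det2_bilinear)
    next
      case 3
      then have "norm (p + - q) = norm p + norm (- q)" using n by (simp add: algebra_simps)
      from strict_det2[OF this] show ?thesis using det2_swap[of p q] by (simp add: det2_bilinear)
    qed
  qed
  then obtain \<mu> where \<mu>: "p = \<mu> *\<^sub>R q" using det2_zero_iff[OF q0] by blast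
  have "p - q = (\<mu> - 1) *\<^sub>R q" by (simp add: \<mu> algebra_simps)
  then have "\<bar>\<mu> - 1\<bar> = \<bar>c - 1\<bar>" "\<bar>\<mu>\<bar> = \<bar>c\<bar>" using n \<mu> q0 by auto
  then have "\<mu> = c" by linarith
  then show ?thesis using \<mu> by simp
qed

lemma congruent_det2_zero:
  assumes q: "norm q = norm z" "z \<noteq> 0" and p: "norm p = norm x" "norm (p - q) = norm (x - z)"
  shows "det2 q p = 0 \<longleftrightarrow> det2 z x = 0"
proof -
  have "det2 q p = 0" if zx: "det2 z x = 0" and "norm q = norm z" and z: "z \<noteq> 0" and "norm p = norm x" "norm (p - q) = norm (x - z)" for q z p x :: 'a
  proof -
    obtain c where "x = c *\<^sub>R z" using zx det2_zero_iff[OF z, of x] by auto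
    then have "p = c *\<^sub>R q" using congruent_collinear that by blast
    then show ?thesis by (simp add: det2_bilinear)
  qed
  from this[of z x q p] this[of q p z x] show ?thesis using assms by (metis norm_zero zero_less_norm_iff)
qed

lemma congruent_side:
  assumes q: "norm q = norm z" "z \<noteq> 0" and c: "congruent_to z x q p"
  shows "sgn (det2 q p) = sgn (det2 z x)"
  using congruent_det2_zero[OF q, of p x] c unfolding congruent_to_def
  by (auto simp: sgn_if zero_le_mult_iff)

lemma congruent_unique:
  assumes q: "norm q = norm z" "z \<noteq> 0" and c: "congruent_to z x q p" "congruent_to z x q p'"
  shows "p = p'"
proof (cases "det2 z x = 0")
  case True
  then obtain c where "x = c *\<^sub>R z" using q det2_zero_iff by blast
  then show ?thesis
    using congruent_collinear[OF q, of p c] congruent_collinear[OF q, of p' c] c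
    by (simp add: congruent_to_def)
next
  case False
  have "sgn (det2 q p) = sgn (det2 q p')" "det2 q p \<noteq> 0"
    using congruent_side[OF q c(1)] congruent_side[OF q c(2)] False by (auto simp: sgn_0_0)
  then have "0 < det2 q p * det2 q p'" by (auto simp: sgn_if zero_less_mult_iff split: if_splits)
  then show ?thesis using c by (intro isosceles_unique) (auto simp: congruent_to_def)
qed

text \<open>
  Along the half of the sphere of radius \<open>norm x\<close> on the prescribed side of \<open>q\<close>, the
  distance to \<open>q\<close> runs from the smallest to the largest value that the triangle inequality allows, so it
  takes the value \<open>norm (x - z)\<close>.
\<close>

lemma congruent_exists:
  assumes q: "norm q = norm z" "z \<noteq> 0"
  shows "\<exists>p. congruent_to z x q p"
proof (cases "det2 z x = 0")
  case True
  then obtain c where x: "x = c *\<^sub>R z" using q det2_zero_iff by blast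
  have "norm (c *\<^sub>R q - q) = \<bar>c - 1\<bar> * norm q" "norm (c *\<^sub>R z - z) = \<bar>c - 1\<bar> * norm z"
    using norm_scaleR[of "c - 1" q] norm_scaleR[of "c - 1" z] by (simp_all add: algebra_simps)
  then show ?thesis
    by (intro exI[of _ "c *\<^sub>R q"]) (auto simp: congruent_to_def x q det2_bilinear)
next
  case False
  have q0: "q \<noteq> 0" using q by auto
  \<comment> \<open>a vector on the prescribed side of the line through \<open>q\<close>; \<open>\<gamma>\<close> turns from \<open>q\<close> through \<open>w\<close> to \<open>- q\<close>\<close>
  define w where "w = sgn (det2 z x) *\<^sub>R ((- co2 q) *\<^sub>R u + co1 q *\<^sub>R v)"
  have dqw: "det2 q w = sgn (det2 z x) * ((co1 q)\<^sup>2 + (co2 q)\<^sup>2)"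
    by (simp add: w_def det2_def co_simps power2_eq_square algebra_simps)
  have "(co1 q)\<^sup>2 + (co2 q)\<^sup>2 \<noteq> 0" using q0 co_eqI[of q 0] by (auto simp: co_zero)
  then have pos: "0 < (co1 q)\<^sup>2 + (co2 q)\<^sup>2" by (simp add: sum_power2_gt_zero_iff)
  then have dqw0: "det2 q w \<noteq> 0" using False pos by (auto simp: dqw sgn_0_0 simp del: sum_power2_eq_zero_iff)
  define \<gamma> where "\<gamma> \<tau> = cos \<tau> *\<^sub>R q + sin \<tau> *\<^sub>R w" for \<tau>
  have \<gamma>0: "\<gamma> \<tau> \<noteq> 0" for \<tau>
  proof
    assume 0: "\<gamma> \<tau> = 0"
    then have "det2 q (\<gamma> \<tau>) = 0" by (simp add: det2_bilinear)
    then have s: "sin \<tau> = 0" using dqw0 by (simp add: \<gamma>_def det2_bilinear)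
    then have "cos \<tau> = 0" using 0 q0 by (simp add: \<gamma>_def)
    with s show False using sin_cos_squared_add[of \<tau>] by simp
  qed
  define R where "R = norm x"
  define p where "p \<tau> = (R / norm (\<gamma> \<tau>)) *\<^sub>R \<gamma> \<tau>" for \<tau>
  have np: "norm (p \<tau>) = R" for \<tau> using \<gamma>0[of \<tau>] by (simp add: p_def R_def)
  have cont: "continuous_on {0..pi} (\<lambda>\<tau>. norm (p \<tau> - q))"
    unfolding p_def \<gamma>_def by (intro continuous_intros) (use \<gamma>0 in \<open>auto simp: \<gamma>_def\<close>)
  have "p 0 - q = (R / norm q - 1) *\<^sub>R q" "p pi - q = - (R / norm q + 1) *\<^sub>R q"
    by (simp_all add: p_def \<gamma>_def algebra_simps)
  then have "norm (p 0 - q) = \<bar>R / norm q - 1\<bar> * norm q" "norm (p pi - q) = \<bar>R / norm q + 1\<bar> * norm q"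
    by (simp_all only: norm_scaleR abs_minus_cancel norm_minus_cancel scaleR_minus_left)
  then have ends: "norm (p 0 - q) = \<bar>R - norm q\<bar>" "norm (p pi - q) = R + norm q"
  proof -
    have "\<bar>R / norm q + s\<bar> * norm q = \<bar>R + s * norm q\<bar>" for s
    proof -
      have "\<bar>R / norm q + s\<bar> * norm q = \<bar>(R / norm q + s) * norm q\<bar>" by (simp add: abs_mult)
      also have "(R / norm q + s) * norm q = R + s * norm q" using q0 by (simp add: field_simps)
      finally show ?thesis .
    qed
    from this[of "-1"] this[of 1]
    show "norm (p 0 - q) = \<bar>R - norm q\<bar>" "norm (p pi - q) = R + norm q"
      using \<open>norm (p 0 - q) = _\<close> \<open>norm (p pi - q) = _\<close> by (simp_all add: R_def)
  qed
  have "\<bar>R - norm q\<bar> \<le> norm (x - z)" "norm (x - z) \<le> R + norm q"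
    using norm_triangle_ineq3[of x z] norm_triangle_ineq4[of x z] by (auto simp: R_def q)
  then obtain \<tau> where \<tau>: "0 \<le> \<tau>" "\<tau> \<le> pi" "norm (p \<tau> - q) = norm (x - z)"
    using IVT'[of "\<lambda>\<tau>. norm (p \<tau> - q)" 0 "norm (x - z)" pi] cont ends by auto
  have "det2 z x * det2 q (p \<tau>) = \<bar>det2 z x\<bar> * (R / norm (\<gamma> \<tau>) * sin \<tau> * ((co1 q)\<^sup>2 + (co2 q)\<^sup>2))"
    by (simp add: p_def \<gamma>_def det2_bilinear dqw abs_sgn mult_ac)
  also have "\<dots> \<ge> 0"
    using pos \<tau> by (intro mult_nonneg_nonneg divide_nonneg_nonneg sin_ge_zero) (auto simp: R_def)
  finally show ?thesis
    using \<tau> np by (auto simp: congruent_to_def R_def)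
qed

text \<open>
  The point that lies to \<open>q\<close> as \<open>x\<close> lies to \<open>z\<close>. With \<open>q = f t\<close> this is the rotation map.
\<close>

definition transport :: "'a \<Rightarrow> 'a \<Rightarrow> 'a \<Rightarrow> 'a" where
  "transport z q x = (THE p. congruent_to z x q p)"

lemma transport:
  assumes "norm q = norm z" "z \<noteq> 0"
  shows "congruent_to z x q (transport z q x)"
  unfolding transport_def
  using theI'[of "congruent_to z x q"] congruent_exists[OF assms] congruent_unique[OF assms] by metis

lemma transport_eqI:
  assumes "norm q = norm z" "z \<noteq> 0" "congruent_to z x q p"
  shows "transport z q x = p"
  using congruent_unique[OF assms(1,2) transport[OF assms(1,2)] assms(3)] .

lemma transport_inverse:
  assumes "norm q = norm z" "z \<noteq> 0"
  shows "transport q z (transport z q x) = x"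
proof (rule transport_eqI)
  show "q \<noteq> 0" using assms by auto
qed (use assms transport[OF assms] in \<open>auto intro: congruent_to_sym\<close>)

lemma transport_collinear:
  assumes "norm q = norm z" "z \<noteq> 0"
  shows "transport z q (c *\<^sub>R z) = c *\<^sub>R q"
  using transport[OF assms, of "c *\<^sub>R z"] by (intro congruent_collinear[OF assms]) (auto simp: congruent_to_def)

text \<open>
  The congruence relation is closed and the transported point has the norm of \<open>x\<close>, so it
  stays in a compact ball.
\<close>

lemma transport_continuous:
  assumes z: "z \<noteq> 0"
  shows "continuous_on (sphere 0 (norm z) \<times> UNIV) (\<lambda>(q, x). transport z q x)"
proof (rule sequential_compact_continuous)
  fix s :: "nat \<Rightarrow> 'a \<times> 'a" and a
  assume s: "\<And>n. s n \<in> sphere 0 (norm z) \<times> UNIV" and a: "a \<in> sphere 0 (norm z) \<times> UNIV" and lim: "s \<longlonglongrightarrow> a"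
  have q: "norm (fst (s n)) = norm z" for n using s[of n] by (auto simp: mem_Times_iff)
  have c: "congruent_to z (snd (s n)) (fst (s n)) (case s n of (q, x) \<Rightarrow> transport z q x)" for n
    using transport[OF q z] by (simp add: case_prod_unfold)
  have lims: "(\<lambda>n. fst (s n)) \<longlonglongrightarrow> fst a" "(\<lambda>n. snd (s n)) \<longlonglongrightarrow> snd a"
    using lim by (auto intro: tendsto_fst tendsto_snd)
  then obtain M where "\<And>n. norm (snd (s n)) \<le> M"
    using convergent_imp_Bseq[of "\<lambda>n. snd (s n)"] by (auto simp: convergent_def Bseq_def)
  then have "\<forall>n. (case s n of (q, x) \<Rightarrow> transport z q x) \<in> cball 0 M"
    using c by (auto simp: congruent_to_def)
  then show "\<exists>K. compact K \<and> (\<forall>n. (case s n of (q, x) \<Rightarrow> transport z q x) \<in> K)"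
    using compact_cball_plane by blast
  fix p assume p: "(\<lambda>n. case s n of (q, x) \<Rightarrow> transport z q x) \<longlonglongrightarrow> p"
  define P where "P n = (case s n of (q, x) \<Rightarrow> transport z q x)" for n
  have P: "P \<longlonglongrightarrow> p" using p by (simp add: P_def[abs_def])
  have c': "norm (P n) = norm (snd (s n))" "norm (P n - fst (s n)) = norm (snd (s n) - z)"
    "0 \<le> det2 z (snd (s n)) * det2 (fst (s n)) (P n)" for n
    using c[of n] by (auto simp: congruent_to_def P_def)
  have "congruent_to z (snd a) (fst a) p"
    unfolding congruent_to_def
  proof (intro conjI)
    show "norm p = norm (snd a)"
      by (rule LIMSEQ_unique[OF tendsto_norm[OF P]]) (use c' lims in \<open>auto intro!: tendsto_intros\<close>)
    have "(\<lambda>n. norm (P n - fst (s n))) \<longlonglongrightarrow> norm (p - fst a)" by (intro tendsto_intros P lims)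
    moreover have "(\<lambda>n. norm (P n - fst (s n))) \<longlonglongrightarrow> norm (snd a - z)"
      unfolding c' by (intro tendsto_intros lims)
    ultimately show "norm (p - fst a) = norm (snd a - z)" by (rule LIMSEQ_unique)
    have "(\<lambda>n. det2 z (snd (s n)) * det2 (fst (s n)) (P n)) \<longlonglongrightarrow> det2 z (snd a) * det2 (fst a) p"
      by (intro tendsto_intros P lims)
    then show "0 \<le> det2 z (snd a) * det2 (fst a) p"
      by (rule LIMSEQ_le_const) (use c' in auto)
  qed
  then show "p = (case a of (q, x) \<Rightarrow> transport z q x)"
    using transport_eqI[of "fst a" z "snd a" p] a z by (auto simp: case_prod_unfold mem_Times_iff)
qed

end

section \<open>The circle and unit-speed curves\<close>

lemma circle_rep_shift: "\<exists>k::int. circle_rep (circle_of s) = s + of_int k * (2 * pi)"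
  using circle_of_eq_iff[of s "circle_rep (circle_of s)"] by simp

lemma period_trichotomy:
  fixes n :: int
  defines "P \<equiv> of_int n * (2 * pi)"
  shows "P = 0 \<or> 2 * pi \<le> P \<or> P \<le> - (2 * pi)"
proof -
  consider "n = 0" | "1 \<le> n" | "n \<le> -1" by linarith
  then show ?thesis
  proof cases
    case 2
    then have "1 * (2 * pi) \<le> of_int n * (2 * pi)" by (intro mult_right_mono) auto
    then show ?thesis by (simp add: P_def)
  next
    case 3
    then have "real_of_int n * (2 * pi) \<le> -1 * (2 * pi)" by (intro mult_right_mono) auto
    then show ?thesis by (simp add: P_def)
  qed (simp add: P_def)
qed

lemma dist_circle_of_le: "dist (circle_of s) (circle_of s') \<le> \<bar>s - s'\<bar>"
proof -
  obtain k k' :: int where k: "circle_rep (circle_of s) = s + of_int k * (2 * pi)"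
    "circle_rep (circle_of s') = s' + of_int k' * (2 * pi)"
    using circle_rep_shift by metis
  define P where "P = of_int (k - k') * (2 * pi)"
  have e: "circle_rep (circle_of s) - circle_rep (circle_of s') = s - s' + P"
    by (simp add: k P_def algebra_simps)
  have P: "P = 0 \<or> 2 * pi \<le> P \<or> P \<le> - (2 * pi)"
    unfolding P_def by (rule period_trichotomy)
  have "\<bar>s - s' + P\<bar> < 2 * pi"
    using e circle_rep_bounds[of "circle_of s"] circle_rep_bounds[of "circle_of s'"] by linarith
  then show ?thesis using P unfolding dist_circle_def e by linarith
qed

text \<open>
  The covering map is a local isometry: distances on the circle are realised by real angles.
\<close>

lemma circle_lift: obtains s' where "circle_of s' = t" "\<bar>s' - s\<bar> = dist (circle_of s) t"
proof -
  obtain k :: int where k: "circle_rep (circle_of s) = s + of_int k * (2 * pi)"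
    using circle_rep_shift by metis
  define x where "x = circle_rep t - circle_rep (circle_of s)"
  have sh: "circle_of (s + x + of_int n * (2 * pi)) = t" for n :: int
  proof -
    have "s + x + of_int n * (2 * pi) = circle_rep t + of_int (n - k) * (2 * pi)"
      by (simp add: x_def k algebra_simps)
    then show ?thesis using circle_of_eq_iff[of "circle_rep t"] circle_of_circle_rep[of t] by metis
  qed
  have d: "dist (circle_of s) t = min \<bar>x\<bar> (2 * pi - \<bar>x\<bar>)"
    by (simp add: dist_circle_def x_def abs_minus_commute)
  have b: "\<bar>x\<bar> < 2 * pi"
    using circle_rep_bounds[of "circle_of s"] circle_rep_bounds[of t] by (simp add: x_def)
  consider "\<bar>x\<bar> \<le> pi" | "pi < x" | "x < - pi" by linarith
  then show ?thesis
  proof cases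
    case 1 then show ?thesis using that[of "s + x"] sh[of 0] d by auto
  next
    case 2 then show ?thesis using that[of "s + x - 2 * pi"] sh[of "-1"] d b by auto
  next
    case 3 then show ?thesis using that[of "s + x + 2 * pi"] sh[of 1] d b by auto
  qed
qed

lemma dist_circle_le_pi: "dist s (t :: circle) \<le> pi"
  by (simp add: dist_circle_def min_def)

lemma dist_circle_of_eq:
  assumes "\<bar>s - s'\<bar> \<le> pi" shows "dist (circle_of s) (circle_of s') = \<bar>s - s'\<bar>"
proof -
  obtain r where r: "circle_of r = circle_of s'" "\<bar>r - s\<bar> = dist (circle_of s) (circle_of s')"
    by (rule circle_lift)
  then obtain P where P: "s' = r + P" "P = 0 \<or> 2 * pi \<le> P \<or> P \<le> - (2 * pi)"
    using circle_of_eq_iff period_trichotomy by blast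
  show ?thesis
    using dist_circle_of_le[of s s'] assms r(2) P by (auto simp: abs_if split: if_splits)
qed

lemma circle_of_continuous: "continuous_on S circle_of"
  unfolding continuous_on_iff
  by (metis dist_circle_of_le dist_real_def le_less_trans)

lemma circle_of_surj: "circle_of ` {0..2 * pi} = UNIV"
proof -
  have "t \<in> circle_of ` {0..2 * pi}" for t
    using circle_rep_bounds[of t] by (intro image_eqI[of _ _ "circle_rep t"]) auto
  then show ?thesis by blast
qed

lemma compact_circle: "compact (UNIV :: circle set)"
  using compact_continuous_image[OF circle_of_continuous, of "{0..2 * pi}"] by (simp add: circle_of_surj)

lemma connected_circle: "connected (UNIV :: circle set)"
  using connected_continuous_image[OF circle_of_continuous, of "{0..2 * pi}"] by (simp add: circle_of_surj)

lemma continuous_on_circleI: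
  fixes g :: "circle \<Rightarrow> 'b::metric_space"
  assumes "continuous_on UNIV (\<lambda>s. g (circle_of s))"
  shows "continuous_on UNIV g"
  unfolding continuous_on_iff
proof (intro ballI allI impI)
  fix t and e :: real assume "0 < e"
  then obtain d where d: "0 < d" "\<And>s. dist s (circle_rep t) < d \<Longrightarrow> dist (g (circle_of s)) (g t) < e"
    using assms unfolding continuous_on_iff by (metis UNIV_I circle_of_circle_rep)
  have "dist (g t') (g t) < e" if t': "dist t' t < d" for t'
  proof -
    obtain s where s: "circle_of s = t'" "\<bar>s - circle_rep t\<bar> = dist (circle_of (circle_rep t)) t'"
      by (rule circle_lift)
    then show ?thesis using d(2)[of s] t' by (simp add: dist_real_def dist_commute)
  qed
  then show "\<exists>d>0. \<forall>t'\<in>UNIV. dist t' t < d \<longrightarrow> dist (g t') (g t) < e" using d(1) by blast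
qed

lemma locally_lipschitz_real:
  fixes G :: "real \<Rightarrow> 'm::metric_space"
  assumes loc: "\<And>s. \<exists>\<delta>>0. \<forall>s'. \<bar>s' - s\<bar> < \<delta> \<longrightarrow> dist (G s') (G s) \<le> K * \<bar>s' - s\<bar>" and "a \<le> b"
  shows "dist (G a) (G b) \<le> K * (b - a)"
proof (rule Bolzano[where P = "\<lambda>a b. dist (G a) (G b) \<le> K * (b - a)", OF \<open>a \<le> b\<close>])
  fix a b c assume "dist (G a) (G b) \<le> K * (b - a)" "dist (G b) (G c) \<le> K * (c - b)"
  then show "dist (G a) (G c) \<le> K * (c - a)"
    using dist_triangle[of "G a" "G c" "G b"] by (simp add: algebra_simps)
next
  fix x
  obtain \<delta> where \<delta>: "0 < \<delta>" "\<And>s'. \<bar>s' - x\<bar> < \<delta> \<Longrightarrow> dist (G s') (G x) \<le> K * \<bar>s' - x\<bar>"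
    using loc by blast
  have "dist (G a) (G b) \<le> K * (b - a)" if "a \<le> x" "x \<le> b" "b - a < \<delta>" for a b
  proof -
    have "dist (G a) (G x) \<le> K * (x - a)" "dist (G b) (G x) \<le> K * (b - x)"
      using \<delta>(2)[of a] \<delta>(2)[of b] that by auto
    then show ?thesis using dist_triangle2[of "G a" "G b" "G x"] by (simp add: algebra_simps)
  qed
  then show "\<exists>d>0. \<forall>a b. a \<le> x \<and> x \<le> b \<and> b - a < d \<longrightarrow> dist (G a) (G b) \<le> K * (b - a)"
    using \<delta>(1) by blast
qed

text \<open>
  A map which to first order does not increase distances does not increase the length of an arc,
  and distances on the circle are lengths of arcs.
\<close>

lemma infinitesimally_short_circle_map:
  fixes h :: "circle \<Rightarrow> circle"
  assumes loc: "\<And>t \<epsilon>. 0 < \<epsilon> \<Longrightarrow> \<exists>\<delta>>0. \<forall>t'. dist t' t < \<delta> \<longrightarrow> dist (h t') (h t) \<le> (1 + \<epsilon>) * dist t' t"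
  shows "dist (h t) (h t') \<le> dist t t'"
proof (rule field_le_epsilon)
  fix e :: real assume "0 < e"
  obtain a b where ab: "circle_of a = t" "circle_of b = t'" "\<bar>b - a\<bar> = dist t t'"
    by (metis circle_lift circle_of_circle_rep)
  \<comment> \<open>a shortest arc has length at most \<open>pi\<close>, so this factor costs less than \<open>e\<close> in total\<close>
  define K where "K = 1 + e / (pi + 1)"
  have K: "0 < e / (pi + 1)" using \<open>0 < e\<close> by (simp add: add_pos_pos)
  define G where "G s = h (circle_of s)" for s
  have G: "\<exists>\<delta>>0. \<forall>s'. \<bar>s' - s\<bar> < \<delta> \<longrightarrow> dist (G s') (G s) \<le> K * \<bar>s' - s\<bar>" for s
  proof -
    obtain \<delta> where \<delta>: "0 < \<delta>" "\<And>t'. dist t' (circle_of s) < \<delta> \<Longrightarrow> dist (h t') (h (circle_of s)) \<le> K * dist t' (circle_of s)"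
      using loc[OF K, of "circle_of s"] unfolding K_def by blast
    have "dist (G s') (G s) \<le> K * \<bar>s' - s\<bar>" if "\<bar>s' - s\<bar> < \<delta>" for s'
    proof -
      have "dist (G s') (G s) \<le> K * dist (circle_of s') (circle_of s)"
        unfolding G_def using dist_circle_of_le[of s' s] that by (intro \<delta>) auto
      also have "\<dots> \<le> K * \<bar>s' - s\<bar>" using dist_circle_of_le[of s' s] K by (intro mult_left_mono) (auto simp: K_def)
      finally show ?thesis .
    qed
    then show ?thesis using \<delta>(1) by blast
  qed
  have "dist (G a) (G b) \<le> K * \<bar>b - a\<bar>"
    using locally_lipschitz_real[OF G, of a b] locally_lipschitz_real[OF G, of b a]
    by (cases "a \<le> b") (auto simp: dist_commute)
  also have "\<dots> = dist t t' + e * (dist t t' / (pi + 1))" by (simp add: K_def ab algebra_simps)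
  also have "dist t t' / (pi + 1) \<le> 1"
  proof -
    have "0 < pi + 1" using pi_gt_zero by linarith
    then show ?thesis using dist_circle_le_pi[of t t'] by (simp add: divide_le_eq)
  qed
  finally show "dist (h t) (h t') \<le> dist t t' + e" using \<open>0 < e\<close> by (simp add: G_def ab mult_left_le)
qed

text \<open>
  If \<open>t\<close> and \<open>h t\<close> were not opposite, they would have a unique midpoint on the shorter arc.
  The isometry \<open>h\<close> exchanges the two ends of this arc, hence fixes its midpoint.
\<close>

lemma circle_isometric_involution:
  fixes h :: "circle \<Rightarrow> circle"
  assumes iso: "\<And>t t'. dist (h t) (h t') = dist t t'" and inv: "\<And>t. h (h t) = t" and fix_free: "\<And>t. h t \<noteq> t"
  shows "h t = antipode t"
proof -
  define D where "D = dist t (h t)"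
  obtain s s' where s: "circle_of s = t" "circle_of s' = h t" "\<bar>s' - s\<bar> = D"
    unfolding D_def by (metis circle_lift circle_of_circle_rep)
  have "0 < D" using fix_free[of t] by (simp add: D_def)
  have "D = pi"
  proof (rule ccontr)
    assume "D \<noteq> pi"
    then have D: "D < pi" using dist_circle_le_pi[of t "h t"] by (simp add: D_def)
    define m where "m = (s + s') / 2"
    have m: "dist (circle_of m) t = D / 2" "dist (circle_of m) (h t) = D / 2"
      using dist_circle_of_eq[of m s] dist_circle_of_eq[of m s'] s D by (auto simp: m_def abs_if field_simps split: if_splits)
    obtain r where r: "circle_of r = h (circle_of m)" "\<bar>r - s\<bar> = dist t (h (circle_of m))"
      using circle_lift[of "h (circle_of m)" s] s(1) by metis
    have rD: "\<bar>r - s\<bar> = D / 2"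
      using r(2) iso[of "h t" "circle_of m"] inv[of t] m(2) by (simp add: dist_commute)
    have "r \<noteq> m" using fix_free r(1) by metis
    then have far: "\<bar>s' - r\<bar> = 3 * D / 2"
      using rD s(3) by (auto simp: m_def abs_if field_simps split: if_splits)
    \<comment> \<open>the other point at distance \<open>D / 2\<close> from \<open>t\<close> lies beyond \<open>t\<close>, too far from \<open>h t\<close>\<close>
    obtain s'' where s'': "circle_of s'' = h t" "\<bar>s'' - r\<bar> = dist (circle_of r) (h t)"
      by (rule circle_lift)
    then have "\<bar>s'' - r\<bar> = D / 2"
      using r(1) iso[of "circle_of m" t] m(1) by simp
    moreover obtain P where "s'' = s' + P" "P = 0 \<or> 2 * pi \<le> P \<or> P \<le> - (2 * pi)"
      using s''(1) s(2) circle_of_eq_iff[of s' s''] period_trichotomy by auto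
    ultimately show False
      using far D \<open>0 < D\<close> by (auto simp: abs_if split: if_splits)
  qed
  then have "s' = s + pi \<or> s + pi = s' + of_int 1 * (2 * pi)" using s(3) by (auto simp: abs_if split: if_splits)
  then have "circle_of s' = circle_of (s + pi)" using circle_of_eq_iff[of s' "s + pi"] by blast
  then show ?thesis using s by (auto simp: antipode_def circle_of_add)
qed

lemma unit_speed_chord:
  fixes f :: "circle \<Rightarrow> 'a::real_normed_vector"
  assumes f: "\<And>s. \<exists>d. ((\<lambda>s. f (circle_of s)) has_vector_derivative d) (at s) \<and> norm d = 1" and e: "0 < \<epsilon>"
  shows "\<exists>\<delta>>0. \<forall>t'. dist t' t < \<delta> \<longrightarrow> \<bar>norm (f t' - f t) - dist t' t\<bar> \<le> \<epsilon> * dist t' t"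
proof -
  obtain d where d: "((\<lambda>s. f (circle_of s)) has_vector_derivative d) (at (circle_rep t))" "norm d = 1"
    using f by blast
  then obtain \<delta> where \<delta>: "0 < \<delta>" "\<And>s. norm (s - circle_rep t) < \<delta> \<Longrightarrow>
      norm (f (circle_of s) - f t - (s - circle_rep t) *\<^sub>R d) \<le> \<epsilon> * norm (s - circle_rep t)"
    using e unfolding has_vector_derivative_def has_derivative_at_alt by (metis circle_of_circle_rep)
  have "\<bar>norm (f t' - f t) - dist t' t\<bar> \<le> \<epsilon> * dist t' t" if t': "dist t' t < \<delta>" for t'
  proof -
    obtain s where s: "circle_of s = t'" "\<bar>s - circle_rep t\<bar> = dist (circle_of (circle_rep t)) t'"
      by (rule circle_lift)
    have n: "norm ((s - circle_rep t) *\<^sub>R d) = dist t' t" using s(2) d(2) by (simp add: dist_commute)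
    have "\<bar>norm (f t' - f t) - norm ((s - circle_rep t) *\<^sub>R d)\<bar> \<le> norm (f t' - f t - (s - circle_rep t) *\<^sub>R d)"
      by (rule norm_triangle_ineq3)
    also have "\<dots> \<le> \<epsilon> * dist t' t" using \<delta>(2)[of s] s t' by (simp add: dist_commute)
    finally show ?thesis unfolding n .
  qed
  then show ?thesis using \<delta>(1) by blast
qed

text \<open>
  Let \<open>h\<close> be the involution of the circle with \<open>f (h t) = - f t\<close>. Since \<open>f\<close> has unit speed and negation
  preserves the norm, \<open>h\<close> preserves distances to first order. So \<open>h\<close> is distance-nonincreasing, being an
  involution it is an isometry, and it has no fixed point because \<open>f\<close> does not vanish.
\<close>

lemma unit_speed_antipode:
  fixes f :: "circle \<Rightarrow> 'a::real_normed_vector"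
  assumes f: "\<And>s. \<exists>d. ((\<lambda>s. f (circle_of s)) has_vector_derivative d) (at s) \<and> norm d = 1"
    and cont: "continuous_on UNIV f" and bij: "bij_betw f UNIV (sphere 0 R)" and R: "0 < R"
  shows "f (antipode t) = - f t"
proof -
  obtain g where g: "homeomorphism UNIV (sphere 0 R) f g"
    using homeomorphism_compact[OF compact_circle cont, of "sphere 0 R"] bij by (auto simp: bij_betw_def)
  define h where "h t = g (- f t)" for t
  have nf: "norm (f t) = R" for t using bij by (auto simp: bij_betw_def)
  have fh: "f (h t) = - f t" for t
    using homeomorphism_apply2[OF g, of "- f t"] nf[of t] by (simp add: h_def)
  have inj: "inj f" using bij by (simp add: bij_betw_def)
  have hh: "h (h t) = t" for t using fh[of "h t"] fh[of t] inj by (simp add: inj_eq)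
  have contg: "continuous_on (sphere 0 R) g" using g by (simp add: homeomorphism_def)
  have "continuous_on UNIV h"
    unfolding h_def by (rule continuous_on_compose2[OF contg]) (auto intro!: continuous_intros cont simp: nf)
  have short: "\<exists>\<delta>>0. \<forall>t'. dist t' t < \<delta> \<longrightarrow> dist (h t') (h t) \<le> (1 + \<epsilon>) * dist t' t" if \<epsilon>: "0 < \<epsilon>" for t \<epsilon>
  proof -
    \<comment> \<open>then \<open>(1 + e) / (1 - e) \<le> 1 + \<epsilon>\<close>\<close>
    define e where "e = min (1/2) (\<epsilon> / 4)"
    have e: "0 < e" "e \<le> 1/2" "4 * e \<le> \<epsilon>" using \<epsilon> by (auto simp: e_def)
    obtain \<delta>1 where \<delta>1: "0 < \<delta>1" "\<And>t'. dist t' t < \<delta>1 \<Longrightarrow> \<bar>norm (f t' - f t) - dist t' t\<bar> \<le> e * dist t' t"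
      using unit_speed_chord[of f, OF f e(1)] by blast
    obtain \<delta>2 where \<delta>2: "0 < \<delta>2" "\<And>t'. dist t' (h t) < \<delta>2 \<Longrightarrow> \<bar>norm (f t' - f (h t)) - dist t' (h t)\<bar> \<le> e * dist t' (h t)"
      using unit_speed_chord[of f, OF f e(1)] by blast
    obtain \<delta>3 where \<delta>3: "0 < \<delta>3" "\<And>t'. dist t' t < \<delta>3 \<Longrightarrow> dist (h t') (h t) < \<delta>2"
      using \<open>continuous_on UNIV h\<close> \<delta>2(1) unfolding continuous_on_iff by blast
    have "dist (h t') (h t) \<le> (1 + \<epsilon>) * dist t' t" if t': "dist t' t < min \<delta>1 \<delta>3" for t'
    proof -
      define D D' where "D = dist t' t" and "D' = dist (h t') (h t)"
      have "norm (f (h t') - f (h t)) = norm (f t' - f t)"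
        unfolding fh by (metis minus_diff_minus norm_minus_cancel)
      then have "D' - e * D' \<le> D + e * D"
        using \<delta>1(2)[of t'] \<delta>2(2)[of "h t'"] \<delta>3(2)[of t'] t' unfolding D_def D'_def by (simp add: abs_le_iff)
      then have 1: "(1 - e) * D' \<le> (1 + e) * D" by (simp add: algebra_simps)
      have "e * e \<le> e * (1/2)" using e by (intro mult_left_mono) auto
      then have "1 + e \<le> (1 - e) * (1 + 4 * e)" by (simp add: algebra_simps)
      also have "\<dots> \<le> (1 - e) * (1 + \<epsilon>)" using e by (intro mult_left_mono) auto
      finally have "(1 + e) * D \<le> (1 - e) * (1 + \<epsilon>) * D" by (intro mult_right_mono) (auto simp: D_def)
      with 1 have "(1 - e) * D' \<le> (1 - e) * ((1 + \<epsilon>) * D)" by (simp add: mult.assoc)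
      then show ?thesis using e by (simp add: D_def D'_def)
    qed
    then show ?thesis using \<delta>1(1) \<delta>3(1) by (intro exI[of _ "min \<delta>1 \<delta>3"]) auto
  qed
  have le: "dist (h t) (h t') \<le> dist t t'" for t t'
    by (rule infinitesimally_short_circle_map) (rule short)
  have "h t = antipode t"
  proof (rule circle_isometric_involution)
    show "dist (h t) (h t') = dist t t'" for t t'
      using le[of t t'] le[of "h t" "h t'"] by (simp add: hh)
    show "h t \<noteq> t" for t
    proof
      assume "h t = t"
      then have "f t = - f t" using fh[of t] by simp
      then have "norm (f t) = 0" by (simp add: eq_neg_iff_add_eq_0 flip: scaleR_2)
      then show False using nf[of t] R by simp
    qed
  qed (rule hh)
  then show ?thesis using fh[of t] by simp
qed

section \<open>Planes with an analytic norm\<close>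

text \<open>
  The functional \<open>L\<close> reduces a vector-valued series to a real one, for which unconditional
  convergence is absolute. At the corner \<open>(\<rho>, \<dots>, \<rho>)\<close> of a polydisc this gives the bound on the
  coefficients.
\<close>

lemma germ_of_power_series:
  fixes g :: "'v::real_normed_vector \<Rightarrow> 'w::real_normed_vector"
  assumes B: "finite B" "independent B" "span B = UNIV" and \<epsilon>: "0 < \<epsilon>"
    and ser: "\<forall>x\<in>ball a \<epsilon>. ((\<lambda>\<alpha>. (\<Prod>b\<in>B. representation B (x - a) b ^ \<alpha> b) *\<^sub>R c \<alpha>) has_sum g x) (B \<rightarrow>\<^sub>E UNIV)"
    and L: "bounded_linear (L :: 'w \<Rightarrow> real)"
  shows "analytic_germ B (\<lambda>y. L (g (a + (\<Sum>b\<in>B. y b *\<^sub>R b))))"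
proof -
  define S where "S = 1 + (\<Sum>b\<in>B. norm b)"
  have S: "0 < S" by (simp add: S_def add_pos_nonneg sum_nonneg)
  define \<rho> where "\<rho> = \<epsilon> / (2 * S)"
  have \<rho>: "0 < \<rho>" using \<epsilon> S by (simp add: \<rho>_def)
  define h where "h y = L (g (a + (\<Sum>b\<in>B. y b *\<^sub>R b)))" for y
  have val: "((\<lambda>\<alpha>. L (c \<alpha>) * monomial B y \<alpha>) has_sum h y) (B \<rightarrow>\<^sub>E UNIV)" if y: "\<forall>b\<in>B. \<bar>y b\<bar> \<le> \<rho>" for y
  proof -
    define x where "x = a + (\<Sum>b\<in>B. y b *\<^sub>R b)"
    have rep: "representation B (x - a) b = y b" if "b \<in> B" for b
    proof -
      have "representation B (\<Sum>b\<in>B. y b *\<^sub>R b) b = (\<Sum>b'\<in>B. y b' * representation B b' b)"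
        using B by (simp add: representation_sum representation_scale)
      also have "\<dots> = (\<Sum>b'\<in>B. if b' = b then y b' else 0)"
        using B by (intro sum.cong) (auto simp: representation_basis)
      also have "\<dots> = y b" using B that by simp
      finally show ?thesis by (simp add: x_def)
    qed
    have "norm (x - a) \<le> (\<Sum>b\<in>B. norm (y b *\<^sub>R b))" unfolding x_def add_diff_cancel_left' by (rule norm_sum)
    also have "\<dots> \<le> (\<Sum>b\<in>B. \<rho> * norm b)" using y by (intro sum_mono) (simp add: mult_right_mono)
    also have "\<dots> = \<rho> * (\<Sum>b\<in>B. norm b)" by (simp add: sum_distrib_left)
    also have "\<dots> \<le> \<rho> * S" using \<rho> by (simp add: S_def)
    also have "\<dots> < \<epsilon>" using \<epsilon> S by (simp add: \<rho>_def)
    finally have "x \<in> ball a \<epsilon>" by (simp add: dist_norm norm_minus_commute)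
    with ser have "((\<lambda>\<alpha>. (\<Prod>b\<in>B. representation B (x - a) b ^ \<alpha> b) *\<^sub>R c \<alpha>) has_sum g x) (B \<rightarrow>\<^sub>E UNIV)"
      by blast
    then have "((\<lambda>\<alpha>. L ((\<Prod>b\<in>B. representation B (x - a) b ^ \<alpha> b) *\<^sub>R c \<alpha>)) has_sum L (g x)) (B \<rightarrow>\<^sub>E UNIV)"
      by (rule has_sum_bounded_linear[OF L])
    then show ?thesis
      by (simp add: rep linear_scale[OF bounded_linear.linear[OF L]] monomial_def h_def x_def[symmetric] mult.commute)
  qed
  have "monomial B (\<lambda>_. \<rho>) \<alpha> = \<rho> ^ sum \<alpha> B" for \<alpha>
    by (simp add: monomial_def power_sum)
  then have "((\<lambda>\<alpha>. L (c \<alpha>) * \<rho> ^ sum \<alpha> B) has_sum h (\<lambda>_. \<rho>)) (B \<rightarrow>\<^sub>E UNIV)"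
    using val[of "\<lambda>_. \<rho>"] \<rho> by simp
  then have "(\<lambda>\<alpha>. norm (L (c \<alpha>) * \<rho> ^ sum \<alpha> B)) summable_on (B \<rightarrow>\<^sub>E UNIV)"
    by (rule summable_on_iff_abs_summable_on_real[THEN iffD1, OF has_sum_imp_summable])
  then have "(\<lambda>\<alpha>. \<bar>L (c \<alpha>)\<bar> * \<rho> ^ sum \<alpha> B) summable_on (B \<rightarrow>\<^sub>E UNIV)"
    using \<rho> by (simp add: abs_mult)
  then obtain D where "((\<lambda>\<alpha>. \<bar>L (c \<alpha>)\<bar> * \<rho> ^ sum \<alpha> B) has_sum D) (B \<rightarrow>\<^sub>E UNIV)"
    by (auto simp: summable_on_def)
  then have "expansion B \<rho> (\<lambda>\<alpha>. L (c \<alpha>)) h D"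
    unfolding expansion_def using val by (intro conjI exI[of _ D] allI impI order_refl)
  then have "analytic_germ B h" using \<rho> by (auto simp: analytic_germ_def majorized_def)
  then show ?thesis by (simp only: h_def[abs_def])
qed

lemma germ_of_power_series_subst:
  fixes g :: "'v::real_normed_vector \<Rightarrow> 'w::real_normed_vector" and w :: "('i \<Rightarrow> real) \<Rightarrow> 'v"
  assumes B: "finite B" "independent B" "span B = UNIV" and \<epsilon>: "0 < \<epsilon>"
    and ser: "\<forall>x\<in>ball (w (\<lambda>_. 0)) \<epsilon>. ((\<lambda>\<alpha>. (\<Prod>b\<in>B. representation B (x - w (\<lambda>_. 0)) b ^ \<alpha> b) *\<^sub>R c \<alpha>) has_sum g x) (B \<rightarrow>\<^sub>E UNIV)"
    and L: "bounded_linear (L :: 'w \<Rightarrow> real)"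
    and I: "finite I" and w: "\<And>b. b \<in> B \<Longrightarrow> analytic_germ I (\<lambda>y. representation B (w y) b)"
  shows "analytic_germ I (\<lambda>y. L (g (w y)))"
proof -
  define a where "a = w (\<lambda>_. 0)"
  have "analytic_germ I (\<lambda>y. representation B (w y) b - representation B a b)" if "b \<in> B" for b
    using w[OF that] by (intro analytic_germ_diff analytic_germ_const)
  then have "analytic_germ I (\<lambda>y. representation B (w y - a) b)" if "b \<in> B" for b
    using that B by (simp add: representation_diff)
  moreover have "representation B (w (\<lambda>_. 0) - a) b = 0" for b
    by (simp add: a_def representation_zero)
  ultimately have "analytic_germ I (\<lambda>y. L (g (a + (\<Sum>b\<in>B. representation B (w y - a) b *\<^sub>R b))))"
    by (intro analytic_germ_compose[OF I B(1) germ_of_power_series[OF B \<epsilon> ser L, folded a_def],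
          where h = "\<lambda>b y. representation B (w y - a) b"])
  then show ?thesis using B by (simp add: sum_representation_eq)
qed

text \<open>
  The basis of the plane is the one in which the power series of the norm are given, so these
  series can be used without a change of coordinates.
\<close>

locale analytic_plane = plane u v for u v :: "'a::real_normed_vector" +
  assumes norm_series: "a \<noteq> (0::'a) \<Longrightarrow> \<exists>\<epsilon>>0. \<exists>c. \<forall>x\<in>ball a \<epsilon>.
    ((\<lambda>\<alpha>. (\<Prod>b\<in>{u, v}. representation {u, v} (x - a) b ^ \<alpha> b) *\<^sub>R c \<alpha>) has_sum norm x) ({u, v} \<rightarrow>\<^sub>E UNIV)"
begin

definition plane_germ :: "'i set \<Rightarrow> (('i \<Rightarrow> real) \<Rightarrow> 'a) \<Rightarrow> bool" where
  "plane_germ I w \<longleftrightarrow> analytic_germ I (\<lambda>y. co1 (w y)) \<and> analytic_germ I (\<lambda>y. co2 (w y))"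

lemma plane_germ_const: "plane_germ I (\<lambda>_. a)"
  by (simp add: plane_germ_def analytic_germ_const)

lemma plane_germ_add: "plane_germ I w \<Longrightarrow> plane_germ I w' \<Longrightarrow> plane_germ I (\<lambda>y. w y + w' y)"
  by (simp add: plane_germ_def co_simps analytic_germ_add)

lemma plane_germ_diff: "plane_germ I w \<Longrightarrow> plane_germ I w' \<Longrightarrow> plane_germ I (\<lambda>y. w y - w' y)"
  by (simp add: plane_germ_def co_simps analytic_germ_diff)

lemma plane_germ_scale: "analytic_germ I h \<Longrightarrow> plane_germ I w \<Longrightarrow> plane_germ I (\<lambda>y. h y *\<^sub>R w y)"
  by (simp add: plane_germ_def co_simps analytic_germ_mult)

lemma germ_norm:
  assumes I: "finite I" and w: "plane_germ I w" and nz: "w (\<lambda>_. 0) \<noteq> 0"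
  shows "analytic_germ I (\<lambda>y. norm (w y))"
proof -
  obtain \<epsilon> c where "0 < \<epsilon>" "\<forall>x\<in>ball (w (\<lambda>_. 0)) \<epsilon>.
    ((\<lambda>\<alpha>. (\<Prod>b\<in>{u, v}. representation {u, v} (x - w (\<lambda>_. 0)) b ^ \<alpha> b) *\<^sub>R c \<alpha>) has_sum norm x) ({u, v} \<rightarrow>\<^sub>E UNIV)"
    using norm_series[OF nz] by blast
  then show ?thesis
    by (rule germ_of_power_series_subst[where L = "\<lambda>x. x", OF _ uv(2,3) _ _ bounded_linear_ident I, rotated])
      (use w in \<open>auto simp: plane_germ_def co1_def co2_def\<close>)
qed

text \<open>
  The set of points near which the norm has the value \<open>C\<close> is open in the line, and closed by the
  identity theorem for power series.
\<close>

lemma norm_constant_on_line: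
  fixes a w :: 'a
  assumes line: "\<And>s. a + s *\<^sub>R w \<noteq> 0" and one: "\<And>s. 0 \<le> s \<Longrightarrow> s \<le> 1 \<Longrightarrow> norm (a + s *\<^sub>R w) = C"
  shows "norm (a + s *\<^sub>R w) = C"
proof -
  define Z where "Z = {s. \<exists>\<epsilon>>0. \<forall>t. \<bar>t\<bar> < \<epsilon> \<longrightarrow> norm (a + (s + t) *\<^sub>R w) = C}"
  have Z_value: "norm (a + s *\<^sub>R w) = C" if s: "s \<in> Z" for s
  proof -
    obtain \<epsilon> where "0 < \<epsilon>" "\<forall>t. \<bar>t\<bar> < \<epsilon> \<longrightarrow> norm (a + (s + t) *\<^sub>R w) = C"
      using s by (auto simp: Z_def)
    from this(2)[rule_format, of 0] this(1) show ?thesis by simp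
  qed
  have "open Z"
    unfolding open_dist
  proof (intro ballI)
    fix s assume "s \<in> Z"
    then obtain \<epsilon> where \<epsilon>: "0 < \<epsilon>" "\<And>t. \<bar>t\<bar> < \<epsilon> \<Longrightarrow> norm (a + (s + t) *\<^sub>R w) = C"
      by (auto simp: Z_def)
    have "s' \<in> Z" if s': "dist s' s < \<epsilon> / 2" for s'
    proof -
      have "norm (a + (s' + t) *\<^sub>R w) = C" if "\<bar>t\<bar> < \<epsilon> / 2" for t
      proof -
        have "\<bar>s' - s + t\<bar> < \<epsilon>" using s' that unfolding dist_real_def by linarith
        from \<epsilon>(2)[OF this] show ?thesis by (simp add: add.assoc[symmetric])
      qed
      then show ?thesis unfolding Z_def using \<epsilon>(1) by (intro CollectI exI[of _ "\<epsilon> / 2"]) auto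
    qed
    then show "\<exists>e>0. \<forall>y. dist y s < e \<longrightarrow> y \<in> Z" using \<epsilon>(1) by (intro exI[of _ "\<epsilon> / 2"]) auto
  qed
  moreover have "closed Z"
    unfolding closure_subset_eq[symmetric]
  proof
    fix s assume s: "s \<in> closure Z"
    have cl: "closed {s. norm (a + s *\<^sub>R w) = C}" by (intro closed_Collect_eq continuous_intros)
    have "closure Z \<subseteq> {s. norm (a + s *\<^sub>R w) = C}" by (rule closure_minimal[OF _ cl]) (use Z_value in auto)
    with s have sC: "norm (a + s *\<^sub>R w) = C" by blast
    define h where "h y = norm (a + (s + y ()) *\<^sub>R w) - C" for y :: "unit \<Rightarrow> real"
    have h0: "h (\<lambda>_. 0) = 0" by (simp add: h_def sC)
    have "plane_germ {()} (\<lambda>y. a + (s + y ()) *\<^sub>R w)"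
      by (intro plane_germ_add plane_germ_scale plane_germ_const analytic_germ_add analytic_germ_const analytic_germ_var) auto
    then have "analytic_germ {()} h"
      unfolding h_def[abs_def]
      by (intro analytic_germ_diff germ_norm analytic_germ_const) (use line[of s] in auto)
    moreover have "\<exists>t. t \<noteq> 0 \<and> \<bar>t\<bar> < \<epsilon> \<and> h (\<lambda>_. t) = 0" if \<epsilon>: "0 < \<epsilon>" for \<epsilon>
    proof -
      obtain s' where s': "s' \<in> Z" "dist s' s < \<epsilon> / 2" using s \<epsilon> unfolding closure_approachable by (metis half_gt_zero)
      then obtain e where e: "0 < e" "\<And>t. \<bar>t\<bar> < e \<Longrightarrow> norm (a + (s' + t) *\<^sub>R w) = C"
        by (auto simp: Z_def)
      \<comment> \<open>a second zero next to \<open>s'\<close>, in case \<open>s'\<close> is \<open>s\<close> itself\<close>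
      define r where "r = min (e / 2) (\<epsilon> / 4)"
      have r: "0 < r" "r < e" "r < \<epsilon> / 2" using e \<epsilon> by (auto simp: r_def)
      have z: "h (\<lambda>_. s' - s) = 0" "h (\<lambda>_. s' - s + r) = 0"
        using e(2)[of 0] e(2)[of r] e(1) r by (simp_all add: h_def add.assoc)
      show ?thesis
      proof (cases "s' = s")
        case True
        then show ?thesis using z(2) r \<epsilon> by (intro exI[of _ r]) auto
      next
        case False
        then show ?thesis using z(1) s'(2) \<epsilon> by (intro exI[of _ "s' - s"]) (auto simp: dist_real_def)
      qed
    qed
    ultimately have "\<exists>\<epsilon>>0. \<forall>t. \<bar>t\<bar> < \<epsilon> \<longrightarrow> h (\<lambda>_. t) = 0"
      using h0 by (intro analytic_germ_identity)
    then show "s \<in> Z" by (simp add: Z_def h_def)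
  qed
  moreover have "1/2 \<in> Z"
    unfolding Z_def using one by (intro CollectI exI[of _ "1/2"]) (auto simp: abs_if split: if_splits)
  ultimately have "Z = UNIV" using clopen[of Z] by blast
  then show ?thesis using Z_value by blast
qed

text \<open>
  If equality holds for two independent vectors, then the norm takes the value \<open>1\<close> at an inner point of
  the segment between the two unit vectors in their directions; by convexity it is \<open>1\<close> on the
  whole segment, hence on the whole line through it. But the norm is unbounded on a line.
\<close>

lemma strictly_convex:
  fixes x y :: 'a
  assumes eq: "norm (x + y) = norm x + norm y" and x: "x \<noteq> 0"
  shows "\<exists>c\<ge>0. y = c *\<^sub>R x"
proof (cases "det2 x y = 0")
  case True
  then obtain c where c: "y = c *\<^sub>R x" using det2_zero_iff[OF x] by blast
  have "x + y = (1 + c) *\<^sub>R x" by (simp add: c algebra_simps)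
  then have "\<bar>1 + c\<bar> * norm x = (1 + \<bar>c\<bar>) * norm x"
    using eq by (metis c distrib_right mult_1 norm_scaleR)
  then have "\<bar>1 + c\<bar> = 1 + \<bar>c\<bar>" using x by simp
  then have "0 \<le> c" by linarith
  with c show ?thesis by blast
next
  case False
  then have y: "y \<noteq> 0" by (auto simp: det2_bilinear)
  define X Y where "X = x /\<^sub>R norm x" and "Y = y /\<^sub>R norm y"
  have XY: "norm X = 1" "norm Y = 1" "det2 X Y \<noteq> 0"
    using x y False by (auto simp: X_def Y_def det2_bilinear)
  define P where "P s = X + s *\<^sub>R (Y - X)" for s :: real
  have P0: "P s \<noteq> 0" for s
  proof
    assume P: "P s = 0"
    then have "det2 X (P s) = 0" "det2 Y (P s) = 0" by (simp_all add: det2_bilinear)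
    then have "s = 0" "s = 1" using XY(3) det2_swap[of Y X] by (auto simp: P_def det2_bilinear algebra_simps)
    then show False by simp
  qed
  have Pc: "P ((1 - c) * s + c * t) = (1 - c) *\<^sub>R P s + c *\<^sub>R P t" for c s t
    by (simp add: P_def algebra_simps)
  have conv: "norm (P ((1 - c) * s + c * t)) \<le> (1 - c) * norm (P s) + c * norm (P t)" if "0 \<le> c" "c \<le> 1" for c s t
    unfolding Pc using norm_triangle_ineq[of "(1 - c) *\<^sub>R P s" "c *\<^sub>R P t"] that by simp
  have ends: "norm (P 0) = 1" "norm (P 1) = 1" using XY by (auto simp: P_def)
  have le: "norm (P s) \<le> 1" if "0 \<le> s" "s \<le> 1" for s
    using conv[of s 0 1] that ends by simp
  define m where "m = norm y / (norm x + norm y)"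
  have nxy: "0 < norm x + norm y" using x by (simp add: add_pos_nonneg)
  have m: "0 < m" "m < 1" using x y nxy by (auto simp: m_def divide_less_eq)
  have "(norm x + norm y) *\<^sub>R P m = x + y"
  proof -
    have "(norm x + norm y) * m = norm y" using nxy by (simp add: m_def)
    then have "(norm x + norm y) *\<^sub>R P m = (norm x + norm y) *\<^sub>R X + norm y *\<^sub>R (Y - X)"
      by (simp only: P_def scaleR_right_distrib scaleR_scaleR)
    also have "\<dots> = norm x *\<^sub>R X + norm y *\<^sub>R Y" by (simp add: algebra_simps)
    finally show ?thesis using x y by (simp add: X_def Y_def)
  qed
  then have "(norm x + norm y) * norm (P m) = norm x + norm y"
    using eq nxy by (metis abs_of_pos norm_scaleR)
  then have Pm: "norm (P m) = 1" using nxy by simp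
  have "norm (P s) = 1" if s: "0 \<le> s" "s \<le> 1" for s
  proof (rule antisym[OF le[OF s]])
    \<comment> \<open>the interior maximum at \<open>m\<close> lies between \<open>s\<close> and an end of the segment\<close>
    consider "s = m" | "s < m" | "m < s" by linarith
    then show "1 \<le> norm (P s)"
    proof cases
      case 2
      define c where "c = (m - s) / (1 - s)"
      have c: "0 \<le> c" "c < 1" using 2 m s by (auto simp: c_def divide_less_eq)
      have "c * (1 - s) = m - s" using 2 m by (simp add: c_def)
      then have "(1 - c) * s + c * 1 = m" by (simp add: algebra_simps)
      then have "1 \<le> (1 - c) * norm (P s) + c * 1" using conv[of c s 1] c Pm ends by simp
      then have "(1 - c) * 1 \<le> (1 - c) * norm (P s)" by simp
      then show ?thesis using c by simp
    next
      case 3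
      define c where "c = m / s"
      have c: "0 < c" "c \<le> 1" using 3 m s by (auto simp: c_def)
      have "(1 - c) * 0 + c * s = m" using 3 m by (simp add: c_def)
      then have "1 \<le> (1 - c) * 1 + c * norm (P s)" using conv[of c 0 s] c Pm ends by simp
      then have "c * 1 \<le> c * norm (P s)" by simp
      then show ?thesis using c by simp
    qed (simp add: Pm)
  qed
  then have const: "norm (P s) = 1" for s
    using norm_constant_on_line[of X "Y - X" 1 s] P0 unfolding P_def by blast
  define s where "s = 3 / norm (Y - X)"
  have "Y - X \<noteq> 0" using XY by (auto simp: det2_bilinear)
  then have "norm (s *\<^sub>R (Y - X)) = 3" by (simp add: s_def)
  moreover have "norm (s *\<^sub>R (Y - X)) \<le> norm (P s) + norm X"
    using norm_triangle_ineq4[of "P s" X] by (simp add: P_def)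
  ultimately show ?thesis using const[of s] XY by simp
qed

end

sublocale analytic_plane \<subseteq> strict_plane
  by unfold_locales (rule strictly_convex)

section \<open>Moving along the sphere changes distances to first order\<close>

lemma DERIV_of_square_bound:
  fixes g :: "real \<Rightarrow> real"
  assumes "0 < R" and b: "\<And>t. \<bar>t\<bar> \<le> R \<Longrightarrow> \<bar>g (s + t) - g s - d * t\<bar> \<le> K * t\<^sup>2"
  shows "(g has_real_derivative d) (at s)"
  unfolding DERIV_def
proof (rule LIM_zero_cancel, rule Lim_null_comparison)
  show "\<forall>\<^sub>F t in at 0. norm ((g (s + t) - g s) / t - d) \<le> \<bar>K\<bar> * \<bar>t\<bar>"
    unfolding eventually_at
  proof (intro exI[of _ R] conjI ballI impI)
    fix t :: real assume t: "t \<noteq> 0 \<and> dist t 0 < R"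
    then have "\<bar>g (s + t) - g s - d * t\<bar> \<le> K * t\<^sup>2" by (intro b) auto
    also have "\<dots> \<le> \<bar>K\<bar> * t\<^sup>2" by (intro mult_right_mono) auto
    finally have "\<bar>g (s + t) - g s - d * t\<bar> / \<bar>t\<bar> \<le> \<bar>K\<bar> * \<bar>t\<bar>"
      using t by (simp add: divide_le_eq power2_eq_square mult.assoc)
    moreover have "(g (s + t) - g s) / t - d = (g (s + t) - g s - d * t) / t" using t by (simp add: field_simps)
    ultimately show "norm ((g (s + t) - g s) / t - d) \<le> \<bar>K\<bar> * \<bar>t\<bar>" by (simp add: abs_divide)
  qed (use assms in auto)
  show "((\<lambda>t::real. \<bar>K\<bar> * \<bar>t\<bar>) \<longlongrightarrow> 0) (at 0)"
    by (intro tendsto_mult_right_zero tendsto_rabs_zero tendsto_ident_at)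
qed

text \<open>
  A convex function attains its minimum where it is stationary.
\<close>

lemma norm_minimal_if_stationary:
  fixes a w :: "'a::real_normed_vector"
  assumes "((\<lambda>s. (norm (a + s *\<^sub>R w) - norm a) / s) \<longlongrightarrow> 0) (at 0)"
  shows "norm a \<le> norm (a + s *\<^sub>R w)"
proof (cases "s = 0")
  case False
  define g where "g s = norm (a + s *\<^sub>R w)" for s
  have "((\<lambda>l. s * ((g (s * l) - norm a) / (s * l))) \<longlongrightarrow> s * 0) (at_right 0)"
  proof (intro tendsto_intros)
    have "filterlim (\<lambda>l. s * l) (at 0) (at_right 0)"
      unfolding filterlim_at
    proof
      show "((\<lambda>l. s * l) \<longlongrightarrow> 0) (at_right 0)" by (intro tendsto_eq_intros) auto
      show "\<forall>\<^sub>F x in at_right 0. s * x \<in> UNIV \<and> s * x \<noteq> 0"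
        using eventually_at_right_less by eventually_elim (use False in auto)
    qed
    with assms show "((\<lambda>l. (g (s * l) - norm a) / (s * l)) \<longlongrightarrow> 0) (at_right 0)"
      unfolding g_def by (rule filterlim_compose)
  qed
  moreover have "\<forall>\<^sub>F l in at_right 0. s * ((g (s * l) - norm a) / (s * l)) \<le> g s - norm a"
    unfolding eventually_at_right_field
  proof (intro exI[of _ 1] conjI allI impI)
    fix l :: real assume l: "0 < l" "l < 1"
    have "a + (s * l) *\<^sub>R w = (1 - l) *\<^sub>R a + l *\<^sub>R (a + s *\<^sub>R w)" by (simp add: algebra_simps)
    then have "g (s * l) \<le> (1 - l) * norm a + l * g s"
      unfolding g_def using norm_triangle_ineq[of "(1 - l) *\<^sub>R a" "l *\<^sub>R (a + s *\<^sub>R w)"] l by simp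
    then have "g (s * l) - norm a \<le> l * (g s - norm a)" by (simp add: algebra_simps)
    then have "(g (s * l) - norm a) / l \<le> g s - norm a" using l by (simp add: divide_le_eq mult.commute)
    then show "s * ((g (s * l) - norm a) / (s * l)) \<le> g s - norm a" using False l by simp
  qed simp
  ultimately have "s * 0 \<le> g s - norm a"
    by (rule tendsto_upperbound) (rule trivial_limit_at_right_real)
  then show ?thesis by (simp add: g_def)
qed simp

text \<open>
  Both \<open>p\<close> and \<open>r\<close> are Birkhoff-orthogonal to \<open>w\<close>. On the line through \<open>r\<close> in the direction \<open>w\<close>
  the point nearest to \<open>0\<close> is unique by strict convexity, and both \<open>r\<close> and a multiple of \<open>p\<close> are
  nearest points.
\<close>

lemma (in strict_plane) common_birkhoff_orthogonal:
  assumes w: "w \<noteq> 0" and p: "p \<noteq> 0" and min_p: "\<And>s. norm p \<le> norm (p + s *\<^sub>R w)"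
    and min_r: "\<And>s. norm r \<le> norm (r + s *\<^sub>R w)"
  shows "det2 p r = 0"
proof -
  have pw: "det2 p w \<noteq> 0"
  proof
    assume "det2 p w = 0"
    then obtain c where c: "w = c *\<^sub>R p" using det2_zero_iff[OF p] by blast
    then have "c \<noteq> 0" using w by auto
    then have "p + (- 1 / c) *\<^sub>R w = 0" by (simp add: c)
    then show False using min_p[of "- 1 / c"] p by simp
  qed
  define a b where "a = det2 r w / det2 p w" and "b = det2 p r / det2 p w"
  have r: "r = a *\<^sub>R p + b *\<^sub>R w" unfolding a_def b_def by (rule cramer[OF pw])
  have min_ap: "norm (a *\<^sub>R p) \<le> norm (a *\<^sub>R p + s *\<^sub>R w)" for s
  proof (cases "a = 0")
    case False
    have "a *\<^sub>R p + s *\<^sub>R w = a *\<^sub>R (p + (s / a) *\<^sub>R w)" using False by (simp add: scaleR_right_distrib)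
    then show ?thesis using min_p[of "s / a"] by (simp add: mult_left_mono)
  qed simp
  have "norm r \<le> norm (a *\<^sub>R p)" using min_r[of "- b"] by (simp add: r)
  moreover have "norm (a *\<^sub>R p) \<le> norm r" using min_ap[of b] by (simp add: r)
  moreover have "norm (a *\<^sub>R p) + norm (a *\<^sub>R p) \<le> norm (a *\<^sub>R p + r)"
  proof -
    \<comment> \<open>the midpoint of the two nearest points is no nearer, which is equality in the triangle inequality\<close>
    have "a *\<^sub>R p + r = 2 *\<^sub>R (a *\<^sub>R p + (b / 2) *\<^sub>R w)"
      unfolding r scaleR_right_distrib scaleR_scaleR by (simp flip: scaleR_left_distrib)
    then have "norm (a *\<^sub>R p + r) = 2 * norm (a *\<^sub>R p + (b / 2) *\<^sub>R w)" by simp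
    then show ?thesis using min_ap[of "b / 2"] by simp
  qed
  ultimately have "norm (a *\<^sub>R p + r) = norm (a *\<^sub>R p) + norm r"
    using norm_triangle_ineq[of "a *\<^sub>R p" r] by simp
  then have "a * det2 p r = 0" using strict_det2[of "a *\<^sub>R p" r] by (simp add: det2_bilinear)
  moreover have "det2 p r = 0" if "a = 0"
    using \<open>norm r \<le> norm (a *\<^sub>R p)\<close> that by (simp add: det2_bilinear)
  ultimately show ?thesis by auto
qed

lemma representation_real:
  assumes "independent B" "span B = (UNIV :: real set)"
  shows "representation B s b = s * representation B 1 b"
  using representation_scale[of B 1 s] assms by simp

context analytic_plane
begin

lemma plane_germ_circle:
  fixes f :: "circle \<Rightarrow> 'a" and h :: "('i \<Rightarrow> real) \<Rightarrow> real"
  assumes f: "circle_analytic f" and I: "finite I" and h: "analytic_germ I h"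
  shows "plane_germ I (\<lambda>y. f (circle_of (h y)))"
proof -
  obtain B where B: "finite B" "independent B" "span B = (UNIV :: real set)" and
    "\<forall>a. \<exists>\<epsilon>>0. \<exists>c. \<forall>x\<in>ball a \<epsilon>.
      ((\<lambda>\<alpha>. (\<Prod>b\<in>B. representation B (x - a) b ^ \<alpha> b) *\<^sub>R c \<alpha>) has_sum f (circle_of x)) (B \<rightarrow>\<^sub>E UNIV)"
    using f unfolding circle_analytic_def real_analytic_on_def by auto
  then obtain \<epsilon> c where ser: "0 < \<epsilon>" "\<forall>x\<in>ball (h (\<lambda>_. 0)) \<epsilon>.
      ((\<lambda>\<alpha>. (\<Prod>b\<in>B. representation B (x - h (\<lambda>_. 0)) b ^ \<alpha> b) *\<^sub>R c \<alpha>) has_sum f (circle_of x)) (B \<rightarrow>\<^sub>E UNIV)"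
    by meson
  have rep: "analytic_germ I (\<lambda>y. representation B (h y) b)" for b
    unfolding representation_real[OF B(2,3), of "h _"] by (intro analytic_germ_mult analytic_germ_const h)
  have "analytic_germ I (\<lambda>y. L (f (circle_of (h y))))" if "bounded_linear L" for L
    by (rule germ_of_power_series_subst[where w = h and g = "\<lambda>s. f (circle_of s)", OF B ser that I rep])
  then show ?thesis using bounded_linear_co by (simp add: plane_germ_def)
qed

lemma circle_differentiable:
  fixes f :: "circle \<Rightarrow> 'a"
  assumes f: "circle_analytic f"
  shows "\<exists>d. ((\<lambda>s. f (circle_of s)) has_vector_derivative d) (at s)"
proof -
  have g: "plane_germ {()} (\<lambda>y. f (circle_of (s + y ())))"
    by (intro plane_germ_circle f analytic_germ_add analytic_germ_const analytic_germ_var) auto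
  have upd: "(\<lambda>_. 0)(() := t) = (\<lambda>_. t)" for t :: real by auto
  have d: "\<exists>d. ((\<lambda>s. L (f (circle_of s))) has_real_derivative d) (at s)"
    if L: "analytic_germ {()} (\<lambda>y. L (f (circle_of (s + y ()))))" for L
  proof -
    obtain d K R where "0 < R" and b: "\<And>t. \<bar>t\<bar> \<le> R \<Longrightarrow>
        \<bar>L (f (circle_of (s + ((\<lambda>_. 0)(() := t)) ()))) - L (f (circle_of (s + 0))) - d * t\<bar> \<le> K * t\<^sup>2"
      by (rule analytic_germ_first_order[OF L]) auto
    then show ?thesis
      by (intro exI[of _ d] DERIV_of_square_bound[of R _ s d K]) simp_all
  qed
  obtain d1 d2 where "((\<lambda>s. co1 (f (circle_of s))) has_real_derivative d1) (at s)"
    "((\<lambda>s. co2 (f (circle_of s))) has_real_derivative d2) (at s)"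
    using d[of co1] d[of co2] g unfolding plane_germ_def by blast
  then have "((\<lambda>s. co1 (f (circle_of s)) *\<^sub>R u + co2 (f (circle_of s)) *\<^sub>R v) has_vector_derivative
      (d1 *\<^sub>R u + d2 *\<^sub>R v)) (at s)"
    by (auto intro!: derivative_eq_intros)
  then show ?thesis by (subst (asm) co_eq[symmetric]) blast
qed

text \<open>
  The derivative is prescribed at the representatives in \<open>[0, 2\<pi>)\<close> and carried to
  the other real angles by periodicity.
\<close>

lemma unit_speed:
  fixes f :: "circle \<Rightarrow> 'a"
  assumes f: "circle_analytic f" and speed: "\<forall>t. norm (circle_deriv f t) = 1"
  shows "\<exists>d. ((\<lambda>s. f (circle_of s)) has_vector_derivative d) (at s) \<and> norm d = 1"
proof -
  obtain k :: int where k: "circle_rep (circle_of s) = s + of_int k * (2 * pi)"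
    using circle_rep_shift by blast
  define P where "P = of_int k * (2 * pi)"
  obtain d where d: "((\<lambda>s. f (circle_of s)) has_vector_derivative d) (at (s + P))"
    using circle_differentiable[OF f] by blast
  have "circle_deriv f (circle_of s) = d"
    unfolding circle_deriv_def k P_def[symmetric] by (rule vector_derivative_at[OF d])
  then have "norm d = 1" using speed by metis
  have per: "f (circle_of (r + P)) = f (circle_of r)" for r
    using circle_of_eq_iff[of r "r + P"] by (auto simp: P_def)
  have "((\<lambda>r. r + P) has_vector_derivative 1) (at s)" by (auto intro!: derivative_eq_intros)
  from vector_diff_chain_at[OF this d] \<open>norm d = 1\<close> show ?thesis by (auto simp: o_def per)
qed

lemma circle_analytic_continuous:
  fixes f :: "circle \<Rightarrow> 'a"
  assumes "circle_analytic f"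
  shows "continuous_on UNIV f"
proof (rule continuous_on_circleI)
  show "continuous_on UNIV (\<lambda>s. f (circle_of s))"
    unfolding continuous_on_eq_continuous_within
    using circle_differentiable[OF assms] has_vector_derivative_continuous by fastforce
qed

text \<open>
  The partial derivative needed for the implicit function theorem. The tangent \<open>w\<close> at the point
  \<open>p\<close> of the sphere is Birkhoff-orthogonal to \<open>p\<close>, because the distance to \<open>0\<close> is constant on the sphere.
  If the distance to \<open>q\<close> were stationary too, \<open>w\<close> would also be Birkhoff-orthogonal to \<open>p - q\<close>, so
  that \<open>p\<close> and \<open>q\<close> would be linearly dependent.
\<close>

lemma distance_along_sphere_nonstationary:
  fixes f :: "circle \<Rightarrow> 'a"
  assumes d: "((\<lambda>s. f (circle_of s)) has_vector_derivative d) (at \<theta>)" "d \<noteq> 0"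
    and sph: "\<And>t. norm (f t) = m" and R: "0 < R"
    and p: "p = R *\<^sub>R f (circle_of \<theta>)" and pq: "det2 q p \<noteq> 0"
  shows "\<not> ((\<lambda>s. (norm (R *\<^sub>R f (circle_of (\<theta> + s)) - q) - norm (p - q)) / s) \<longlongrightarrow> 0) (at 0)"
proof
  assume stat: "((\<lambda>s. (norm (R *\<^sub>R f (circle_of (\<theta> + s)) - q) - norm (p - q)) / s) \<longlongrightarrow> 0) (at 0)"
  define w where "w = R *\<^sub>R d"
  define F where "F s = R *\<^sub>R f (circle_of (\<theta> + s))" for s
  have "((\<lambda>s. F s) has_vector_derivative w) (at 0)"
  proof -
    have "((\<lambda>s. \<theta> + s) has_vector_derivative 1) (at 0)" by (auto intro!: derivative_eq_intros)
    moreover have "((\<lambda>s. f (circle_of s)) has_vector_derivative d) (at (\<theta> + 0))" using d by simp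
    ultimately have "(((\<lambda>s. f (circle_of s)) \<circ> (\<lambda>s. \<theta> + s)) has_vector_derivative 1 *\<^sub>R d) (at 0)"
      by (rule vector_diff_chain_at)
    then show ?thesis unfolding F_def w_def o_def by (auto intro!: derivative_eq_intros)
  qed
  then have tang: "((\<lambda>s. norm (F s - p - s *\<^sub>R w) / norm s) \<longlongrightarrow> 0) (at 0)"
    unfolding has_vector_derivative_def has_derivative_at by (simp add: F_def p)
  \<comment> \<open>the curve and its tangent line have the same first-order distances\<close>
  have transfer: "norm (p - c) \<le> norm (p - c + s *\<^sub>R w)"
    if c: "((\<lambda>s. (norm (F s - c) - norm (p - c)) / s) \<longlongrightarrow> 0) (at 0)" for c s
  proof (rule norm_minimal_if_stationary)
    have "((\<lambda>s. (norm (p - c + s *\<^sub>R w) - norm (F s - c)) / s) \<longlongrightarrow> 0) (at 0)"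
    proof (rule Lim_null_comparison[OF always_eventually[OF allI] tang])
      fix s
      have "\<bar>norm (p - c + s *\<^sub>R w) - norm (F s - c)\<bar> \<le> norm (p - c + s *\<^sub>R w - (F s - c))"
        by (rule norm_triangle_ineq3)
      also have "p - c + s *\<^sub>R w - (F s - c) = - (F s - p - s *\<^sub>R w)" by simp
      finally show "norm ((norm (p - c + s *\<^sub>R w) - norm (F s - c)) / s) \<le> norm (F s - p - s *\<^sub>R w) / norm s"
        by (simp add: abs_divide divide_right_mono norm_minus_commute del: minus_diff_eq)
    qed
    from tendsto_add[OF this c]
    show "((\<lambda>s. (norm (p - c + s *\<^sub>R w) - norm (p - c)) / s) \<longlongrightarrow> 0) (at 0)"
      by (simp add: add_divide_distrib[symmetric])
  qed
  have "norm (F s) = norm p" for s using R by (simp add: F_def p sph)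
  then have "norm p \<le> norm (p + s *\<^sub>R w)" for s using transfer[of 0 s] by simp
  moreover have "norm (p - q) \<le> norm (p - q + s *\<^sub>R w)" for s
    using transfer[of q s] stat by (simp add: F_def)
  moreover have "w \<noteq> 0" using d R by (simp add: w_def)
  moreover have "p \<noteq> 0" using pq by (auto simp: det2_bilinear)
  ultimately have "det2 p (p - q) = 0" by (intro common_birkhoff_orthogonal[of w p "p - q"])
  then show False using pq det2_swap[of p q] by (simp add: det2_bilinear)
qed

end

section \<open>Analytic dependence of the transported point\<close>

text \<open>
  Linear coordinates on the product of the plane with the line of angles. The zero vector is not one of
  the basis vectors and is therefore free to serve as the index of an additional unknown.
\<close>

lemma product_basis:
  fixes u v :: "'a::real_normed_vector"
  assumes uv: "u \<noteq> v" "independent {u, v}" "span {u, v} = UNIV"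
  defines "B \<equiv> {(u, 0 :: real), (v, 0), (0, 1)}"
  shows "independent B" "span B = UNIV" "(u, 0 :: real) \<noteq> (v, 0)" "(0, 0) \<notin> B"
    and "fst p = representation B p (u, 0) *\<^sub>R u + representation B p (v, 0) *\<^sub>R v"
    and "snd p = representation B p (0, 1)"
proof -
  have uv0: "u \<noteq> 0" "v \<noteq> 0" using uv(2) dependent_zero by auto
  then have ne: "(u, 0 :: real) \<noteq> (v, 0)" "(u, 0 :: real) \<noteq> (0, 1)" "(v, 0 :: real) \<noteq> (0, 1)"
    using uv(1) by auto
  interpret plane u v by unfold_locales (use uv in auto)
  show ind: "independent B"
  proof (rule independent_if_scalars_zero)
    fix c and x :: "'a \<times> real" assume "(\<Sum>b\<in>B. c b *\<^sub>R b) = 0" "x \<in> B"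
    then have "c (u, 0) *\<^sub>R (u, 0 :: real) + c (v, 0) *\<^sub>R (v, 0) + c (0, 1) *\<^sub>R (0, 1) = 0"
      unfolding B_def using ne by (simp add: add.assoc)
    then have 0: "c (u, 0) *\<^sub>R u + c (v, 0) *\<^sub>R v = 0" "c (0, 1) = 0" by (auto simp: zero_prod_def)
    have "c (u, 0) = 0" "c (v, 0) = 0"
      using arg_cong[OF 0(1), of co1] arg_cong[OF 0(1), of co2] by (simp_all add: co_simps)
    then show "c x = 0" using 0(2) \<open>x \<in> B\<close> by (auto simp: B_def)
  qed (simp add: B_def)
  show span: "span B = UNIV"
  proof -
    have "p \<in> span B" for p
    proof -
      have "p = co1 (fst p) *\<^sub>R (u, 0) + co2 (fst p) *\<^sub>R (v, 0) + snd p *\<^sub>R (0, 1)"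
        using co_eq[of "fst p"] by (simp add: prod_eq_iff)
      also have "\<dots> \<in> span B" by (intro span_add span_scale span_base) (auto simp: B_def)
      finally show ?thesis .
    qed
    then show ?thesis by blast
  qed
  show "(u, 0 :: real) \<noteq> (v, 0)" "(0, 0) \<notin> B" using ne uv0 by (auto simp: B_def)
  have "(\<Sum>b\<in>B. representation B p b *\<^sub>R b) = p"
    using ind span by (intro sum_representation_eq) (auto simp: B_def)
  then have "representation B p (u, 0) *\<^sub>R (u, 0 :: real) + representation B p (v, 0) *\<^sub>R (v, 0)
      + representation B p (0, 1) *\<^sub>R (0, 1) = p"
    using ne by (simp add: B_def add.assoc)
  then show "fst p = representation B p (u, 0) *\<^sub>R u + representation B p (v, 0) *\<^sub>R v"
    and "snd p = representation B p (0, 1)"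
    by (auto simp: prod_eq_iff)
qed

context analytic_plane
begin

text \<open>
  The transported point lies on the sphere of radius \<open>norm (X y)\<close>, so it is \<open>f\<close> at some angle, scaled by
  \<open>norm (X y) / norm z\<close>. The angle is the only unknown: it is a zero of the function \<open>H\<close> below, which is
  analytic as a composition of the norm with \<open>f\<close>. By continuity the actual angle stays in the
  neighbourhood where the implicit function theorem applies.
\<close>

lemma transport_germ:
  fixes f :: "circle \<Rightarrow> 'a" and X :: "('i \<Rightarrow> real) \<Rightarrow> 'a" and T :: "('i \<Rightarrow> real) \<Rightarrow> real"
  assumes f: "circle_analytic f" "bij_betw f UNIV (sphere 0 (norm z))" "\<forall>t. norm (circle_deriv f t) = 1"
    and z: "z \<noteq> 0" and I: "finite I" "k \<notin> I"
    and X: "plane_germ (insert k I) X" "plane_germ I X" and T: "analytic_germ (insert k I) T" "analytic_germ I T"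
    and indep: "\<And>y \<theta>. X (y(k := \<theta>)) = X y" "\<And>y \<theta>. T (y(k := \<theta>)) = T y"
    and cont: "\<And>\<epsilon>. 0 < \<epsilon> \<Longrightarrow> \<exists>\<delta>>0. \<forall>y. (\<forall>i\<in>I. \<bar>y i\<bar> \<le> \<delta>) \<longrightarrow>
        dist (X y) (X (\<lambda>_. 0)) < \<epsilon> \<and> dist (T y) (T (\<lambda>_. 0)) < \<epsilon>"
    and x0: "X (\<lambda>_. 0) \<notin> span {z}"
  shows "plane_germ I (\<lambda>y. transport z (f (circle_of (T y))) (X y))"
proof -
  define x0 s0 where "x0 = X (\<lambda>_. 0)" and "s0 = T (\<lambda>_. 0)"
  define q where "q = f (circle_of s0)"
  have nf: "norm (f t) = norm z" for t using f(2) by (auto simp: bij_betw_def)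
  have x0z: "det2 z x0 \<noteq> 0" using x0 span_eq_det2[OF z] by (simp add: x0_def)
  have x0n: "x0 \<noteq> 0" "x0 \<noteq> z" using x0z by (auto simp: det2_bilinear)
  have fcont: "continuous_on UNIV f" by (rule circle_analytic_continuous[OF f(1)])
  obtain g where g: "homeomorphism UNIV (sphere 0 (norm z)) f g"
    using homeomorphism_compact[OF compact_circle fcont, of "sphere 0 (norm z)"] f(2) by (auto simp: bij_betw_def)
  \<comment> \<open>the angle at which the transported point sits on the sphere through it\<close>
  define angle where "angle = (\<lambda>(x, t). g ((norm z / norm x) *\<^sub>R transport z (f t) x))"
  have tr: "congruent_to z x (f t) (transport z (f t) x)" for x t by (rule transport[OF nf z])
  have angle: "f (angle (x, t)) = (norm z / norm x) *\<^sub>R transport z (f t) x" if "x \<noteq> 0" for x t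
    unfolding angle_def using homeomorphism_apply2[OF g] tr[of x t] that by (auto simp: congruent_to_def)
  have angle_cont: "continuous_on ((UNIV - {0}) \<times> UNIV) angle"
  proof -
    have "continuous_on ((UNIV - {0}) \<times> UNIV) (\<lambda>p. (\<lambda>(q, x). transport z q x) (f (snd p), fst p))"
      by (rule continuous_on_compose2[OF transport_continuous[OF z]])
        (auto intro!: continuous_intros continuous_on_compose2[OF fcont] simp: nf)
    then have inner: "continuous_on ((UNIV - {0}) \<times> UNIV) (\<lambda>p. (norm z / norm (fst p)) *\<^sub>R transport z (f (snd p)) (fst p))"
      by (intro continuous_intros) auto
    have "continuous_on (sphere 0 (norm z)) g" using g by (simp add: homeomorphism_def)
    from this inner have "continuous_on ((UNIV - {0}) \<times> UNIV) (\<lambda>p. g ((norm z / norm (fst p)) *\<^sub>R transport z (f (snd p)) (fst p)))"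
      by (rule continuous_on_compose2) (use tr in \<open>auto simp: congruent_to_def split: if_splits\<close>)
    then show ?thesis by (simp add: angle_def case_prod_unfold)
  qed
  define \<theta>0 where "\<theta>0 = circle_rep (angle (x0, circle_of s0))"
  define R where "R = norm x0 / norm z"
  have R: "0 < R" using x0n z by (simp add: R_def)
  define p where "p = transport z q x0"
  have p: "p = R *\<^sub>R f (circle_of \<theta>0)"
    using angle[OF x0n(1), of "circle_of s0"] x0n z by (simp add: \<theta>0_def R_def p_def q_def)
  have cong_p: "congruent_to z x0 q p" unfolding p_def q_def by (rule tr)
  have qp: "det2 q p \<noteq> 0"
    using congruent_det2_zero[of q z p x0] cong_p nf z x0z by (simp add: congruent_to_def q_def)
  have pq: "norm (p - q) = norm (x0 - z)" using cong_p by (simp add: congruent_to_def)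
  define H where "H y = norm ((norm (X y) / norm z) *\<^sub>R f (circle_of (\<theta>0 + y k)) - f (circle_of (T y))) - norm (X y - z)" for y
  define J where "J = insert k I"
  have J: "finite J" "k \<in> J" using I by (auto simp: J_def)
  have scale: "analytic_germ J (\<lambda>y. norm (X y) / norm z)"
    unfolding divide_inverse using X(1) x0n
    by (intro analytic_germ_mult analytic_germ_const germ_norm) (auto simp: x0_def J_def I)
  have H_germ: "analytic_germ J H"
    unfolding H_def[abs_def]
  proof (intro analytic_germ_diff germ_norm J)
    have "plane_germ J (\<lambda>y. f (circle_of (\<theta>0 + y k)))"
      by (intro plane_germ_circle f J analytic_germ_add analytic_germ_const analytic_germ_var)
    moreover have "plane_germ J (\<lambda>y. f (circle_of (T y)))"
      using T by (intro plane_germ_circle f J) (simp add: J_def)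
    ultimately show "plane_germ J (\<lambda>y. (norm (X y) / norm z) *\<^sub>R f (circle_of (\<theta>0 + y k)) - f (circle_of (T y)))"
      by (intro plane_germ_diff plane_germ_scale scale)
    show "plane_germ J (\<lambda>y. X y - z)"
      using X by (intro plane_germ_diff plane_germ_const) (simp add: J_def)
    have "(norm (X (\<lambda>_. 0)) / norm z) *\<^sub>R f (circle_of (\<theta>0 + 0)) - f (circle_of (T (\<lambda>_. 0))) = p - q"
      by (simp add: p R_def x0_def q_def s0_def)
    moreover have "p - q \<noteq> 0" using pq x0n by auto
    ultimately show "(norm (X (\<lambda>_. 0)) / norm z) *\<^sub>R f (circle_of (\<theta>0 + 0)) - f (circle_of (T (\<lambda>_. 0))) \<noteq> 0" by simp
    show "X (\<lambda>_. 0) - z \<noteq> 0" using x0n by (simp add: x0_def)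
  qed
  have H_axis: "H ((\<lambda>_. 0)(k := s)) = norm (R *\<^sub>R f (circle_of (\<theta>0 + s)) - q) - norm (p - q)" for s
    by (simp add: H_def indep R_def q_def pq[unfolded q_def] flip: x0_def s0_def)
  have H0: "H (\<lambda>_. 0) = 0"
    using pq by (simp add: H_def p R_def q_def flip: x0_def s0_def)
  obtain d where d: "((\<lambda>s. f (circle_of s)) has_vector_derivative d) (at \<theta>0)" "norm d = 1"
    using unit_speed[OF f(1,3)] by blast
  have "\<not> ((\<lambda>s. H ((\<lambda>_. 0)(k := s)) / s) \<longlongrightarrow> 0) (at 0)"
    unfolding H_axis using d
    by (intro distance_along_sphere_nonstationary[where d = d and m = "norm z"] nf R p qp) auto
  then obtain \<Theta> \<delta> where \<Theta>: "analytic_germ I \<Theta>" "\<Theta> (\<lambda>_. 0) = 0" "0 < \<delta>"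
    and uniq: "\<And>y \<theta>. (\<forall>i\<in>I. \<bar>y i\<bar> \<le> \<delta>) \<Longrightarrow> \<bar>\<theta>\<bar> \<le> \<delta> \<Longrightarrow> H (y(k := \<theta>)) = 0 \<Longrightarrow> \<theta> = \<Theta> y"
    by (rule analytic_germ_implicit[OF I H_germ[unfolded J_def] H0]) (rule that)
  obtain \<eta> where \<eta>: "0 < \<eta>" "\<And>x t. x \<noteq> 0 \<Longrightarrow> dist (x, t) (x0, circle_of s0) < \<eta> \<Longrightarrow> dist (angle (x, t)) (angle (x0, circle_of s0)) < \<delta>"
    using angle_cont \<Theta>(3) x0n unfolding continuous_on_iff by (fastforce simp: mem_Times_iff)
  obtain \<delta>' where \<delta>': "0 < \<delta>'" "\<And>y. \<forall>i\<in>I. \<bar>y i\<bar> \<le> \<delta>' \<Longrightarrow> dist (X y) x0 < min (\<eta> / 2) (norm x0) \<and> dist (T y) s0 < min (\<eta> / 2) (norm x0)"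
    using cont[of "min (\<eta> / 2) (norm x0)"] \<eta> x0n unfolding x0_def s0_def by fastforce
  have eq: "transport z (f (circle_of (T y))) (X y) = (norm (X y) / norm z) *\<^sub>R f (circle_of (\<theta>0 + \<Theta> y))"
    if y: "\<forall>i\<in>I. \<bar>y i\<bar> \<le> min \<delta> \<delta>'" for y
  proof -
    define t where "t = circle_of (T y)"
    have dX: "dist (X y) x0 < \<eta> / 2" "dist (X y) x0 < norm x0" and dT: "dist (T y) s0 < \<eta> / 2"
      using \<delta>'(2)[of y] y by auto
    have Xn: "X y \<noteq> 0" using dX(2) by auto
    have "dist t (circle_of s0) < \<eta> / 2"
      using dist_circle_of_le[of "T y" s0] dT by (simp add: t_def dist_real_def)
    then have "dist (X y, t) (x0, circle_of s0) < \<eta>"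
      using dX(1) real_sqrt_sum_squares_triangle_ineq[of "dist (X y) x0" 0 0 "dist t (circle_of s0)"]
      by (simp add: dist_Pair_Pair)
    then have "dist (angle (X y, t)) (circle_of \<theta>0) < \<delta>"
      using \<eta>(2)[OF Xn] by (simp add: \<theta>0_def)
    then obtain \<theta> where \<theta>: "circle_of \<theta> = angle (X y, t)" "\<bar>\<theta> - \<theta>0\<bar> < \<delta>"
      using circle_lift[of "angle (X y, t)" \<theta>0] by (metis dist_commute)
    have fl: "(norm (X y) / norm z) *\<^sub>R f (circle_of \<theta>) = transport z (f t) (X y)"
      using angle[OF Xn, of t] Xn z by (simp add: \<theta>)
    have "H (y(k := \<theta> - \<theta>0)) = norm (transport z (f t) (X y) - f t) - norm (X y - z)"
      by (simp add: H_def indep fl t_def)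
    also have "\<dots> = 0" using tr[of "X y" t] by (simp add: congruent_to_def)
    finally have "\<theta> - \<theta>0 = \<Theta> y" using y \<theta>(2) by (intro uniq) auto
    then have "\<theta> = \<theta>0 + \<Theta> y" by simp
    then show ?thesis using fl by (simp add: t_def)
  qed
  have "plane_germ I (\<lambda>y. (norm (X y) / norm z) *\<^sub>R f (circle_of (\<theta>0 + \<Theta> y)))"
    unfolding divide_inverse using X(2) x0n \<Theta>(1)
    by (intro plane_germ_scale plane_germ_circle f analytic_germ_mult analytic_germ_const germ_norm analytic_germ_add I)
      (auto simp: x0_def)
  then have g1: "analytic_germ I (\<lambda>y. co1 ((norm (X y) / norm z) *\<^sub>R f (circle_of (\<theta>0 + \<Theta> y))))"
    and g2: "analytic_germ I (\<lambda>y. co2 ((norm (X y) / norm z) *\<^sub>R f (circle_of (\<theta>0 + \<Theta> y))))"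
    by (simp_all add: plane_germ_def)
  have pos: "0 < min \<delta> \<delta>'" using \<Theta>(3) \<delta>'(1) by simp
  show ?thesis
    unfolding plane_germ_def
    by (intro conjI analytic_germ_cong[OF g1 pos] analytic_germ_cong[OF g2 pos]) (simp_all only: eq)
qed

end

context analytic_plane
begin

lemma transport_real_analytic:
  fixes f :: "circle \<Rightarrow> 'a"
  assumes f: "circle_analytic f" "bij_betw f UNIV (sphere 0 (norm z))" "\<forall>t. norm (circle_deriv f t) = 1"
    and z: "z \<noteq> 0"
  shows "analytic_on_times_circle (\<lambda>(x, t). transport z (f t) x) (UNIV - span {z})"
  unfolding analytic_on_times_circle_def real_analytic_on_def
proof (intro conjI)
  define B where "B = {(u, 0 :: real), (v, 0), (0, 1)}"
  note basis = product_basis[OF uv, folded B_def]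
  have in_B: "(u, 0) \<in> B" "(v, 0) \<in> B" "(0, 1) \<in> B" and fin: "finite B" by (auto simp: B_def)
  have "closed {x. det2 z x = 0}" by (intro closed_Collect_eq continuous_intros)
  moreover have "span {z} = {x. det2 z x = 0}" using span_eq_det2[OF z] by blast
  ultimately show "open ((UNIV - span {z}) \<times> (UNIV :: real set))"
    by (auto intro!: open_Times simp: open_Diff)
  have rep: "co1 (fst p) = representation B p (u, 0)" "co2 (fst p) = representation B p (v, 0)" for p
    by (subst basis(5), simp add: co_simps)+
  obtain K1 K2 where K12: "\<And>x. norm (co1 x) \<le> norm x * K1" "\<And>x. norm (co2 x) \<le> norm x * K2" "0 < K1" "0 < K2"
    using bounded_linear.pos_bounded[OF bounded_linear_co(1)] bounded_linear.pos_bounded[OF bounded_linear_co(2)] by blast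
  define K where "K = max 1 (max K1 K2)"
  have K: "1 \<le> K" by (simp add: K_def)
  have coK: "\<bar>co1 x\<bar> \<le> norm x * K" "\<bar>co2 x\<bar> \<le> norm x * K" for x
  proof -
    have "norm x * K1 \<le> norm x * K" "norm x * K2 \<le> norm x * K" by (auto intro!: mult_left_mono simp: K_def)
    then show "\<bar>co1 x\<bar> \<le> norm x * K" "\<bar>co2 x\<bar> \<le> norm x * K" using K12(1,2)[of x] by auto
  qed
  show "\<exists>B. finite B \<and> independent B \<and> span B = UNIV \<and> (\<forall>a\<in>(UNIV - span {z}) \<times> UNIV. \<exists>\<epsilon>>0. \<exists>c. \<forall>x\<in>ball a \<epsilon>.
      ((\<lambda>\<alpha>. (\<Prod>b\<in>B. representation B (x - a) b ^ \<alpha> b) *\<^sub>R c \<alpha>) has_sum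
        (case x of (x, s) \<Rightarrow> (case (x, circle_of s) of (x, t) \<Rightarrow> transport z (f t) x))) (B \<rightarrow>\<^sub>E UNIV))"
  proof (intro exI[of _ B] conjI ballI fin basis(1,2))
    fix a :: "'a \<times> real" assume a: "a \<in> (UNIV - span {z}) \<times> UNIV"
    define X where "X y = fst a + (y (u, 0) *\<^sub>R u + y (v, 0) *\<^sub>R v)" for y :: "'a \<times> real \<Rightarrow> real"
    define T where "T y = snd a + y (0, 1)" for y :: "'a \<times> real \<Rightarrow> real"
    have XT: "plane_germ J X" "analytic_germ J T" if "finite J" "B \<subseteq> J" for J
      unfolding X_def[abs_def] T_def[abs_def] using that in_B
      by (auto intro!: plane_germ_add plane_germ_const plane_germ_scale analytic_germ_add analytic_germ_const analytic_germ_var)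
    have germ: "plane_germ B (\<lambda>y. transport z (f (circle_of (T y))) (X y))"
    proof (rule transport_germ[OF f z fin basis(4)])
      show "plane_germ (insert (0, 0) B) X" "plane_germ B X" "analytic_germ (insert (0, 0) B) T" "analytic_germ B T"
        using XT(1)[of "insert (0, 0) B"] XT(1)[of B] XT(2)[of "insert (0, 0) B"] XT(2)[of B] fin by auto
      show "X (y((0, 0) := \<theta>)) = X y" "T (y((0, 0) := \<theta>)) = T y" for y \<theta>
        using basis(4) in_B by (auto simp: X_def T_def)
      show "X (\<lambda>_. 0) \<notin> span {z}" using a by (auto simp: X_def)
      fix \<epsilon> :: real assume \<epsilon>: "0 < \<epsilon>"
      define S where "S = 1 + norm u + norm v"
      have S: "1 \<le> S" by (simp add: S_def)
      have "dist (X y) (X (\<lambda>_. 0)) < \<epsilon> \<and> dist (T y) (T (\<lambda>_. 0)) < \<epsilon>" if y: "\<forall>i\<in>B. \<bar>y i\<bar> \<le> \<epsilon> / (2 * S)" for y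
      proof
        have yb: "\<bar>y (u, 0)\<bar> \<le> \<epsilon> / (2 * S)" "\<bar>y (v, 0)\<bar> \<le> \<epsilon> / (2 * S)" "\<bar>y (0, 1)\<bar> \<le> \<epsilon> / (2 * S)"
          using y in_B by auto
        have "dist (X y) (X (\<lambda>_. 0)) \<le> \<bar>y (u, 0)\<bar> * norm u + \<bar>y (v, 0)\<bar> * norm v"
          using norm_triangle_ineq[of "y (u, 0) *\<^sub>R u" "y (v, 0) *\<^sub>R v"] by (simp add: X_def dist_norm)
        also have "\<dots> \<le> \<epsilon> / (2 * S) * norm u + \<epsilon> / (2 * S) * norm v"
          using yb by (intro add_mono mult_right_mono) auto
        also have "\<dots> = \<epsilon> / (2 * S) * (S - 1)" unfolding S_def distrib_left[symmetric] by simp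
        also have "\<dots> \<le> \<epsilon> / (2 * S) * S" using \<epsilon> S by (intro mult_left_mono) auto
        also have "\<dots> < \<epsilon>" using \<epsilon> S by simp
        finally show "dist (X y) (X (\<lambda>_. 0)) < \<epsilon>" .
        have "\<epsilon> / (2 * S) \<le> \<epsilon> / 2" using \<epsilon> S by (intro divide_left_mono) auto
        then show "dist (T y) (T (\<lambda>_. 0)) < \<epsilon>" using yb(3) \<epsilon> by (simp add: T_def dist_real_def)
      qed
      then show "\<exists>\<delta>>0. \<forall>y. (\<forall>i\<in>B. \<bar>y i\<bar> \<le> \<delta>) \<longrightarrow> dist (X y) (X (\<lambda>_. 0)) < \<epsilon> \<and> dist (T y) (T (\<lambda>_. 0)) < \<epsilon>"
        using \<epsilon> S by (intro exI[of _ "\<epsilon> / (2 * S)"]) auto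
    qed
    define G where "G y = transport z (f (circle_of (T y))) (X y)" for y
    obtain \<rho>1 C1 \<rho>2 C2 where m: "0 < \<rho>1" "majorized B \<rho>1 (\<lambda>y. co1 (G y)) C1" "0 < \<rho>2" "majorized B \<rho>2 (\<lambda>y. co2 (G y)) C2"
      using germ unfolding plane_germ_def analytic_germ_def G_def by blast
    define \<rho> where "\<rho> = min \<rho>1 \<rho>2"
    have \<rho>: "0 < \<rho>" using m by (simp add: \<rho>_def)
    have "majorized B \<rho> (\<lambda>y. co1 (G y)) C1" "majorized B \<rho> (\<lambda>y. co2 (G y)) C2"
      using majorized_mono[OF m(2) \<rho>, of C1] majorized_mono[OF m(4) \<rho>, of C2] by (simp_all add: \<rho>_def)
    then obtain c1 c2 where
      c1: "\<And>y. \<forall>i\<in>B. \<bar>y i\<bar> \<le> \<rho> \<Longrightarrow> ((\<lambda>\<alpha>. c1 \<alpha> * monomial B y \<alpha>) has_sum co1 (G y)) (B \<rightarrow>\<^sub>E UNIV)" and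
      c2: "\<And>y. \<forall>i\<in>B. \<bar>y i\<bar> \<le> \<rho> \<Longrightarrow> ((\<lambda>\<alpha>. c2 \<alpha> * monomial B y \<alpha>) has_sum co2 (G y)) (B \<rightarrow>\<^sub>E UNIV)"
      unfolding majorized_def expansion_def by blast
    have "((\<lambda>\<alpha>. (\<Prod>b\<in>B. representation B (x - a) b ^ \<alpha> b) *\<^sub>R (c1 \<alpha> *\<^sub>R u + c2 \<alpha> *\<^sub>R v)) has_sum
        (case x of (x, s) \<Rightarrow> (case (x, circle_of s) of (x, t) \<Rightarrow> transport z (f t) x))) (B \<rightarrow>\<^sub>E UNIV)"
      if x: "x \<in> ball a (\<rho> / K)" for x
    proof -
      define y where "y = representation B (x - a)"
      have nx: "norm (x - a) * K < \<rho>"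
        using x K by (simp add: dist_norm norm_minus_commute pos_less_divide_eq)
      have "norm (fst (x - a)) * K \<le> norm (x - a) * K" "norm (snd (x - a)) * 1 \<le> norm (x - a) * K"
        using K norm_fst_le[of "fst (x - a)" "snd (x - a)"] norm_snd_le[of "snd (x - a)" "fst (x - a)"]
          mult_mono[of "norm (snd (x - a))" "norm (x - a)" 1 K]
        unfolding prod.collapse by (auto intro!: mult_right_mono simp del: fst_diff snd_diff)
      then have "\<bar>y (u, 0)\<bar> \<le> \<rho>" "\<bar>y (v, 0)\<bar> \<le> \<rho>" "\<bar>y (0, 1)\<bar> \<le> \<rho>"
        using nx coK[of "fst (x - a)"] unfolding y_def rep[symmetric] basis(6)[symmetric] by auto
      then have y: "\<forall>i\<in>B. \<bar>y i\<bar> \<le> \<rho>" by (auto simp: B_def)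
      have "X y = fst x" "T y = snd x"
        unfolding X_def T_def y_def basis(5)[symmetric] basis(6)[symmetric] by simp_all
      then have G: "G y = (case x of (x, s) \<Rightarrow> (case (x, circle_of s) of (x, t) \<Rightarrow> transport z (f t) x))"
        by (simp add: G_def case_prod_unfold)
      have "((\<lambda>\<alpha>. (c1 \<alpha> * monomial B y \<alpha>) *\<^sub>R u + (c2 \<alpha> * monomial B y \<alpha>) *\<^sub>R v) has_sum
          co1 (G y) *\<^sub>R u + co2 (G y) *\<^sub>R v) (B \<rightarrow>\<^sub>E UNIV)"
        by (intro has_sum_add has_sum_bounded_linear[OF bounded_linear_scaleR_left] c1[OF y] c2[OF y])
      moreover have "co1 (G y) *\<^sub>R u + co2 (G y) *\<^sub>R v = G y" by (rule co_eq[symmetric])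
      ultimately show ?thesis
        unfolding G[symmetric] y_def[symmetric] by (simp add: monomial_def scaleR_right_distrib mult.commute)
    qed
    then show "\<exists>\<epsilon>>0. \<exists>c. \<forall>x\<in>ball a \<epsilon>. ((\<lambda>\<alpha>. (\<Prod>b\<in>B. representation B (x - a) b ^ \<alpha> b) *\<^sub>R c \<alpha>) has_sum
        (case x of (x, s) \<Rightarrow> (case (x, circle_of s) of (x, t) \<Rightarrow> transport z (f t) x))) (B \<rightarrow>\<^sub>E UNIV)"
      using \<rho> K by (intro exI[of _ "\<rho> / K"] conjI exI[of _ "\<lambda>\<alpha>. c1 \<alpha> *\<^sub>R u + c2 \<alpha> *\<^sub>R v"] ballI) auto
  qed
qed

end

section \<open>The rotation map\<close>

context strict_plane
begin

text \<open>
  The triangle \<open>0, q, p\<close> may be read with the roles of \<open>q\<close> and \<open>p\<close> exchanged; both orientations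
  then change sign. So the same uniqueness and existence statements also determine \<open>q\<close>
  from \<open>p\<close>, which makes each orbit of the rotation map a bijection.
\<close>

lemma congruent_to_exchange:
  assumes "norm q = norm z" "norm p = norm x"
  shows "congruent_to z x q p \<longleftrightarrow> congruent_to x z p q"
  using assms det2_swap[of z x] det2_swap[of q p] by (auto simp: congruent_to_def norm_minus_commute)

lemma transport_rotation_map:
  assumes f: "continuous_on UNIV f" "\<And>t. norm (f t) = norm z" "f 0 = z" and z: "z \<noteq> 0"
  shows "rotation_map z f (\<lambda>(x, t). transport z (f t) x)"
  unfolding rotation_map_def
proof (intro conjI allI)
  have "continuous_on UNIV (\<lambda>p. (\<lambda>(q, x). transport z q x) (f (snd p), fst p))"
    by (rule continuous_on_compose2[OF transport_continuous[OF z]])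
      (auto intro!: continuous_intros continuous_on_compose2[OF f(1)] simp: f(2))
  then show "continuous_on UNIV (\<lambda>(x, t). transport z (f t) x)" by (simp add: case_prod_unfold)
  have zz: "transport z (f t) z = f t" for t using transport_collinear[OF f(2) z, of t 1] by simp
  show "(case (z, t) of (x, t) \<Rightarrow> transport z (f t) x) = f t" for t by (simp add: zz)
  show "(case (x, 0) of (x, t) \<Rightarrow> transport z (f t) x) = x" for x
    using transport_eqI[of z z x x] z f(3) by (simp add: congruent_to_def)
  fix x t
  have "congruent_to z x (f t) (transport z (f t) x)" by (rule transport[OF f(2) z])
  then show "norm (case (x, t) of (x, t) \<Rightarrow> transport z (f t) x) = norm x"
    "norm ((case (x, t) of (x, t) \<Rightarrow> transport z (f t) x) - (case (z, t) of (x, t) \<Rightarrow> transport z (f t) x)) = norm (x - z)"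
    by (simp_all add: zz congruent_to_def)
qed

text \<open>
  The conditions on the norms leave two candidates, one on each side of the line through \<open>f t\<close>. The
  orientation \<open>\<sigma>\<close> is continuous without zeros on the connected circle and positive at \<open>0\<close>
  when \<open>x\<close> is off \<open>span {z}\<close>, so the side never changes.
\<close>

lemma rotation_map_unique:
  assumes f: "continuous_on UNIV f" "\<And>t. norm (f t) = norm z" "f 0 = z" and z: "z \<noteq> 0"
    and r: "rotation_map z f r"
  shows "r = (\<lambda>(x, t). transport z (f t) x)"
proof (rule ext, clarify)
  fix x t
  have cont: "continuous_on UNIV r" and rz: "\<And>t. r (z, t) = f t" and r0: "r (x, 0) = x"
    and n: "\<And>t. norm (r (x, t)) = norm x" "\<And>t. norm (r (x, t) - f t) = norm (x - z)"
    using r by (auto simp: rotation_map_def)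
  define \<sigma> where "\<sigma> t = det2 z x * det2 (f t) (r (x, t))" for t
  have "0 \<le> \<sigma> t"
  proof (cases "det2 z x = 0")
    case False
    have nz: "\<sigma> t \<noteq> 0" for t
      using congruent_det2_zero[OF f(2) z n(1) n(2), of t] False by (simp add: \<sigma>_def)
    have "continuous_on UNIV \<sigma>"
      unfolding \<sigma>_def by (intro continuous_intros f(1) continuous_on_compose2[OF cont]) auto
    then have conn: "connected (range \<sigma>)" using connected_circle by (rule connected_continuous_image)
    have "0 < \<sigma> 0" using False by (simp add: \<sigma>_def f(3) r0 not_square_less_zero zero_less_mult_iff) linarith
    show ?thesis
    proof (rule ccontr)
      assume "\<not> 0 \<le> \<sigma> t"
      then have "0 \<in> range \<sigma>"
        using conn \<open>0 < \<sigma> 0\<close> unfolding connected_iff_interval by (meson less_imp_le not_le rangeI)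
      then show False using nz by (metis rangeE)
    qed
  qed (simp add: \<sigma>_def)
  then have "congruent_to z x (f t) (r (x, t))" using n by (simp add: congruent_to_def \<sigma>_def)
  then show "r (x, t) = transport z (f t) x" using transport_eqI[OF f(2) z] by simp
qed

lemma transport_side:
  assumes q: "norm q = norm z" "z \<noteq> 0" and xy: "x \<notin> span {z}" "y \<notin> span {z}"
  shows "connected_component (UNIV - span {z}) x y \<longleftrightarrow>
    connected_component (UNIV - span {q}) (transport z q x) (transport z q y)"
proof -
  have q0: "q \<noteq> 0" using q by auto
  have s: "sgn (det2 q (transport z q w)) = sgn (det2 z w)" for w
    by (rule congruent_side[OF q transport[OF q]])
  have "transport z q w \<notin> span {q}" if "w \<notin> span {z}" for w
    using s[of w] that span_eq_det2[OF q(2)] span_eq_det2[OF q0] by (metis sgn_0_0)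
  moreover have "0 < a * b \<longleftrightarrow> 0 < sgn a * sgn b" for a b :: real
    by (auto simp: sgn_if zero_less_mult_iff)
  ultimately show ?thesis
    using same_side_iff_connected[OF q(2) xy] same_side_iff_connected[OF q0] xy s by metis
qed

lemma transport_homeomorphism:
  assumes q: "norm q = norm z" "z \<noteq> 0"
  shows "homeomorphism UNIV UNIV (transport z q) (transport q z)"
proof -
  have q0: "q \<noteq> 0" using q by auto
  have "continuous_on UNIV (transport z q)" if "norm q = norm z" "z \<noteq> 0" for z q
  proof -
    have "continuous_on UNIV (\<lambda>x. (\<lambda>(q, x). transport z q x) (q, x))"
      by (rule continuous_on_compose2[OF transport_continuous[OF that(2)]])
        (use that in \<open>auto intro!: continuous_intros\<close>)
    then show ?thesis by simp
  qed
  from this[OF q] this[OF q(1)[symmetric] q0]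
  show ?thesis
    using transport_inverse[OF q] transport_inverse[OF q(1)[symmetric] q0]
    by (intro homeomorphismI) auto
qed

lemma transport_orbit_homeomorphism:
  assumes f: "continuous_on UNIV f" "bij_betw f UNIV (sphere 0 (norm z))" and z: "z \<noteq> 0" and x: "x \<noteq> 0"
  shows "\<exists>g. homeomorphism (UNIV :: circle set) (sphere 0 (norm x)) (\<lambda>t. transport z (f t) x) g"
proof -
  have nf: "norm (f t) = norm z" for t using f(2) by (auto simp: bij_betw_def)
  have tr: "congruent_to z x (f t) (transport z (f t) x)" for t by (rule transport[OF nf z])
  have tn: "norm (transport z (f t) x) = norm x" for t using tr by (simp add: congruent_to_def)
  have cont: "continuous_on UNIV (\<lambda>t. transport z (f t) x)"
  proof -
    have "continuous_on UNIV (\<lambda>t. (\<lambda>(q, x). transport z q x) (f t, x))"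
      by (rule continuous_on_compose2[OF transport_continuous[OF z]])
        (auto intro!: continuous_intros f(1) simp: nf)
    then show ?thesis by simp
  qed
  have "inj (\<lambda>t. transport z (f t) x)"
  proof (rule injI)
    fix s t assume e: "transport z (f s) x = transport z (f t) x"
    have "congruent_to x z (transport z (f t) x) (f t)" for t
      using tr congruent_to_exchange[OF nf tn] by simp
    then have "f s = f t" using congruent_unique[OF tn x] e by metis
    then show "s = t" using f(2) by (auto simp: bij_betw_def inj_eq)
  qed
  moreover have "p \<in> range (\<lambda>t. transport z (f t) x)" if p: "norm p = norm x" for p
  proof -
    obtain q where q: "congruent_to x z p q" using congruent_exists[OF p x] by blast
    then have "q \<in> range f" using f(2) by (simp add: congruent_to_def bij_betw_def)
    then obtain t where "q = f t" by blast
    then have "transport z (f t) x = p"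
      using q congruent_to_exchange[OF nf p] by (intro transport_eqI nf z) simp
    then show ?thesis by blast
  qed
  moreover from this have "range (\<lambda>t. transport z (f t) x) = sphere 0 (norm x)"
    using tn by (intro set_eqI) auto
  ultimately show ?thesis
    using homeomorphism_compact[OF compact_circle cont, of "sphere 0 (norm x)"] by blast
qed

lemma transport_neg:
  assumes "norm q = norm z" "z \<noteq> 0"
  shows "transport z (- q) x = - transport z q x"
proof (rule transport_eqI)
  have "norm (- transport z q x - - q) = norm (transport z q x - q)"
    by (metis minus_diff_minus norm_minus_cancel)
  then show "congruent_to z x (- q) (- transport z q x)"
    using transport[OF assms, of x] by (simp add: congruent_to_def det2_bilinear)
qed (use assms in auto)

end

theorem theorem4p4:
  fixes z :: "'a::real_normed_vector" and f :: "circle \<Rightarrow> 'a"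
  assumes "normed_plane TYPE('a)" and "analytic_norm TYPE('a)" and "\<not> euclidean_norm TYPE('a)"
    and "z \<noteq> 0"
    and "circle_analytic f" and "bij_betw f UNIV (sphere 0 (norm z))"
    and "f 0 = z" and "\<forall>t. norm (circle_deriv f t) = 1"
  shows "(\<exists>!r. rotation_map z f r) \<and>
    (\<forall>r. rotation_map z f r \<longrightarrow>
      analytic_on_times_circle r (UNIV - span {z}) \<and>
      (\<forall>x \<in> UNIV - span {z}. \<forall>y \<in> UNIV - span {z}. \<forall>t.
         connected_component (UNIV - span {z}) x y \<longleftrightarrow>
         connected_component (UNIV - span {f t}) (r (x, t)) (r (y, t))) \<and>
      (\<forall>t. \<exists>g. homeomorphism UNIV UNIV (\<lambda>x. r (x, t)) g) \<and>
      (\<forall>x. x \<noteq> 0 \<longrightarrow> (\<exists>g. homeomorphism UNIV (sphere 0 (norm x)) (\<lambda>t. r (x, t)) g)) \<and>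
      (\<forall>x t. r (x, antipode t) = - r (x, t)))"
proof -
  obtain B where B: "finite B" "independent B" "span B = (UNIV :: 'a set)" and ser:
    "\<forall>a\<in>UNIV - {0::'a}. \<exists>\<epsilon>>0. \<exists>c. \<forall>x\<in>ball a \<epsilon>.
      ((\<lambda>\<alpha>. (\<Prod>b\<in>B. representation B (x - a) b ^ \<alpha> b) *\<^sub>R c \<alpha>) has_sum norm x) (B \<rightarrow>\<^sub>E UNIV)"
    using assms(2) unfolding analytic_norm_def real_analytic_on_def by auto
  have "card B = 2"
    using dim_eq_card[of B UNIV] B assms(1) by (simp add: normed_plane_def)
  then obtain u v where uv: "B = {u, v}" "u \<noteq> v" by (auto simp: card_2_iff)
  interpret analytic_plane u v
  proof
    show "u \<noteq> v" "independent {u, v}" "span {u, v} = UNIV" using B uv by auto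
    show "\<exists>\<epsilon>>0. \<exists>c. \<forall>x\<in>ball a \<epsilon>. ((\<lambda>\<alpha>. (\<Prod>b\<in>{u, v}. representation {u, v} (x - a) b ^ \<alpha> b) *\<^sub>R c \<alpha>)
        has_sum norm x) ({u, v} \<rightarrow>\<^sub>E UNIV)" if "a \<noteq> 0" for a
      using ser that unfolding uv(1) by simp
  qed
  have fcont: "continuous_on UNIV f" by (rule circle_analytic_continuous[OF assms(5)])
  have nf: "norm (f t) = norm z" for t using assms(6) by (auto simp: bij_betw_def)
  have rot: "rotation_map z f (\<lambda>(x, t). transport z (f t) x)"
    by (rule transport_rotation_map[OF fcont nf assms(7,4)])
  have uniq: "r = (\<lambda>(x, t). transport z (f t) x)" if "rotation_map z f r" for r
    by (rule rotation_map_unique[OF fcont nf assms(7,4) that])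
  have anti: "f (antipode t) = - f t" for t
    by (rule unit_speed_antipode[OF unit_speed[OF assms(5,8)] fcont assms(6)]) (use assms(4) in simp)
  show ?thesis
  proof (intro conjI allI impI)
    show "\<exists>!r. rotation_map z f r" using rot uniq by blast
    fix r assume "rotation_map z f r"
    then have r: "r = (\<lambda>(x, t). transport z (f t) x)" by (rule uniq)
    show "analytic_on_times_circle r (UNIV - span {z})"
      unfolding r by (rule transport_real_analytic[OF assms(5,6,8,4)])
    show "\<forall>x \<in> UNIV - span {z}. \<forall>y \<in> UNIV - span {z}. \<forall>t.
         connected_component (UNIV - span {z}) x y \<longleftrightarrow>
         connected_component (UNIV - span {f t}) (r (x, t)) (r (y, t))"
      using transport_side[OF nf assms(4)] by (simp add: r)
    show "\<exists>g. homeomorphism UNIV UNIV (\<lambda>x. r (x, t)) g" for t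
      using transport_homeomorphism[OF nf assms(4)] by (auto simp: r)
    show "\<exists>g. homeomorphism UNIV (sphere 0 (norm x)) (\<lambda>t. r (x, t)) g" if "x \<noteq> 0" for x
      using transport_orbit_homeomorphism[OF fcont assms(6,4) that] by (simp add: r)
    show "r (x, antipode t) = - r (x, t)" for x t
      using transport_neg[OF nf assms(4)] by (simp add: r anti)
  qed
qed

end
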